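(* Let $K$ be a field and let $A$ be a central simple finitely generated $K$-algebra of Gelfand-Kirillov dimension $n:=\mathrm{GK}(A)$ (over $K$) with $0<n<\infty$. Let $C$ be a commutative subalgebra of $A$. Then $$\mathrm{GK}(C)\leq \mathrm{GK}(A)\left(1-\frac{1}{f_A+\max\{f_A,1\}}\right),$$ where $f_A:=\max\{\mathrm{d}_{Q_m}(Q_m\otimes_K A)\mid 0\leq m\leq n\}$ ($m$ an integer), $Q_0:=K$, and $Q_m:=K(x_1,\ldots,x_m)$ is the rational function field in $m$ indeterminates.
   Context: Algebras are associative with $1$. A $K$-algebra $A$ is central if its centre is $Z(A)=K$. For a function $f:\mathbb{N}\to\mathbb{N}$ put $\gamma(f):=\inf\{r\in\mathbb{R}\mid f(i)\leq i^r \text{ for } i\gg 0\}\in[0,\infty]$. For a finitely generated algebra $A=k\langle a_1,\ldots,a_s\rangle$ over a field $k$, the standard filtration associated with the generators is $A_0=k$, $A_1=k+\sum_{j}ka_j$, $A_i=A_1^i$; the Gelfand-Kirillov dimension is $\mathrm{GK}_k(A)=\gamma(i\mapsto\dim_k A_i)$ (independent of the generators). For an algebra that is not finitely generated, $\mathrm{GK}$ is the supremum over its finitely generated subalgebras. $\mathrm{GK}=\mathrm{GK}_K$. Filter dimensions: let $A$ be a simple finitely generated algebra over a field $k$ whose centre is algebraic over $k$, and let $F=\{A_i\}$ be a standard filtration. Define $\nu_F(i):=\min\{j\in\mathbb{N}\mid 1\in A_jaA_j \text{ for all } 0\neq a\in A_i\}$ and $\lambda_F(i):=\min\{j\in\mathbb{N}\mid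 1\in AaA_j\text{ for all }0\neq a\in A_i\}$, where $A_jaA_j$ is the $k$-span of all $xay$ with $x,y\in A_j$, and $AaA_j$ is the left ideal of $A$ generated by $aA_j$. The filter dimension is $\mathrm{fd}_k(A):=\gamma(\nu_F)$ and the left filter dimension is $\mathrm{lfd}_k(A):=\gamma(\lambda_F)$ (both independent of the choice of $F$). The symbol $\mathrm{d}_k$ denotes either $\mathrm{fd}_k$ or $\mathrm{lfd}_k$ (one fixed choice; the statement is asserted for each choice). Here $Q_m\otimes_K A$ is regarded as a $Q_m$-algebra, so $k=Q_m$. If $f_A=\infty$, the fraction $1/(f_A+\max\{f_A,1\})$ is read as $0$. *)

theory Defs
  imports
    "HOL-Algebra.Embedded_Algebras"
    "HOL-Algebra.Generated_Rings"
    "HOL-Algebra.QuotRing"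
    "HOL-Algebra.Algebraic_Closure_Type"
    "HOL-Computational_Algebra.Fraction_Field"
    "HOL-Library.Poly_Mapping"
    "HOL-Library.Extended_Nonnegative_Real"
begin

section \<open>Growth of functions on the natural numbers\<close>

text \<open>The infimum is taken in \<open>[0, \<infinity>]\<close>: \<^const>\<open>ennreal\<close> sends negative exponents to \<open>0\<close> and
  the infimum of the empty set is \<open>\<infinity>\<close>.\<close>

definition growth_degree :: "(nat \<Rightarrow> nat) \<Rightarrow> ennreal" where
  "growth_degree f =
     Inf {ennreal r | r :: real. \<forall>\<^sub>F i in sequentially. real (f i) \<le> real i powr r}"


section \<open>Simple rings, centre\<close>

definition ring_centre :: "('a, 'b) ring_scheme \<Rightarrow> 'a set" where
  "ring_centre R = {z \<in> carrier R. \<forall>x \<in> carrier R. z \<otimes>\<^bsub>R\<^esub> x = x \<otimes>\<^bsub>R\<^esub> z}"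

definition simple_ring :: "('a, 'b) ring_scheme \<Rightarrow> bool" where
  "simple_ring R \<longleftrightarrow> ring R \<and> carrier R \<noteq> {\<zero>\<^bsub>R\<^esub>} \<and>
     (\<forall>I. ideal I R \<longrightarrow> I = {\<zero>\<^bsub>R\<^esub>} \<or> I = carrier R)"


section \<open>Standard filtrations and Gelfand-Kirillov dimension\<close>

text \<open>Throughout, an algebra over a field is a ring \<open>R\<close> together with the image \<open>k\<close> of the base
  field, a central subfield of \<open>R\<close>. Subalgebras and subspaces are subsets of the carrier of \<open>R\<close>.\<close>

definition subspace_span :: "('a, 'b) ring_scheme \<Rightarrow> 'a set \<Rightarrow> 'a set \<Rightarrow> 'a set" where
  "subspace_span R k V = (\<Union>us \<in> {us. set us \<subseteq> V}. ring.Span R k us)"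

primrec standard_filtration ::
    "('a, 'b) ring_scheme \<Rightarrow> 'a set \<Rightarrow> 'a set \<Rightarrow> nat \<Rightarrow> 'a set" where
  "standard_filtration R k S 0 = k"
| "standard_filtration R k S (Suc i) =
     subspace_span R k {x \<otimes>\<^bsub>R\<^esub> y | x y.
       x \<in> standard_filtration R k S i \<and> y \<in> subspace_span R k (insert \<one>\<^bsub>R\<^esub> S)}"

definition algebra_generators ::
    "('a, 'b) ring_scheme \<Rightarrow> 'a set \<Rightarrow> 'a set \<Rightarrow> 'a set \<Rightarrow> bool" where
  "algebra_generators R k C S \<longleftrightarrow>
     finite S \<and> S \<subseteq> carrier R \<and> generate_ring R (k \<union> S) = C"

definition finitely_generated_algebra ::
    "('a, 'b) ring_scheme \<Rightarrow> 'a set \<Rightarrow> 'a set \<Rightarrow> bool" where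
  "finitely_generated_algebra R k C \<longleftrightarrow> (\<exists>S. algebra_generators R k C S)"

text \<open>The dimensions below do not depend on the finite generating set; one is chosen.\<close>

definition chosen_filtration ::
    "('a, 'b) ring_scheme \<Rightarrow> 'a set \<Rightarrow> 'a set \<Rightarrow> nat \<Rightarrow> 'a set" where
  "chosen_filtration R k C = standard_filtration R k (SOME S. algebra_generators R k C S)"

definition fg_GK_dim :: "('a, 'b) ring_scheme \<Rightarrow> 'a set \<Rightarrow> 'a set \<Rightarrow> ennreal" where
  "fg_GK_dim R k C = growth_degree (\<lambda>i. ring.dim R k (chosen_filtration R k C i))"

definition GK_dim :: "('a, 'b) ring_scheme \<Rightarrow> 'a set \<Rightarrow> 'a set \<Rightarrow> ennreal" where
  "GK_dim R k C =
     (if finitely_generated_algebra R k C then fg_GK_dim R k C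
      else (SUP D \<in> {D. D \<subseteq> C \<and> finitely_generated_algebra R k D}. fg_GK_dim R k D))"


section \<open>Filter dimensions\<close>

text \<open>For simple finitely generated algebras with centre algebraic over \<open>k\<close> the minima exist.
  The span of all \<open>x a y\<close> with \<open>x\<close> in \<open>R\<close> and \<open>y\<close> in \<open>F j\<close> is the left ideal generated by \<open>a F j\<close>.\<close>

definition return_function ::
    "('a, 'b) ring_scheme \<Rightarrow> 'a set \<Rightarrow> (nat \<Rightarrow> 'a set) \<Rightarrow> nat \<Rightarrow> nat" where
  "return_function R k F i = (LEAST j. \<forall>a \<in> F i - {\<zero>\<^bsub>R\<^esub>}.
     \<one>\<^bsub>R\<^esub> \<in> subspace_span R k {x \<otimes>\<^bsub>R\<^esub> a \<otimes>\<^bsub>R\<^esub> y | x y. x \<in> F j \<and> y \<in> F j})"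

definition left_return_function ::
    "('a, 'b) ring_scheme \<Rightarrow> 'a set \<Rightarrow> (nat \<Rightarrow> 'a set) \<Rightarrow> nat \<Rightarrow> nat" where
  "left_return_function R k F i = (LEAST j. \<forall>a \<in> F i - {\<zero>\<^bsub>R\<^esub>}.
     \<one>\<^bsub>R\<^esub> \<in> subspace_span R k {x \<otimes>\<^bsub>R\<^esub> a \<otimes>\<^bsub>R\<^esub> y | x y. x \<in> carrier R \<and> y \<in> F j})"

definition filter_dim :: "('a, 'b) ring_scheme \<Rightarrow> 'a set \<Rightarrow> ennreal" where
  "filter_dim R k = growth_degree (return_function R k (chosen_filtration R k (carrier R)))"

definition left_filter_dim :: "('a, 'b) ring_scheme \<Rightarrow> 'a set \<Rightarrow> ennreal" where
  "left_filter_dim R k =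
     growth_degree (left_return_function R k (chosen_filtration R k (carrier R)))"


section \<open>Tensor products of algebras\<close>

text \<open>For \<open>K\<close>-algebras \<open>S\<close>, \<open>A\<close> with structure maps \<open>\<sigma>\<close>, \<open>\<iota>\<close>: the free abelian group on
  \<open>S \<times> A\<close>, multiplied by \<open>(s, a) (t, b) = (s t, a b)\<close>, modulo the bilinearity relations. As
  the images of \<open>K\<close> are central, the subgroup generated by the relations is already an ideal.\<close>

definition tensor_presentation ::
    "('s, 'c) ring_scheme \<Rightarrow> ('a, 'b) ring_scheme \<Rightarrow> (('s \<times> 'a) \<Rightarrow>\<^sub>0 int) ring" where
  "tensor_presentation S A =
     \<lparr>carrier = {f. Poly_Mapping.keys f \<subseteq> carrier S \<times> carrier A},
      monoid.mult = (\<lambda>f g. frag_extend (\<lambda>(s, a).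
                frag_extend (\<lambda>(t, b). frag_of (s \<otimes>\<^bsub>S\<^esub> t, a \<otimes>\<^bsub>A\<^esub> b)) g) f),
      one = frag_of (\<one>\<^bsub>S\<^esub>, \<one>\<^bsub>A\<^esub>),
      ring.zero = 0,
      add = (+)\<rparr>"

definition tensor_relations ::
    "('s, 'c) ring_scheme \<Rightarrow> ('k \<Rightarrow> 's) \<Rightarrow> ('a, 'b) ring_scheme \<Rightarrow> ('k \<Rightarrow> 'a) \<Rightarrow>
      (('s \<times> 'a) \<Rightarrow>\<^sub>0 int) set" where
  "tensor_relations S \<sigma> A \<iota> =
     {frag_of (s \<oplus>\<^bsub>S\<^esub> t, a) - frag_of (s, a) - frag_of (t, a) | s t a.
        s \<in> carrier S \<and> t \<in> carrier S \<and> a \<in> carrier A}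
   \<union> {frag_of (s, a \<oplus>\<^bsub>A\<^esub> b) - frag_of (s, a) - frag_of (s, b) | s a b.
        s \<in> carrier S \<and> a \<in> carrier A \<and> b \<in> carrier A}
   \<union> {frag_of (s \<otimes>\<^bsub>S\<^esub> \<sigma> c, a) - frag_of (s, \<iota> c \<otimes>\<^bsub>A\<^esub> a) | s c a.
        s \<in> carrier S \<and> a \<in> carrier A}"

definition tensor_ideal ::
    "('s, 'c) ring_scheme \<Rightarrow> ('k \<Rightarrow> 's) \<Rightarrow> ('a, 'b) ring_scheme \<Rightarrow> ('k \<Rightarrow> 'a) \<Rightarrow>
      (('s \<times> 'a) \<Rightarrow>\<^sub>0 int) set" where
  "tensor_ideal S \<sigma> A \<iota> = Idl\<^bsub>tensor_presentation S A\<^esub> (tensor_relations S \<sigma> A \<iota>)"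

definition tensor_algebra ::
    "('s, 'c) ring_scheme \<Rightarrow> ('k \<Rightarrow> 's) \<Rightarrow> ('a, 'b) ring_scheme \<Rightarrow> ('k \<Rightarrow> 'a) \<Rightarrow>
      (('s \<times> 'a) \<Rightarrow>\<^sub>0 int) set ring" where
  "tensor_algebra S \<sigma> A \<iota> = tensor_presentation S A Quot tensor_ideal S \<sigma> A \<iota>"

definition pure_tensor ::
    "('s, 'c) ring_scheme \<Rightarrow> ('k \<Rightarrow> 's) \<Rightarrow> ('a, 'b) ring_scheme \<Rightarrow> ('k \<Rightarrow> 'a) \<Rightarrow>
      's \<Rightarrow> 'a \<Rightarrow> (('s \<times> 'a) \<Rightarrow>\<^sub>0 int) set" where
  "pure_tensor S \<sigma> A \<iota> s a = tensor_ideal S \<sigma> A \<iota> +>\<^bsub>tensor_presentation S A\<^esub> frag_of (s, a)"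


section \<open>Rational function fields\<close>

text \<open>Monomials are exponent functions of finite support, so \<open>'k ratfun\<close> is the field of
  rational functions over \<open>'k\<close> in countably many indeterminates \<open>x\<^sub>0, x\<^sub>1, \<dots>\<close>.\<close>

type_synonym 'k mpoly = "(nat \<Rightarrow>\<^sub>0 nat) \<Rightarrow>\<^sub>0 'k"

type_synonym 'k ratfun = "'k mpoly fract"

definition mpolys :: "nat \<Rightarrow> 'k::field mpoly set" where
  "mpolys m = {p. \<forall>e \<in> Poly_Mapping.keys p. Poly_Mapping.keys e \<subseteq> {..<m}}"

definition ratfun_const :: "'k::field \<Rightarrow> 'k ratfun" where
  "ratfun_const c = Fract (Poly_Mapping.single 0 c) 1"

text \<open>The subfield generated by the constants and the first \<open>m\<close> indeterminates.\<close>

definition ratfun_field :: "nat \<Rightarrow> 'k::field ratfun ring" where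
  "ratfun_field m = ring_of_type_algebra
     \<lparr>carrier := {Fract p q | p q. p \<in> mpolys m \<and> q \<in> mpolys m \<and> q \<noteq> 0}\<rparr>"


section \<open>Extension of scalars to rational function fields\<close>

definition ratfun_extension ::
    "nat \<Rightarrow> ('a, 'b) ring_scheme \<Rightarrow> ('k::field \<Rightarrow> 'a) \<Rightarrow> (('k ratfun \<times> 'a) \<Rightarrow>\<^sub>0 int) set ring"
  where "ratfun_extension m A \<iota> = tensor_algebra (ratfun_field m) ratfun_const A \<iota>"

definition ratfun_scalars ::
    "nat \<Rightarrow> ('a, 'b) ring_scheme \<Rightarrow> ('k::field \<Rightarrow> 'a) \<Rightarrow> (('k ratfun \<times> 'a) \<Rightarrow>\<^sub>0 int) set set"
  where "ratfun_scalars m A \<iota> =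
    (\<lambda>q. pure_tensor (ratfun_field m) ratfun_const A \<iota> q \<one>\<^bsub>A\<^esub>) ` carrier (ratfun_field m)"

end

theory Submission
  imports Defs "HOL-Real_Asymp.Real_Asymp"
begin

text \<open>
  Let \<open>x\<^sub>1, \<dots>, x\<^sub>m\<close> in \<open>C\<close> be algebraically independent and let \<open>Q\<^sub>m\<close> be the fraction field of
  \<open>K[x\<^sub>1, \<dots>, x\<^sub>m]\<close>. The localisation of \<open>A\<close> at the nonzero polynomials is a cyclic module \<open>M\<close> over
  \<open>B = Q\<^sub>m \<otimes> A\<close>; clearing denominators gives \<open>GK\<^sub>K A \<ge> m + GK\<^sub>Q M\<close>. If \<open>1 \<in> B a B\<^sub>j\<close> for all nonzero
  \<open>a\<close> in the \<open>i\<close>-th step of the filtration, then this step embeds into the linear maps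
  \<open>M\<^sub>j \<rightarrow> M\<^sub>i\<^sub>+\<^sub>j\<close>; hence \<open>GK A \<le> GK\<^sub>Q M (d + max {d, 1})\<close>, where \<open>d\<close> is the (left) filter dimension of
  \<open>B\<close>. Together these bound \<open>m\<close>, and the Gelfand-Kirillov dimension of a commutative algebra is
  the largest such \<open>m\<close>. The localisation itself is avoided: \<open>M\<close> is realised as a space of
  \<open>Q\<^sub>m\<close>-valued functions on \<open>A\<close>, generated by a functional that is linear over the polynomials.
\<close>

section \<open>Algebras over a central subfield\<close>

text \<open>Origin of the exponent: if \<open>M\<close> grows like \<open>i^g\<close> and
  \<open>j\<close> is of order \<open>i^d\<close>, then \<open>M\<^sub>j\<close> has dimension about
  \<open>i^(g d)\<close> and \<open>M\<^sub>i\<^sub>+\<^sub>j\<close> about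
  \<open>i^(g max {d, 1})\<close>, and the product of the two bounds the growth of \<open>A\<close>.
  Inserting \<open>g \<le> n - m\<close> and solving for \<open>m\<close> gives the claim. The
  maximum over \<open>m\<close> in \<open>f_A\<close> is taken because the transcendence degree of
  the subalgebra is not known beforehand.

  The obstacle is uniformity: one \<open>j\<close> must serve all nonzero \<open>a\<close> of an
  infinite set. It is overcome by Artin-Whaples operators. For a \<open>K\<close>-basis of a
  filtration step of \<open>A\<close> there are multiplication operators reading off single
  coefficients; they extend to \<open>B\<close> and read off the coefficients of all
  \<open>Q\<^sub>m\<close>-combinations at once.

  The space of functions that stands for \<open>M\<close> is a quotient of the localisation,
  possibly a proper one. What matters is that it is nonzero, which the value \<open>1\<close> of the
  functional at \<open>\<one>\<close> guarantees.

  The generating sets of \<open>A\<close> and of \<open>B\<close> are picked by independent choices.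
  Linear factors, called \<open>c\<close> and \<open>e\<close> throughout, translate between the two
  filtrations.\<close>

locale central_algebra = ring R for R (structure) +
  fixes k :: "'a set"
  assumes subfield: "subfield k R"
    and central: "\<lbrakk>c \<in> k; x \<in> carrier R\<rbrakk> \<Longrightarrow> c \<otimes> x = x \<otimes> c"
begin

lemma scalars_in_carrier: "k \<subseteq> carrier R"
  using subfieldE(3)[OF subfield] .

lemma one_in_scalars: "\<one> \<in> k"
  using subringE(3)[OF subfieldE(1)[OF subfield]] .

lemma one_neq_zero: "\<one> \<noteq> \<zero>"
  using subfieldE(6)[OF subfield] by simp

text \<open>In \<open>HOL-Algebra\<close>, \<open>subalgebra k E R\<close> means that
  \<open>E\<close> is a \<open>k\<close>-linear subspace. Negatives arise as multiples by the scalar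
  \<open>\<ominus> \<one>\<close>.\<close>

lemma subspaceI:
  assumes "E \<subseteq> carrier R" "\<zero> \<in> E"
    and "\<And>x y. \<lbrakk>x \<in> E; y \<in> E\<rbrakk> \<Longrightarrow> x \<oplus> y \<in> E"
    and "\<And>c x. \<lbrakk>c \<in> k; x \<in> E\<rbrakk> \<Longrightarrow> c \<otimes> x \<in> E"
  shows "subalgebra k E R"
proof -
  have "\<ominus> x \<in> E" if "x \<in> E" for x
  proof -
    have "\<ominus> \<one> \<in> k"
      using subringE(5)[OF subfieldE(1)[OF subfield] one_in_scalars] .
    then have "\<ominus> \<one> \<otimes> x \<in> E" using assms(4) that by blast
    moreover have "\<ominus> \<one> \<otimes> x = \<ominus> x" using that assms(1) by (simp add: l_minus subset_iff)
    ultimately show ?thesis by simp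
  qed
  then have "subgroup E (add_monoid R)"
    using assms by (intro add.subgroupI) (auto simp: a_inv_def)
  then show ?thesis
    using assms by (simp add: subalgebra_def subalgebra_axioms_def)
qed

lemma subspaceD:
  assumes "subalgebra k E R"
  shows "E \<subseteq> carrier R" "\<zero> \<in> E"
    and "\<And>x y. \<lbrakk>x \<in> E; y \<in> E\<rbrakk> \<Longrightarrow> x \<oplus> y \<in> E"
    and "\<And>c x. \<lbrakk>c \<in> k; x \<in> E\<rbrakk> \<Longrightarrow> c \<otimes> x \<in> E"
  using subalgebra_in_carrier[OF assms] subalgebra.smult_closed[OF assms]
    subgroup.one_closed[OF subalgebra.axioms(1)[OF assms]]
    subgroup.m_closed[OF subalgebra.axioms(1)[OF assms]]
  by auto

lemma subspace_finsum:
  assumes "subalgebra k E R" "\<And>i. i \<in> I \<Longrightarrow> f i \<in> E"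
  shows "(\<Oplus>i\<in>I. f i) \<in> E"
  using assms(2)
proof (induction I rule: infinite_finite_induct)
  case (insert i I)
  then have "f i \<in> carrier R" "f \<in> I \<rightarrow> carrier R"
    using subspaceD(1)[OF assms(1)] by auto
  then show ?case
    using insert subspaceD(3)[OF assms(1)] by (simp add: finsum_insert)
qed (use subspaceD(2)[OF assms(1)] in \<open>simp_all add: finsum_infinite\<close>)

lemma subspace_span_least:
  assumes "subalgebra k E R" "V \<subseteq> E"
  shows "subspace_span R k V \<subseteq> E"
  unfolding subspace_span_def
  using subalgebra_Span_incl[OF subfield assms(1)] assms(2) by blast

lemma subspace_span_superset:
  assumes "V \<subseteq> carrier R"
  shows "V \<subseteq> subspace_span R k V"
proof
  fix v assume "v \<in> V"
  then have "v \<in> Span k [v]"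
    using Span_base_incl[OF subfield, of "[v]"] assms by auto
  then show "v \<in> subspace_span R k V"
    unfolding subspace_span_def using \<open>v \<in> V\<close> by (intro UN_I[of "[v]"]) auto
qed

lemma subspace_subspace_span:
  assumes "V \<subseteq> carrier R"
  shows "subalgebra k (subspace_span R k V) R"
proof (rule subspaceI)
  have sub: "subalgebra k (Span k us) R" if "set us \<subseteq> V" for us
    using Span_is_subalgebra[OF subfield] that assms by blast
  show "subspace_span R k V \<subseteq> carrier R"
    unfolding subspace_span_def using subspaceD(1)[OF sub] by auto
  show "\<zero> \<in> subspace_span R k V"
    unfolding subspace_span_def using subspaceD(2)[OF sub[of "[]"]] by (intro UN_I[of "[]"]) auto
  show "c \<otimes> x \<in> subspace_span R k V" if "c \<in> k" "x \<in> subspace_span R k V" for c x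
    using that subspaceD(4)[OF sub] unfolding subspace_span_def by blast
  show "x \<oplus> y \<in> subspace_span R k V"
    if xy: "x \<in> subspace_span R k V" "y \<in> subspace_span R k V" for x y
  proof -
    obtain us vs where us: "set us \<subseteq> V" "x \<in> Span k us" and vs: "set vs \<subseteq> V" "y \<in> Span k vs"
      using xy unfolding subspace_span_def by blast
    have "set us \<subseteq> carrier R" "set vs \<subseteq> carrier R" using us vs assms by auto
    then have "x \<in> Span k (us @ vs)" "y \<in> Span k (us @ vs)"
      using us vs mono_Span_append[OF subfield, of us vs] mono_Span_append[OF subfield, of vs us]
      by blast+
    then have "x \<oplus> y \<in> Span k (us @ vs)"
      using subspaceD(3)[OF sub] us vs by (metis Un_subset_iff set_append)
    then show ?thesis
      unfolding subspace_span_def using us vs by (intro UN_I[of "us @ vs"]) auto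
  qed
qed

lemma subspace_span_carrier: "V \<subseteq> carrier R \<Longrightarrow> subspace_span R k V \<subseteq> carrier R"
  using subspaceD(1)[OF subspace_subspace_span] .

lemma subspace_span_mono: "\<lbrakk>V \<subseteq> W; W \<subseteq> carrier R\<rbrakk> \<Longrightarrow> subspace_span R k V \<subseteq> subspace_span R k W"
  unfolding subspace_span_def by blast

lemma subspace_span_set:
  assumes "set us \<subseteq> carrier R"
  shows "subspace_span R k (set us) = Span k us"
proof
  show "subspace_span R k (set us) \<subseteq> Span k us"
    using Span_is_subalgebra[OF subfield assms] Span_base_incl[OF subfield assms]
    by (rule subspace_span_least)
  show "Span k us \<subseteq> subspace_span R k (set us)"
    unfolding subspace_span_def by blast
qed

text \<open>Bilinear extension in two steps, each time because a set of admissible factors is a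
  subspace. For the left factor associativity is enough; for the right factor the scalars have to
  pass \<open>x\<close>, which is where their centrality enters.\<close>

lemma span_mult_span:
  assumes E: "subalgebra k E R" and VW: "V \<subseteq> carrier R" "W \<subseteq> carrier R"
    and *: "\<And>v w. \<lbrakk>v \<in> V; w \<in> W\<rbrakk> \<Longrightarrow> v \<otimes> w \<in> E"
    and "x \<in> subspace_span R k V" "y \<in> subspace_span R k W"
  shows "x \<otimes> y \<in> E"
proof -
  note Ed = subspaceD[OF E]
  have "subalgebra k {x \<in> carrier R. \<forall>w\<in>W. x \<otimes> w \<in> E} R"
    using VW Ed scalars_in_carrier
    by (intro subspaceI) (auto simp: l_distr m_assoc subset_iff)
  then have 1: "\<forall>w\<in>W. x \<otimes> w \<in> E"
    using subspace_span_least[of "{x \<in> carrier R. \<forall>w\<in>W. x \<otimes> w \<in> E}" V] VW * assms(5) by blast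
  have x: "x \<in> carrier R" using assms(5) subspace_span_carrier[OF VW(1)] by blast
  have "x \<otimes> (c \<otimes> y) = c \<otimes> (x \<otimes> y)" if "c \<in> k" "y \<in> carrier R" for c y
  proof -
    have c: "c \<in> carrier R" using that scalars_in_carrier by blast
    have "x \<otimes> (c \<otimes> y) = (x \<otimes> c) \<otimes> y" using that x c by (simp add: m_assoc)
    also have "x \<otimes> c = c \<otimes> x" using central[OF that(1) x] by simp
    finally show ?thesis using that x c by (simp add: m_assoc)
  qed
  then have "subalgebra k {y \<in> carrier R. x \<otimes> y \<in> E} R"
    using x Ed scalars_in_carrier by (intro subspaceI) (auto simp: r_distr subset_iff)
  then show ?thesis
    using subspace_span_least[of "{y \<in> carrier R. x \<otimes> y \<in> E}" W] VW 1 assms(6) by blast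
qed

lemma subspace_scalars: "subalgebra k k R"
  using subringE[OF subfieldE(1)[OF subfield]] by (intro subspaceI) auto

section \<open>Standard filtrations\<close>

abbreviation "Fil \<equiv> standard_filtration R k"

lemma
  assumes S: "S \<subseteq> carrier R"
  shows filtration_carrier: "Fil S i \<subseteq> carrier R"
    and subspace_filtration: "subalgebra k (Fil S i) R"
proof -
  have "Fil S i \<subseteq> carrier R \<and> subalgebra k (Fil S i) R"
  proof (induction i)
    case 0
    then show ?case using subspace_scalars scalars_in_carrier by simp
  next
    case (Suc i)
    have "subspace_span R k (insert \<one> S) \<subseteq> carrier R"
      using S by (intro subspace_span_carrier) auto
    then have "{x \<otimes> y |x y. x \<in> Fil S i \<and> y \<in> subspace_span R k (insert \<one> S)} \<subseteq> carrier R"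
      using Suc by auto
    then show ?case
      using subspace_subspace_span subspace_span_carrier by simp
  qed
  then show "Fil S i \<subseteq> carrier R" "subalgebra k (Fil S i) R" by auto
qed

lemma filtration_mult_generator:
  assumes S: "S \<subseteq> carrier R" and "x \<in> Fil S i" "y \<in> subspace_span R k (insert \<one> S)"
  shows "x \<otimes> y \<in> Fil S (Suc i)"
proof -
  have "subspace_span R k (insert \<one> S) \<subseteq> carrier R"
    using S by (intro subspace_span_carrier) auto
  then have "{x \<otimes> y |x y. x \<in> Fil S i \<and> y \<in> subspace_span R k (insert \<one> S)} \<subseteq> carrier R"
    using filtration_carrier[OF S, of i] by (auto intro!: m_closed dest!: subsetD)
  then have "{x \<otimes> y |x y. x \<in> Fil S i \<and> y \<in> subspace_span R k (insert \<one> S)} \<subseteq> Fil S (Suc i)"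
    using subspace_span_superset by simp
  then show ?thesis using assms(2,3) by blast
qed

lemma filtration_Suc:
  assumes S: "S \<subseteq> carrier R"
  shows "Fil S i \<subseteq> Fil S (Suc i)"
proof
  fix x assume x: "x \<in> Fil S i"
  have "\<one> \<in> subspace_span R k (insert \<one> S)"
    using S subspace_span_superset[of "insert \<one> S"] by auto
  then have "x \<otimes> \<one> \<in> Fil S (Suc i)"
    by (rule filtration_mult_generator[OF S x])
  moreover have "x \<in> carrier R" using x filtration_carrier[OF S] by blast
  ultimately show "x \<in> Fil S (Suc i)" by (simp del: standard_filtration.simps)
qed

lemma filtration_mono:
  assumes S: "S \<subseteq> carrier R" and "i \<le> j"
  shows "Fil S i \<subseteq> Fil S j"
  using assms(2) by (induction rule: dec_induct) (use filtration_Suc[OF S] in blast)+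

lemma scalars_filtration: "S \<subseteq> carrier R \<Longrightarrow> k \<subseteq> Fil S i"
  using filtration_mono[of S 0 i] by simp

lemma one_filtration: "S \<subseteq> carrier R \<Longrightarrow> \<one> \<in> Fil S i"
  using scalars_filtration one_in_scalars by blast

lemma generator_filtration:
  assumes S: "S \<subseteq> carrier R" and "s \<in> S"
  shows "s \<in> Fil S (Suc 0)"
proof -
  have "s \<in> subspace_span R k (insert \<one> S)"
    using assms subspace_span_superset[of "insert \<one> S"] by auto
  then have "\<one> \<otimes> s \<in> Fil S (Suc 0)"
    using one_in_scalars by (intro filtration_mult_generator[OF S]) auto
  then show ?thesis using assms by (auto simp del: standard_filtration.simps)
qed

text \<open>Induction on the right index, because a step of the filtration arises by appending a
  generator on the right. In degree zero the right factor is a scalar and moves to the left by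
  centrality.\<close>

lemma filtration_mult:
  assumes S: "S \<subseteq> carrier R" and "x \<in> Fil S i" "y \<in> Fil S j"
  shows "x \<otimes> y \<in> Fil S (i + j)"
  using assms(3)
proof (induction j arbitrary: y)
  case 0
  have "x \<in> carrier R" using assms(2) filtration_carrier[OF S] by blast
  then show ?case
    using 0 assms(2) subspaceD(4)[OF subspace_filtration[OF S], of y x i] central[of y x] by simp
next
  case (Suc j)
  have x: "x \<in> carrier R" using assms(2) filtration_carrier[OF S, of i] by auto
  let ?G = "subspace_span R k (insert \<one> S)"
  let ?W = "{x \<otimes> y |x y. x \<in> Fil S j \<and> y \<in> ?G}"
  have G: "?G \<subseteq> carrier R" using S by (intro subspace_span_carrier) auto
  then have W: "?W \<subseteq> carrier R" using filtration_carrier[OF S, of j] by (auto intro!: m_closed dest!: subsetD)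
  have "v \<otimes> w \<in> Fil S (i + Suc j)" if v: "v \<in> {x}" and w: "w \<in> ?W" for v w
  proof -
    obtain a g where ag: "w = a \<otimes> g" "a \<in> Fil S j" "g \<in> ?G" using w by auto
    have "(x \<otimes> a) \<otimes> g \<in> Fil S (Suc (i + j))"
      using Suc.IH[OF ag(2)] ag(3) by (rule filtration_mult_generator[OF S])
    moreover have "(x \<otimes> a) \<otimes> g = v \<otimes> w"
      using v x ag G filtration_carrier[OF S, of j] by (simp add: m_assoc subset_iff)
    ultimately show ?thesis by (simp del: standard_filtration.simps)
  qed
  moreover have "x \<in> subspace_span R k {x}" using subspace_span_superset[of "{x}"] x by auto
  moreover have "y \<in> subspace_span R k ?W" using Suc.prems by simp
  ultimately show ?case
    using span_mult_span[OF subspace_filtration[OF S], of "{x}" ?W] x W by blast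
qed

lemma filtration_power:
  assumes S: "S \<subseteq> carrier R" and "x \<in> Fil S c"
  shows "x [^] (n::nat) \<in> Fil S (c * n)"
proof (induction n)
  case 0
  then show ?case using one_in_scalars by simp
next
  case (Suc n)
  then have "x [^] n \<otimes> x \<in> Fil S (c * n + c)" by (rule filtration_mult[OF S _ assms(2)])
  then show ?case by (simp add: add.commute)
qed

lemma generate_ring_filtration:
  assumes S: "S \<subseteq> carrier R"
  shows "generate_ring R (k \<union> S) \<subseteq> (\<Union>i. Fil S i)"
proof
  fix x assume "x \<in> generate_ring R (k \<union> S)"
  then show "x \<in> (\<Union>i. Fil S i)"
  proof (induction rule: generate_ring.induct)
    case one
    then show ?case using one_filtration[OF S] by blast
  next
    case (incl h)
    then show ?case using scalars_filtration[OF S] generator_filtration[OF S] by blast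
  next
    case (a_inv h)
    then obtain i where i: "h \<in> Fil S i" by blast
    then have "\<ominus> h \<in> Fil S i"
      using subgroup.m_inv_closed[OF subalgebra.axioms(1)[OF subspace_filtration[OF S]]] i
      by (simp add: a_inv_def)
    then show ?case by blast
  next
    case (eng_add h1 h2)
    then obtain i j where "h1 \<in> Fil S i" "h2 \<in> Fil S j" by blast
    then have "h1 \<in> Fil S (max i j)" "h2 \<in> Fil S (max i j)"
      using filtration_mono[OF S] by (meson max.cobounded1 max.cobounded2 subsetD)+
    then show ?case using subspaceD(3)[OF subspace_filtration[OF S]] by blast
  next
    case (eng_mult h1 h2)
    then show ?case using filtration_mult[OF S] by blast
  qed
qed

lemma finite_filtration_bound:
  assumes S: "S \<subseteq> carrier R" and "finite T" "T \<subseteq> generate_ring R (k \<union> S)"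
  shows "\<exists>c. T \<subseteq> Fil S c"
  using assms(2,3)
proof (induction T rule: finite_induct)
  case (insert t T)
  then obtain c c' where "T \<subseteq> Fil S c" "t \<in> Fil S c'"
    using generate_ring_filtration[OF S] by blast
  then have "insert t T \<subseteq> Fil S (max c c')"
    using filtration_mono[OF S, of c "max c c'"] filtration_mono[OF S, of c' "max c c'"] by auto
  then show ?case by blast
qed auto

text \<open>The comparison between two generating sets: filtrations differ by a linear change of
  index only, which growth degrees do not see.\<close>

lemma filtration_change_generators:
  assumes S: "S \<subseteq> carrier R" and S': "S' \<subseteq> carrier R" and "S \<subseteq> Fil S' c"
  shows "Fil S i \<subseteq> Fil S' (c * i)"
proof (induction i)
  case 0
  then show ?case by simp
next
  case (Suc i)
  have "insert \<one> S \<subseteq> Fil S' c" using assms(3) one_filtration[OF S'] by blast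
  then have G: "subspace_span R k (insert \<one> S) \<subseteq> Fil S' c"
    by (rule subspace_span_least[OF subspace_filtration[OF S']])
  have "{x \<otimes> y |x y. x \<in> Fil S i \<and> y \<in> subspace_span R k (insert \<one> S)} \<subseteq> Fil S' (c * i + c)"
    using filtration_mult[OF S'] Suc G by blast
  then have "subspace_span R k {x \<otimes> y |x y. x \<in> Fil S i \<and> y \<in> subspace_span R k (insert \<one> S)}
     \<subseteq> Fil S' (c * i + c)"
    by (rule subspace_span_least[OF subspace_filtration[OF S']])
  then show ?case by (simp add: add.commute)
qed

section \<open>Finite dimension, independent families and bases\<close>

declare Span.simps [simp del]

lemma finite_dimension_span:
  assumes "finite V" "V \<subseteq> carrier R"
  shows "finite_dimension k (subspace_span R k V)"
  using Span_finite_dimension[OF subfield] subspace_span_set finite_list[OF assms(1)] assms(2) by metis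

lemma finite_dimension_filtration:
  assumes S: "S \<subseteq> carrier R" and fin: "finite S"
  shows "finite_dimension k (Fil S i)"
proof -
  have "\<exists>V. finite V \<and> V \<subseteq> carrier R \<and> Fil S i = subspace_span R k V"
  proof (induction i)
    case 0
    have "subspace_span R k {\<one>} = k"
    proof
      show "subspace_span R k {\<one>} \<subseteq> k"
        using one_in_scalars by (intro subspace_span_least[OF subspace_scalars]) auto
      show "k \<subseteq> subspace_span R k {\<one>}"
      proof
        fix c assume c: "c \<in> k"
        have "c \<otimes> \<one> \<in> subspace_span R k {\<one>}"
          using subspaceD(4)[OF subspace_subspace_span c] subspace_span_superset[of "{\<one>}"] by simp
        then show "c \<in> subspace_span R k {\<one>}" using c scalars_in_carrier by (simp add: subset_iff)
      qed
    qed
    then show ?case by (intro exI[of _ "{\<one>}"]) auto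
  next
    case (Suc i)
    then obtain V where V: "finite V" "V \<subseteq> carrier R" "Fil S i = subspace_span R k V" by blast
    let ?Y = "(\<lambda>(x, s). x \<otimes> s) ` (V \<times> insert \<one> S)"
    have S1: "insert \<one> S \<subseteq> carrier R" using S by simp
    have Y: "?Y \<subseteq> carrier R"
    proof (rule image_subsetI, clarify)
      fix v s assume "v \<in> V" "s \<in> insert \<one> S"
      then show "v \<otimes> s \<in> carrier R" using V(2) S1 by (meson m_closed subsetD)
    qed
    have VY: "v \<otimes> w \<in> subspace_span R k ?Y" if "v \<in> V" "w \<in> insert \<one> S" for v w
      using subspace_span_superset[OF Y] that by blast
    have "x \<otimes> y \<in> subspace_span R k ?Y"
      if "x \<in> Fil S i" "y \<in> subspace_span R k (insert \<one> S)" for x y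
      using that V(3) span_mult_span[OF subspace_subspace_span[OF Y] V(2) S1 VY] by blast
    then have "{x \<otimes> y |x y. x \<in> Fil S i \<and> y \<in> subspace_span R k (insert \<one> S)}
        \<subseteq> subspace_span R k ?Y" by blast
    then have 1: "Fil S (Suc i) \<subseteq> subspace_span R k ?Y"
      unfolding standard_filtration.simps by (rule subspace_span_least[OF subspace_subspace_span[OF Y]])
    have "V \<subseteq> Fil S i" using V(3) subspace_span_superset[OF V(2)] by simp
    then have "v \<otimes> s \<in> Fil S (Suc i)" if "v \<in> V" "s \<in> insert \<one> S" for v s
      using that subspace_span_superset[OF S1] by (intro filtration_mult_generator[OF S]) blast+
    then have "?Y \<subseteq> Fil S (Suc i)" by (intro image_subsetI, clarify)
    then have "subspace_span R k ?Y \<subseteq> Fil S (Suc i)"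
      by (rule subspace_span_least[OF subspace_filtration[OF S]])
    with 1 have "Fil S (Suc i) = subspace_span R k ?Y" by (rule subset_antisym)
    moreover have "finite ?Y" using V(1) fin by simp
    ultimately show ?case using Y by blast
  qed
  then show ?thesis using finite_dimension_span by metis
qed

text \<open>Independence of an indexed family, in contrast to the list predicate
  \<open>independent\<close>: product index sets and subfamilies are then available directly. It is
  meant for finite \<open>I\<close>, since \<open>finsum\<close> over an infinite set has a default
  value.\<close>

definition lin_indep :: "('i \<Rightarrow> 'a) \<Rightarrow> 'i set \<Rightarrow> bool" where
  "lin_indep f I \<longleftrightarrow>
     (\<forall>g \<in> I \<rightarrow> k. (\<Oplus>i\<in>I. g i \<otimes> f i) = \<zero> \<longrightarrow> (\<forall>i\<in>I. g i = \<zero>))"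

lemma combine_map:
  assumes "distinct is" "f \<in> set is \<rightarrow> carrier R" "g \<in> set is \<rightarrow> carrier R"
  shows "combine (map g is) (map f is) = (\<Oplus>i\<in>set is. g i \<otimes> f i)"
  using assms
proof (induction "is")
  case (Cons i js)
  then have "(\<lambda>i. g i \<otimes> f i) \<in> set js \<rightarrow> carrier R" "g i \<otimes> f i \<in> carrier R" by auto
  then show ?case using Cons by (simp add: finsum_insert)
qed simp

lemma lin_indep_imp_independent:
  assumes "lin_indep f (set is)" "distinct is" "f \<in> set is \<rightarrow> carrier R"
  shows "independent k (map f is)"
proof (rule trivial_combine_imp_independent[OF subfield])
  show "set (map f is) \<subseteq> carrier R" using assms(3) by auto
next
  fix Ks assume Ks: "set Ks \<subseteq> k" "combine Ks (map f is) = \<zero>"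
  obtain Ks' where Ks': "set (take (length (map f is)) Ks) \<subseteq> set Ks'"
      "set Ks' \<subseteq> set (take (length (map f is)) Ks) \<union> {\<zero>}"
      "length Ks' = length (map f is)" "combine Ks' (map f is) = \<zero>"
  proof (rule combine_normalize[OF _ _ Ks(2)])
    show "set Ks \<subseteq> carrier R" using Ks(1) scalars_in_carrier by blast
    show "set (map f is) \<subseteq> carrier R" using assms(3) by auto
  qed blast
  have Ks'k: "set Ks' \<subseteq> k"
    using Ks'(2) Ks(1) subspaceD(2)[OF subspace_scalars] set_take_subset[of _ Ks] by blast
  define g where "g i = (if i \<in> set is then the (map_of (zip is Ks') i) else \<zero>)" for i
  have g: "map g is = Ks'"
    using Ks'(3) assms(2)
    by (intro nth_equalityI) (auto simp: g_def map_of_zip_nth)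
  have gk: "g \<in> set is \<rightarrow> k"
    using Ks'k unfolding g[symmetric] by auto
  then have "g \<in> set is \<rightarrow> carrier R"
    using scalars_in_carrier by blast
  then have "(\<Oplus>i\<in>set is. g i \<otimes> f i) = combine (map g is) (map f is)"
    by (rule combine_map[symmetric, OF assms(2,3)])
  also have "\<dots> = \<zero>" unfolding g by (rule Ks'(4))
  finally have "\<forall>i\<in>set is. g i = \<zero>"
    using assms(1) gk unfolding lin_indep_def by blast
  then have "set Ks' \<subseteq> {\<zero>}" unfolding g[symmetric] by auto
  then show "set (take (length (map f is)) Ks) \<subseteq> {\<zero>}" using Ks'(1) by blast
qed

lemma independent_imp_lin_indep:
  assumes "independent k us"
  shows "lin_indep ((!) us) {..<length us}"
  unfolding lin_indep_def
proof (intro ballI impI)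
  fix g i assume g: "g \<in> {..<length us} \<rightarrow> k" and 0: "(\<Oplus>i\<in>{..<length us}. g i \<otimes> us ! i) = \<zero>"
    and i: "i \<in> {..<length us}"
  have us: "set us \<subseteq> carrier R" using independent_in_carrier[OF assms] .
  have "(!) us \<in> set [0..<length us] \<rightarrow> carrier R" using us(1) by auto
  moreover have "g \<in> set [0..<length us] \<rightarrow> carrier R" using g scalars_in_carrier by auto
  ultimately have *: "combine (map g [0..<length us]) us = \<zero>"
    using combine_map[of "[0..<length us]" "(!) us" g] 0 by (simp add: map_nth lessThan_atLeast0)
  have "set (take (length us) (map g [0..<length us])) \<subseteq> {\<zero>}"
    by (rule independent_imp_trivial_combine[OF subfield assms _ *]) (use g in auto)
  then show "g i = \<zero>" using i by (auto simp: image_subset_iff)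
qed

lemma card_le_dim:
  assumes "lin_indep f I" "finite I" "f \<in> I \<rightarrow> V" "V \<subseteq> carrier R" "finite_dimension k V"
  shows "card I \<le> dim k V"
proof -
  obtain js where js: "set js = I" "distinct js" using finite_distinct_list[OF assms(2)] by blast
  have "independent k (map f js)"
    using lin_indep_imp_independent[of f js] js assms by blast
  moreover have "dimension (dim k V) k V"
    using finite_dimensionE[OF subfield assms(5)] by (simp add: over_def)
  moreover have "set (map f js) \<subseteq> V" using js assms by auto
  ultimately have "length (map f js) \<le> dim k V"
    using independent_length_le_dimension[OF subfield] by blast
  then show ?thesis using distinct_card[OF js(2)] js by simp
qed

lemma exists_basis:
  assumes "finite_dimension k V"
  obtains f :: "nat \<Rightarrow> 'a" where "f \<in> {..<dim k V} \<rightarrow> V" "lin_indep f {..<dim k V}"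
    "\<And>v. v \<in> V \<Longrightarrow> \<exists>g \<in> {..<dim k V} \<rightarrow> k. v = (\<Oplus>i\<in>{..<dim k V}. g i \<otimes> f i)"
proof -
  have "dimension (dim k V) k V"
    using finite_dimensionE[OF subfield assms] by (simp add: over_def)
  then obtain us where us: "set us \<subseteq> carrier R" "independent k us" "length us = dim k V" "Span k us = V"
    using exists_base[OF subfield] by blast
  show ?thesis
  proof (rule that[of "(!) us"])
    show "(!) us \<in> {..<dim k V} \<rightarrow> V"
      using us(3,4) Span_base_incl[OF subfield us(1)] by (auto dest: nth_mem)
    show "lin_indep ((!) us) {..<dim k V}"
      using independent_imp_lin_indep[OF us(2)] us(3) by simp
    fix v assume "v \<in> V"
    then obtain Ks where Ks: "set Ks \<subseteq> k" "length Ks = length us" "v = combine Ks us"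
      using Span_mem_iff_length_version[OF subfield us(1)] us(4) by blast
    have "(!) us \<in> set [0..<length us] \<rightarrow> carrier R" using us(1) by auto
    moreover have "(!) Ks \<in> set [0..<length us] \<rightarrow> carrier R"
      using Ks(1,2) scalars_in_carrier by (metis Pi_I atLeastLessThan_iff nth_mem set_upt subsetD)
    moreover have "map ((!) us) [0..<length us] = us" by (rule map_nth)
    moreover have "map ((!) Ks) [0..<length us] = Ks" using Ks(2) map_nth[of Ks] by simp
    ultimately have "v = (\<Oplus>i\<in>{..<dim k V}. Ks ! i \<otimes> us ! i)"
      using combine_map[of "[0..<length us]" "(!) us" "(!) Ks"] Ks us(3)
      by (simp add: lessThan_atLeast0)
    then show "\<exists>g \<in> {..<dim k V} \<rightarrow> k. v = (\<Oplus>i\<in>{..<dim k V}. g i \<otimes> us ! i)"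
      using Ks(1,2) us(3) by (intro bexI[of _ "(!) Ks"]) auto
  qed
qed

text \<open>A spanning list is thinned out by dropping each entry that lies in the span of the later
  ones. The independent list that remains is no longer than before and bounds the length of every
  independent list in its span.\<close>

lemma dim_span_le:
  assumes W: "finite W" "W \<subseteq> carrier R" and V: "V \<subseteq> subspace_span R k W" "subalgebra k V R"
  shows "dim k V \<le> card W"
proof -
  obtain xs where xs: "set xs = W" "distinct xs" using finite_distinct_list[OF W(1)] by blast
  have sp: "subspace_span R k W = Span k xs" using subspace_span_set[of xs] xs W by simp
  have "\<exists>vs. independent k vs \<and> Span k vs = Span k xs \<and> length vs \<le> length xs"
    if "set xs \<subseteq> carrier R" for xs
    using that
  proof (induction xs)
    case Nil
    show ?case using li_Nil by (metis list.size(3) order_refl)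
  next
    case (Cons x xs)
    then obtain vs where vs: "independent k vs" "Span k vs = Span k xs" "length vs \<le> length xs"
      by (metis insert_subset list.set(2))
    have vs': "set vs \<subseteq> carrier R" using independent_in_carrier[OF vs(1)] .
    have x: "x \<in> carrier R" using Cons.prems by simp
    have eq: "Span k (x # xs) = Span k (x # vs)" using vs(2) by (simp add: Span.simps)
    show ?case
    proof (cases "x \<in> Span k vs")
      case True
      have "Span k (x # vs) = Span k vs"
      proof
        show "Span k vs \<subseteq> Span k (x # vs)" by (rule mono_Span[OF subfield vs' x])
        have "set (x # vs) \<subseteq> Span k vs"
          using True Span_base_incl[OF subfield vs'] by (simp del: Span.simps)
        then show "Span k (x # vs) \<subseteq> Span k vs" by (rule mono_Span_subset[OF subfield _ vs'])
      qed
      then show ?thesis using vs eq by (metis le_Suc_eq length_Cons)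
    next
      case False
      then have "independent k (x # vs)" using vs(1) x by (intro li_Cons)
      moreover have "length (x # vs) \<le> length (x # xs)" using vs(3) by simp
      ultimately show ?thesis using eq by metis
    qed
  qed
  then obtain vs where vs: "independent k vs" "Span k vs = Span k xs" "length vs \<le> card W"
    using xs W distinct_card[OF xs(2)] by metis
  have fd: "finite_dimension k V"
    using subalbegra_incl_imp_finite_dimension[OF subfield finite_dimension_span[OF W]] V by blast
  obtain us where us: "independent k us" "length us = dim k V" "Span k us = V"
    using exists_base[OF subfield finite_dimensionE[OF subfield fd]] by (auto simp: over_def)
  have "length us \<le> length vs"
    using independent_length_le[OF subfield us(1) vs(1)] Span_base_incl[OF subfield]
      independent_in_carrier[OF us(1)] us(3) V(1) sp vs(2) by blast
  then show ?thesis using us vs(3) by simp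
qed

end

section \<open>The multiplication algebra of a central simple algebra\<close>

text \<open>On the carrier these are the finite sums of maps
  \<open>z \<mapsto> x \<otimes> z \<otimes> y\<close>, that is, the multiplication algebra of
  \<open>R\<close>. The inductive form yields additivity and closure under composition without
  normal forms.\<close>

inductive_set mult_ops :: "('a, 'b) ring_scheme \<Rightarrow> ('a \<Rightarrow> 'a) set" for R (structure) where
  ident: "(\<lambda>z. z) \<in> mult_ops R"
| add: "\<lbrakk>T \<in> mult_ops R; U \<in> mult_ops R\<rbrakk> \<Longrightarrow> (\<lambda>z. T z \<oplus> U z) \<in> mult_ops R"
| lmult: "\<lbrakk>x \<in> carrier R; T \<in> mult_ops R\<rbrakk> \<Longrightarrow> (\<lambda>z. x \<otimes> T z) \<in> mult_ops R"
| rmult: "\<lbrakk>x \<in> carrier R; T \<in> mult_ops R\<rbrakk> \<Longrightarrow> (\<lambda>z. T z \<otimes> x) \<in> mult_ops R"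

context ring
begin

lemma mult_ops_closed [simp, intro]: "\<lbrakk>T \<in> mult_ops R; z \<in> carrier R\<rbrakk> \<Longrightarrow> T z \<in> carrier R"
  by (induction rule: mult_ops.induct) auto

lemma mult_ops_add:
  "\<lbrakk>T \<in> mult_ops R; z \<in> carrier R; w \<in> carrier R\<rbrakk> \<Longrightarrow> T (z \<oplus> w) = T z \<oplus> T w"
proof (induction rule: mult_ops.induct)
  case (add T U)
  have "T z \<in> carrier R" "U z \<in> carrier R" "T w \<in> carrier R" "U w \<in> carrier R"
    using add by auto
  then show ?case using add by (simp add: a_ac)
qed (auto simp: l_distr r_distr)

lemma mult_ops_zero: "T \<in> mult_ops R \<Longrightarrow> T \<zero> = \<zero>"
  by (induction rule: mult_ops.induct) auto

lemma mult_ops_finsum: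
  assumes "T \<in> mult_ops R" "f \<in> I \<rightarrow> carrier R"
  shows "T (\<Oplus>i\<in>I. f i) = (\<Oplus>i\<in>I. T (f i))"
  using assms(2)
proof (induction I rule: infinite_finite_induct)
  case (insert i I)
  then have "f i \<in> carrier R" "f \<in> I \<rightarrow> carrier R" by auto
  moreover have "(\<lambda>i. T (f i)) \<in> I \<rightarrow> carrier R" "T (f i) \<in> carrier R"
    using calculation assms(1) by auto
  ultimately show ?case using insert mult_ops_add[OF assms(1)] by (simp add: finsum_insert)
qed (simp_all add: mult_ops_zero[OF assms(1)] finsum_infinite)

lemma mult_ops_comp:
  assumes "T \<in> mult_ops R" "U \<in> mult_ops R"
  shows "(\<lambda>z. T (U z)) \<in> mult_ops R"
  using assms(1) by (induction rule: mult_ops.induct) (auto intro: mult_ops.intros assms(2))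

lemma mult_ops_linear_combination:
  assumes "finite I" "\<And>i. i \<in> I \<Longrightarrow> T i \<in> mult_ops R" "\<And>i. i \<in> I \<Longrightarrow> y i \<in> carrier R"
  shows "\<exists>W \<in> mult_ops R. \<forall>z \<in> carrier R. W z = (\<Oplus>i\<in>I. y i \<otimes> T i z)"
  using assms
proof (induction I rule: finite_induct)
  case empty
  have "(\<lambda>z. \<zero> \<otimes> z) \<in> mult_ops R" by (intro mult_ops.intros) auto
  then show ?case by (intro bexI[of _ "\<lambda>z. \<zero> \<otimes> z"]) auto
next
  case (insert i I)
  then obtain W where W: "W \<in> mult_ops R" "\<And>z. z \<in> carrier R \<Longrightarrow> W z = (\<Oplus>i\<in>I. y i \<otimes> T i z)"
    by auto
  have "(\<lambda>z. y i \<otimes> T i z \<oplus> W z) \<in> mult_ops R"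
    using insert.prems W(1) by (intro mult_ops.intros) auto
  moreover have "y i \<otimes> T i z \<oplus> W z = (\<Oplus>i\<in>insert i I. y i \<otimes> T i z)" if "z \<in> carrier R" for z
  proof -
    have "(\<lambda>i. y i \<otimes> T i z) \<in> I \<rightarrow> carrier R" "y i \<otimes> T i z \<in> carrier R"
      using insert.prems that by auto
    then show ?thesis using insert.hyps W(2)[OF that] by (simp add: finsum_insert)
  qed
  ultimately show ?case by (intro bexI[of _ "\<lambda>z. y i \<otimes> T i z \<oplus> W z"]) auto
qed

text \<open>The values at \<open>a\<close> of all multiplication operators form the two-sided ideal
  generated by \<open>a\<close>, which is everything by simplicity.\<close>

lemma simple_mult_op_eq_one:
  assumes "simple_ring R" "a \<in> carrier R" "a \<noteq> \<zero>"
  shows "\<exists>T \<in> mult_ops R. T a = \<one>"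
proof -
  let ?I = "{T a |T. T \<in> mult_ops R}"
  have inv: "\<ominus> \<one> \<otimes> T a = \<ominus> (T a)" if "T \<in> mult_ops R" for T
    using that assms(2) by (simp add: l_minus)
  have sub: "subgroup ?I (add_monoid R)"
  proof (rule add.subgroupI)
    show "?I \<subseteq> carrier R" using assms(2) by auto
    show "?I \<noteq> {}" using mult_ops.ident by auto
    show "\<ominus> x \<in> ?I" if x: "x \<in> ?I" for x
    proof -
      obtain T where T: "T \<in> mult_ops R" "x = T a" using x by auto
      have "(\<lambda>z. \<ominus> \<one> \<otimes> T z) \<in> mult_ops R" using T by (intro mult_ops.intros) auto
      then have "\<exists>U. \<ominus> x = U a \<and> U \<in> mult_ops R"
        using inv[OF T(1)] T(2) by (intro exI[of _ "\<lambda>z. \<ominus> \<one> \<otimes> T z"]) simp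
      then show ?thesis by simp
    qed
    show "x \<oplus> y \<in> ?I" if xy: "x \<in> ?I" "y \<in> ?I" for x y
    proof -
      obtain T U where "T \<in> mult_ops R" "x = T a" "U \<in> mult_ops R" "y = U a" using xy by auto
      then show ?thesis by (auto intro!: exI[of _ "\<lambda>z. T z \<oplus> U z"] mult_ops.intros)
    qed
  qed
  have "ideal ?I R"
  proof (rule idealI[OF ring_axioms sub])
    fix x y assume xy: "x \<in> ?I" "y \<in> carrier R"
    then obtain T where T: "T \<in> mult_ops R" "x = T a" by auto
    show "y \<otimes> x \<in> ?I"
      using T xy(2) by (auto intro!: exI[of _ "\<lambda>z. y \<otimes> T z"] mult_ops.intros)
    show "x \<otimes> y \<in> ?I"
      using T xy(2) by (auto intro!: exI[of _ "\<lambda>z. T z \<otimes> y"] mult_ops.intros)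
  qed
  moreover have "a \<in> ?I" using mult_ops.ident[of R] by (intro CollectI exI[of _ "\<lambda>z. z"]) simp
  ultimately have "?I = carrier R" using assms unfolding simple_ring_def by auto
  then have "\<one> \<in> ?I" by simp
  then show ?thesis by auto
qed

end

section \<open>Separating independent elements by multiplication operators\<close>

context central_algebra
begin

lemma lin_indep_subset:
  assumes "lin_indep f I" "J \<subseteq> I" "finite I" "f \<in> I \<rightarrow> carrier R"
  shows "lin_indep f J"
  unfolding lin_indep_def
proof (intro ballI impI)
  fix g i assume g: "g \<in> J \<rightarrow> k" "(\<Oplus>i\<in>J. g i \<otimes> f i) = \<zero>" and i: "i \<in> J"
  let ?g = "\<lambda>i. if i \<in> J then g i else \<zero>"
  have "(\<Oplus>i\<in>I. ?g i \<otimes> f i) = (\<Oplus>i\<in>J. g i \<otimes> f i)"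
    using assms g(1) scalars_in_carrier
    by (intro add.finprod_mono_neutral_cong_right) (auto simp: Pi_iff subset_iff)
  then have "(\<Oplus>i\<in>I. ?g i \<otimes> f i) = \<zero>" using g(2) by simp
  moreover have "?g \<in> I \<rightarrow> k" using g(1) subspaceD(2)[OF subspace_scalars] by auto
  moreover have "i \<in> I" using i assms(2) by blast
  ultimately have "?g i = \<zero>" using assms(1)[unfolded lin_indep_def, rule_format, of ?g i] by blast
  then show "g i = \<zero>" using i by simp
qed

text \<open>Artin--Whaples: an operator vanishing on \<open>f t\<close> for all \<open>t \<noteq> s\<close> but not at \<open>f s\<close> exists;
  otherwise \<open>T (f s)\<close> would be determined by the values \<open>T (f t)\<close>, and applying this to the
  identity exhibits \<open>f s\<close> as a combination of the \<open>f t\<close> with central coefficients.\<close>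

theorem mult_ops_separate:
  assumes simple: "simple_ring R" and centre: "ring_centre R = k"
  shows "\<lbrakk>finite I; lin_indep f I; f \<in> I \<rightarrow> carrier R; s \<in> I\<rbrakk> \<Longrightarrow>
    \<exists>T \<in> mult_ops R. \<forall>t\<in>I. T (f t) = (if t = s then \<one> else \<zero>)"
proof (induction "card I" arbitrary: I s)
  case 0
  then show ?case by auto
next
  case (Suc n I s)
  define J where "J = I - {s}"
  have J: "finite J" "s \<notin> J" "I = insert s J" "card J = n"
    using Suc.prems Suc.hyps(2) by (auto simp: J_def)
  have f: "f s \<in> carrier R" "\<And>t. t \<in> J \<Longrightarrow> f t \<in> carrier R" using Suc.prems J by auto
  have "lin_indep f J" using Suc.prems J by (intro lin_indep_subset[of f I J]) auto
  then have "\<exists>T \<in> mult_ops R. \<forall>u\<in>J. T (f u) = (if u = t then \<one> else \<zero>)" if "t \<in> J" for t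
    using Suc.hyps(1)[of J t] J f that by auto
  then obtain T where T: "\<And>t. t \<in> J \<Longrightarrow> T t \<in> mult_ops R"
    and Tf: "\<And>t u. \<lbrakk>t \<in> J; u \<in> J\<rbrakk> \<Longrightarrow> T t (f u) = (if u = t then \<one> else \<zero>)"
    by metis
  have "\<exists>U \<in> mult_ops R. (\<forall>t\<in>J. U (f t) = \<zero>) \<and> U (f s) \<noteq> \<zero>"
  proof (rule ccontr)
    assume neg: "\<not> ?thesis"
    then have dep: "U (f s) = \<zero>" if "U \<in> mult_ops R" "\<And>t. t \<in> J \<Longrightarrow> U (f t) = \<zero>" for U
      using that by blast
    define b where "b t = T t (f s)" for t
    have bc: "b t \<in> carrier R" if "t \<in> J" for t using T f that by (auto simp: b_def)
    have b: "b t \<in> k" if t: "t \<in> J" for t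
    proof -
      have "b t \<otimes> x = x \<otimes> b t" if x: "x \<in> carrier R" for x
      proof -
        \<comment> \<open>The commutator of \<open>x\<close> with \<open>T t z\<close> vanishes at
          every \<open>f u\<close>, since \<open>T t (f u)\<close> is \<open>\<one>\<close> or
          \<open>\<zero>\<close>. By \<open>dep\<close> it vanishes at \<open>f s\<close> too, so
          \<open>b t\<close> commutes with \<open>x\<close>.\<close>
        let ?U = "\<lambda>z. x \<otimes> T t z \<oplus> \<ominus> \<one> \<otimes> (T t z \<otimes> x)"
        have "?U \<in> mult_ops R" using T t x by (intro mult_ops.intros) auto
        moreover have "?U (f u) = \<zero>" if "u \<in> J" for u
          using Tf[OF t that] x by (auto simp: l_minus r_neg)
        ultimately have "?U (f s) = \<zero>" by (rule dep)
        then have "x \<otimes> b t \<oplus> \<ominus> (b t \<otimes> x) = \<zero>" using bc[OF t] x by (simp add: b_def l_minus)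
        then show ?thesis using bc[OF t] x by (metis a_inv_closed m_closed minus_equality minus_minus)
      qed
      then have "b t \<in> ring_centre R" using bc[OF t] by (auto simp: ring_centre_def)
      then show ?thesis using centre by simp
    qed
    obtain W where W: "W \<in> mult_ops R" "\<And>z. z \<in> carrier R \<Longrightarrow> W z = (\<Oplus>t\<in>J. f t \<otimes> T t z)"
      using mult_ops_linear_combination[of J T f] J(1) T f by blast
    \<comment> \<open>Identity minus interpolation: zero at every \<open>f u\<close> with
      \<open>u\<close> in \<open>J\<close>, hence zero at \<open>f s\<close>. This is the relation
      that contradicts independence, with coefficient \<open>\<ominus> \<one>\<close> at
      \<open>s\<close>.\<close>
    let ?U = "\<lambda>z. z \<oplus> \<ominus> \<one> \<otimes> W z"
    have "?U \<in> mult_ops R" using W by (intro mult_ops.intros) auto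
    moreover have "?U (f u) = \<zero>" if u: "u \<in> J" for u
    proof -
      have "W (f u) = (\<Oplus>t\<in>J. if u = t then f t else \<zero>)"
        unfolding W(2)[OF f(2)[OF u]]
        using f Tf u by (intro finsum_cong') auto
      also have "\<dots> = f u" using f u J(1) by (intro add.finprod_singleton) auto
      finally show ?thesis using f(2)[OF u] by (simp add: l_minus r_neg)
    qed
    ultimately have "?U (f s) = \<zero>" by (rule dep)
    then have "\<ominus> (f s) \<oplus> W (f s) = \<zero>"
      using f W(1) by (metis a_comm a_inv_closed l_minus l_one mult_ops_closed one_closed r_neg
          add.inv_solve_right' minus_equality minus_minus)
    moreover have "W (f s) = (\<Oplus>t\<in>J. b t \<otimes> f t)"
      unfolding W(2)[OF f(1)]
      using f bc central[OF b] by (intro finsum_cong') (auto simp: b_def[symmetric])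
    moreover define g where "g t = (if t = s then \<ominus> \<one> else b t)" for t
    moreover have "(\<Oplus>t\<in>J. g t \<otimes> f t) = (\<Oplus>t\<in>J. b t \<otimes> f t)"
      using J(2) f bc by (intro finsum_cong') (auto simp: g_def)
    moreover have "(\<Oplus>t\<in>I. g t \<otimes> f t) = g s \<otimes> f s \<oplus> (\<Oplus>t\<in>J. g t \<otimes> f t)"
      unfolding J(3) using J(1,2) f bc by (intro finsum_insert) (auto simp: g_def)
    ultimately have "(\<Oplus>t\<in>I. g t \<otimes> f t) = \<zero>" using f(1) by (simp add: g_def l_minus)
    moreover have "g \<in> I \<rightarrow> k"
      using b J subringE(5)[OF subfieldE(1)[OF subfield] one_in_scalars] by (auto simp: g_def)
    ultimately have "g s = \<zero>" using Suc.prems unfolding lin_indep_def by auto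
    then show False using one_neq_zero by (simp add: g_def)
  qed
  then obtain U where U: "U \<in> mult_ops R" "\<And>t. t \<in> J \<Longrightarrow> U (f t) = \<zero>" "U (f s) \<noteq> \<zero>" by blast
  \<comment> \<open>Simplicity turns the nonzero value at \<open>f s\<close> into
    \<open>\<one>\<close>; additivity of \<open>T'\<close> keeps the zeros at the other
    members.\<close>
  obtain T' where T': "T' \<in> mult_ops R" "T' (U (f s)) = \<one>"
    using simple_mult_op_eq_one[OF simple _ U(3)] U(1) f by auto
  have "\<forall>t\<in>I. T' (U (f t)) = (if t = s then \<one> else \<zero>)"
    using T' U J mult_ops_zero[OF T'(1)] by auto
  then show ?case using mult_ops_comp[OF T'(1) U(1)] by (intro bexI[of _ "\<lambda>z. T' (U z)"])
qed

lemma sandwich_carrier: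
  assumes "X1 \<subseteq> carrier R" "X2 \<subseteq> carrier R" "a \<in> carrier R"
  shows "{x \<otimes> a \<otimes> y |x y. x \<in> X1 \<and> y \<in> X2} \<subseteq> carrier R"
  using assms by (auto intro!: m_closed dest: subsetD)

text \<open>An operator involves finitely many multipliers, and some filtration step contains them
  all. That \<open>j\<close> precedes the quantifier over \<open>a\<close> is the uniformity
  required of a return function; the range \<open>i \<ge> j\<close> lets the induction take
  maxima.\<close>

lemma mult_op_in_sandwich:
  assumes S: "S \<subseteq> carrier R" "generate_ring R (k \<union> S) = carrier R" and "T \<in> mult_ops R"
  shows "\<exists>j. \<forall>i\<ge>j. \<forall>a\<in>carrier R.
    T a \<in> subspace_span R k {x \<otimes> a \<otimes> y |x y. x \<in> Fil S i \<and> y \<in> Fil S i}"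
  using assms(3)
proof (induction rule: mult_ops.induct)
  let ?W = "\<lambda>i a. {x \<otimes> a \<otimes> y |x y. x \<in> Fil S i \<and> y \<in> Fil S i}"
  have W: "?W i a \<subseteq> carrier R" if "a \<in> carrier R" for i a
    using that filtration_carrier[OF S(1)] by (intro sandwich_carrier)
  {
    case ident
    have "a \<in> ?W i a" if "a \<in> carrier R" for i a
      using that one_filtration[OF S(1), of i] by (intro CollectI exI[of _ \<one>]) auto
    then show ?case using subspace_span_superset[OF W] by blast
  next
    case (add T U)
    then obtain j1 j2 where
      "\<And>i a. \<lbrakk>i \<ge> j1; a \<in> carrier R\<rbrakk> \<Longrightarrow> T a \<in> subspace_span R k (?W i a)"
      "\<And>i a. \<lbrakk>i \<ge> j2; a \<in> carrier R\<rbrakk> \<Longrightarrow> U a \<in> subspace_span R k (?W i a)" by blast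
    then show ?case
      using subspaceD(3)[OF subspace_subspace_span[OF W]] by (intro exI[of _ "max j1 j2"]) auto
  next
    case (lmult x T)
    then obtain j where j: "\<And>i a. \<lbrakk>i \<ge> j; a \<in> carrier R\<rbrakk> \<Longrightarrow> T a \<in> subspace_span R k (?W i a)"
      by blast
    obtain l where l: "x \<in> Fil S l" using generate_ring_filtration[OF S(1)] lmult.hyps S(2) by blast
    show ?case
    \<comment> \<open>The new multiplier \<open>x\<close> uses up \<open>l\<close> steps, so the
      induction hypothesis is applied at index \<open>i - l\<close>, which is still at least
      \<open>j\<close>.\<close>
    proof (intro exI[of _ "l + j"] allI impI ballI)
      fix i a assume i: "l + j \<le> i" and a: "a \<in> carrier R"
      have "v \<otimes> w \<in> subspace_span R k (?W i a)" if "v \<in> {x}" "w \<in> ?W (i - l) a" for v w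
      proof -
        obtain p q where pq: "w = p \<otimes> a \<otimes> q" "p \<in> Fil S (i - l)" "q \<in> Fil S (i - l)"
          using \<open>w \<in> ?W (i - l) a\<close> by auto
        have "x \<otimes> p \<in> Fil S i" using filtration_mult[OF S(1) l pq(2)] i by simp
        moreover have "q \<in> Fil S i" using pq(3) filtration_mono[OF S(1), of "i - l" i] by auto
        moreover have "v \<otimes> w = (x \<otimes> p) \<otimes> a \<otimes> q"
          using that pq a lmult.hyps filtration_carrier[OF S(1), of "i - l"]
          by (auto simp: m_assoc subset_iff)
        ultimately have "v \<otimes> w \<in> ?W i a" by blast
        then show ?thesis using subspace_span_superset[OF W[OF a]] by blast
      qed
      moreover have "T a \<in> subspace_span R k (?W (i - l) a)" using j[of "i - l"] i a by simp
      moreover have "x \<in> subspace_span R k {x}" using subspace_span_superset[of "{x}"] lmult.hyps by auto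
      ultimately show "x \<otimes> T a \<in> subspace_span R k (?W i a)"
        using span_mult_span[OF subspace_subspace_span[OF W[OF a]], of "{x}" "?W (i - l) a"]
          W[OF a] lmult.hyps by blast
    qed
  next
    case (rmult x T)
    then obtain j where j: "\<And>i a. \<lbrakk>i \<ge> j; a \<in> carrier R\<rbrakk> \<Longrightarrow> T a \<in> subspace_span R k (?W i a)"
      by blast
    obtain l where l: "x \<in> Fil S l" using generate_ring_filtration[OF S(1)] rmult.hyps S(2) by blast
    show ?case
    proof (intro exI[of _ "j + l"] allI impI ballI)
      fix i a assume i: "j + l \<le> i" and a: "a \<in> carrier R"
      have "w \<otimes> v \<in> subspace_span R k (?W i a)" if "w \<in> ?W (i - l) a" "v \<in> {x}" for v w
      proof -
        obtain p q where pq: "w = p \<otimes> a \<otimes> q" "p \<in> Fil S (i - l)" "q \<in> Fil S (i - l)"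
          using \<open>w \<in> ?W (i - l) a\<close> by auto
        have "q \<otimes> x \<in> Fil S i" using filtration_mult[OF S(1) pq(3) l] i by simp
        moreover have "p \<in> Fil S i" using pq(2) filtration_mono[OF S(1), of "i - l" i] by auto
        moreover have "w \<otimes> v = p \<otimes> a \<otimes> (q \<otimes> x)"
          using that pq a rmult.hyps filtration_carrier[OF S(1), of "i - l"]
          by (auto simp: m_assoc subset_iff)
        ultimately have "w \<otimes> v \<in> ?W i a" by blast
        then show ?thesis using subspace_span_superset[OF W[OF a]] by blast
      qed
      moreover have "T a \<in> subspace_span R k (?W (i - l) a)" using j[of "i - l"] i a by simp
      moreover have "x \<in> subspace_span R k {x}" using subspace_span_superset[of "{x}"] rmult.hyps by auto
      ultimately show "T a \<otimes> x \<in> subspace_span R k (?W i a)"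
        using span_mult_span[OF subspace_subspace_span[OF W[OF a]], of "?W (i - l) a" "{x}"]
          W[OF a] rmult.hyps by blast
    qed
  }
qed

end

section \<open>Tensor products of algebras\<close>

lemma frag_extend_fun_add: "frag_extend (\<lambda>p. u p + v p) f = frag_extend u f + frag_extend v f"
  by (simp add: frag_extend_def frag_cmul_distrib2 sum.distrib)

lemma frag_extend_fun_diff:
  fixes u v :: "'p \<Rightarrow> 'q \<Rightarrow>\<^sub>0 int"
  shows "frag_extend (\<lambda>p. u p - v p) f = frag_extend u f - frag_extend v f"
  proof -
  have "frag_cmul c (x - y) = frag_cmul c x - frag_cmul c y" for c and x y :: "'q \<Rightarrow>\<^sub>0 int"
    by (rule poly_mapping_eqI) (simp add: lookup_minus right_diff_distrib)
  then show ?thesis by (simp add: frag_extend_def sum_subtractf)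
qed

text \<open>The additive extension of \<open>h\<close> to the free abelian group; the ring structure
  of the target serves to write integer multiples.\<close>

definition frag_eval :: "('p \<Rightarrow> 'g::ring_1) \<Rightarrow> ('p \<Rightarrow>\<^sub>0 int) \<Rightarrow> 'g" where
  "frag_eval h f = (\<Sum>p\<in>Poly_Mapping.keys f. of_int (Poly_Mapping.lookup f p) * h p)"

lemma frag_eval_superset:
  assumes "finite K" "Poly_Mapping.keys f \<subseteq> K"
  shows "frag_eval h f = (\<Sum>p\<in>K. of_int (Poly_Mapping.lookup f p) * h p)"
  unfolding frag_eval_def using assms by (intro sum.mono_neutral_left) (auto simp: in_keys_iff)

lemma frag_eval_diff: "frag_eval h (f - g) = frag_eval h f - frag_eval h g"
proof -
  let ?K = "Poly_Mapping.keys f \<union> Poly_Mapping.keys g"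
  have "Poly_Mapping.keys (f - g) \<subseteq> ?K" by (rule keys_diff)
  then show ?thesis
    by (simp add: frag_eval_superset[of ?K] lookup_minus left_diff_distrib sum_subtractf)
qed

lemma frag_eval_zero [simp]: "frag_eval h 0 = 0"
  by (simp add: frag_eval_def)

lemma frag_eval_add: "frag_eval h (f + g) = frag_eval h f + frag_eval h g"
  using frag_eval_diff[of h f "- g"] frag_eval_diff[of h 0 g] by simp

lemma frag_eval_of [simp]: "frag_eval h (frag_of p) = h p"
  by (simp add: frag_eval_def)

locale tensor_product = S: cring S + A: ring A
  for S :: "('s, 'c) ring_scheme" (structure) and A :: "('a, 'b) ring_scheme" (structure) +
  fixes \<sigma> :: "'k \<Rightarrow> 's" and \<iota> :: "'k \<Rightarrow> 'a"
  assumes \<sigma>_closed [simp, intro]: "\<sigma> c \<in> carrier S"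
    and \<iota>_closed [simp, intro]: "\<iota> c \<in> carrier A"
    and \<iota>_central: "a \<in> carrier A \<Longrightarrow> \<iota> c \<otimes>\<^bsub>A\<^esub> a = a \<otimes>\<^bsub>A\<^esub> \<iota> c"
begin

abbreviation "P \<equiv> tensor_presentation S A"
abbreviation "rel \<equiv> tensor_relations S \<sigma> A \<iota>"
abbreviation "B \<equiv> tensor_algebra S \<sigma> A \<iota>"
abbreviation "pt \<equiv> pure_tensor S \<sigma> A \<iota>"

lemma P_simps:
  "carrier P = {f. Poly_Mapping.keys f \<subseteq> carrier S \<times> carrier A}"
  "\<one>\<^bsub>P\<^esub> = frag_of (\<one>\<^bsub>S\<^esub>, \<one>\<^bsub>A\<^esub>)" "\<zero>\<^bsub>P\<^esub> = 0" "f \<oplus>\<^bsub>P\<^esub> g = f + g"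
  by (simp_all add: tensor_presentation_def)

lemma P_mult: "f \<otimes>\<^bsub>P\<^esub> g =
    frag_extend (\<lambda>(s, a). frag_extend (\<lambda>(t, b). frag_of (s \<otimes>\<^bsub>S\<^esub> t, a \<otimes>\<^bsub>A\<^esub> b)) g) f"
  by (simp add: tensor_presentation_def)

lemma P_mult_of: "frag_of (s, a) \<otimes>\<^bsub>P\<^esub> frag_of (t, b) = frag_of (s \<otimes>\<^bsub>S\<^esub> t, a \<otimes>\<^bsub>A\<^esub> b)"
  by (simp add: P_mult)

lemma P_mult_linear:
  "(f + g) \<otimes>\<^bsub>P\<^esub> h = f \<otimes>\<^bsub>P\<^esub> h + g \<otimes>\<^bsub>P\<^esub> h" "(f - g) \<otimes>\<^bsub>P\<^esub> h = f \<otimes>\<^bsub>P\<^esub> h - g \<otimes>\<^bsub>P\<^esub> h"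
  "h \<otimes>\<^bsub>P\<^esub> (f + g) = h \<otimes>\<^bsub>P\<^esub> f + h \<otimes>\<^bsub>P\<^esub> g" "h \<otimes>\<^bsub>P\<^esub> (f - g) = h \<otimes>\<^bsub>P\<^esub> f - h \<otimes>\<^bsub>P\<^esub> g"
  "0 \<otimes>\<^bsub>P\<^esub> h = 0" "h \<otimes>\<^bsub>P\<^esub> 0 = 0"
  by (simp_all add: P_mult frag_extend_add frag_extend_diff case_prod_unfold
      frag_extend_fun_add frag_extend_fun_diff frag_extend_eq_0)

lemma P_induct [consumes 1, case_names zero of diff]:
  assumes "f \<in> carrier P" "Q 0"
    and "\<And>s a. \<lbrakk>s \<in> carrier S; a \<in> carrier A\<rbrakk> \<Longrightarrow> Q (frag_of (s, a))"
    and "\<And>f g. \<lbrakk>Q f; Q g\<rbrakk> \<Longrightarrow> Q (f - g)"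
  shows "Q f"
proof -
  have "Poly_Mapping.keys f \<subseteq> carrier S \<times> carrier A" using assms(1) by (simp add: P_simps)
  then show ?thesis
    by (induction f rule: frag_induction) (use assms(2-4) in auto)
qed

lemma frag_of_in_P [simp]: "\<lbrakk>s \<in> carrier S; a \<in> carrier A\<rbrakk> \<Longrightarrow> frag_of (s, a) \<in> carrier P"
  by (simp add: P_simps)

lemma P_diff_closed: "\<lbrakk>f \<in> carrier P; g \<in> carrier P\<rbrakk> \<Longrightarrow> f - g \<in> carrier P"
  using keys_diff[of f g] by (auto simp: P_simps)

lemma P_mult_closed: "\<lbrakk>f \<in> carrier P; g \<in> carrier P\<rbrakk> \<Longrightarrow> f \<otimes>\<^bsub>P\<^esub> g \<in> carrier P"
proof (induction f rule: P_induct)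
  case (of s a)
  from of(3) show ?case
    by (induction g rule: P_induct)
      (use of in \<open>auto simp: P_mult_linear P_mult_of P_diff_closed\<close>, simp_all add: P_simps)
qed (auto simp: P_mult_linear P_diff_closed, simp add: P_simps)

lemma ring_P: "ring P"
proof (rule ringI)
  show "abelian_group P"
  proof (rule abelian_groupI)
    show "f \<oplus>\<^bsub>P\<^esub> g \<in> carrier P" if "f \<in> carrier P" "g \<in> carrier P" for f g
      using that keys_add[of f g] by (auto simp: P_simps)
    show "\<exists>g\<in>carrier P. g \<oplus>\<^bsub>P\<^esub> f = \<zero>\<^bsub>P\<^esub>" if "f \<in> carrier P" for f
      using that by (intro bexI[of _ "- f"]) (auto simp: P_simps)
  qed (auto simp: P_simps add_ac)
  show "monoid P"
  proof (rule monoidI)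
    show "f \<otimes>\<^bsub>P\<^esub> g \<otimes>\<^bsub>P\<^esub> h = f \<otimes>\<^bsub>P\<^esub> (g \<otimes>\<^bsub>P\<^esub> h)"
      if "f \<in> carrier P" "g \<in> carrier P" "h \<in> carrier P" for f g h
      using that(1)
    proof (induction f rule: P_induct)
      case (of s a)
      from that(2) show ?case
      proof (induction g rule: P_induct)
        case (of t b)
        from that(3) show ?case
        proof (induction h rule: P_induct)
          case (of u c)
          then show ?case
            using \<open>s \<in> carrier S\<close> \<open>a \<in> carrier A\<close> \<open>t \<in> carrier S\<close> \<open>b \<in> carrier A\<close>
            by (simp add: P_mult_of S.m_assoc A.m_assoc)
        qed (simp_all add: P_mult_linear)
      qed (simp_all add: P_mult_linear)
    qed (simp_all add: P_mult_linear)
    show "\<one>\<^bsub>P\<^esub> \<otimes>\<^bsub>P\<^esub> f = f" if "f \<in> carrier P" for f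
      using that by (induction f rule: P_induct) (simp_all add: P_mult_linear P_mult_of P_simps(2))
    show "f \<otimes>\<^bsub>P\<^esub> \<one>\<^bsub>P\<^esub> = f" if "f \<in> carrier P" for f
      using that by (induction f rule: P_induct) (simp_all add: P_mult_linear P_mult_of P_simps(2))
  qed (simp_all add: P_mult_closed, simp add: P_simps)
qed (simp_all add: P_mult_linear P_simps(4))

sublocale P: ring P by (rule ring_P)

lemma P_minus: "f \<in> carrier P \<Longrightarrow> \<ominus>\<^bsub>P\<^esub> f = - f"
  by (rule P.minus_equality) (auto simp: P_simps)

lemma P_diff: "\<lbrakk>f \<in> carrier P; g \<in> carrier P\<rbrakk> \<Longrightarrow> f \<ominus>\<^bsub>P\<^esub> g = f - g"
  by (simp add: a_minus_def P_minus P_simps(4))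

lemma rel_in_P: "rel \<subseteq> carrier P"
  unfolding tensor_relations_def by (auto intro!: P_diff_closed frag_of_in_P)

text \<open>The subgroup generated by the relations. Once it is identified with the tensor ideal,
  its induction rule shows that a map killing each relation kills the ideal.\<close>

inductive_set rel_span where
  zero: "0 \<in> rel_span"
| rel: "r \<in> rel \<Longrightarrow> r \<in> rel_span"
| diff: "\<lbrakk>f \<in> rel_span; g \<in> rel_span\<rbrakk> \<Longrightarrow> f - g \<in> rel_span"

lemma rel_add_left:
  "\<lbrakk>s \<in> carrier S; t \<in> carrier S; a \<in> carrier A\<rbrakk> \<Longrightarrow>
    frag_of (s \<oplus>\<^bsub>S\<^esub> t, a) - frag_of (s, a) - frag_of (t, a) \<in> rel"
  unfolding tensor_relations_def by blast

lemma rel_add_right: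
  "\<lbrakk>s \<in> carrier S; a \<in> carrier A; b \<in> carrier A\<rbrakk> \<Longrightarrow>
    frag_of (s, a \<oplus>\<^bsub>A\<^esub> b) - frag_of (s, a) - frag_of (s, b) \<in> rel"
  unfolding tensor_relations_def by blast

lemma rel_scalar:
  "\<lbrakk>s \<in> carrier S; a \<in> carrier A\<rbrakk> \<Longrightarrow>
    frag_of (s \<otimes>\<^bsub>S\<^esub> \<sigma> c, a) - frag_of (s, \<iota> c \<otimes>\<^bsub>A\<^esub> a) \<in> rel"
  unfolding tensor_relations_def by blast

lemma rel_cases [consumes 1, case_names add_left add_right scalar]:
  assumes "r \<in> rel"
    and "\<And>s t a. \<lbrakk>s \<in> carrier S; t \<in> carrier S; a \<in> carrier A;
        r = frag_of (s \<oplus>\<^bsub>S\<^esub> t, a) - frag_of (s, a) - frag_of (t, a)\<rbrakk> \<Longrightarrow> thesis"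
    and "\<And>s a b. \<lbrakk>s \<in> carrier S; a \<in> carrier A; b \<in> carrier A;
        r = frag_of (s, a \<oplus>\<^bsub>A\<^esub> b) - frag_of (s, a) - frag_of (s, b)\<rbrakk> \<Longrightarrow> thesis"
    and "\<And>s c a. \<lbrakk>s \<in> carrier S; a \<in> carrier A;
        r = frag_of (s \<otimes>\<^bsub>S\<^esub> \<sigma> c, a) - frag_of (s, \<iota> c \<otimes>\<^bsub>A\<^esub> a)\<rbrakk> \<Longrightarrow> thesis"
  shows thesis
  using assms(1) unfolding tensor_relations_def
  by (elim UnE CollectE exE conjE) (rule assms(2) assms(3) assms(4); assumption)+

text \<open>A relation multiplied by a generator is again a single relation of the same kind. For
  the scalar relations this rests on the centrality of \<open>\<iota> c\<close> and on the
  commutativity of \<open>S\<close>.\<close>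

lemma rel_mult:
  assumes "s \<in> carrier S" "a \<in> carrier A" "r \<in> rel"
  shows "frag_of (s, a) \<otimes>\<^bsub>P\<^esub> r \<in> rel" "r \<otimes>\<^bsub>P\<^esub> frag_of (s, a) \<in> rel"
proof -
  from assms(3) have "frag_of (s, a) \<otimes>\<^bsub>P\<^esub> r \<in> rel \<and> r \<otimes>\<^bsub>P\<^esub> frag_of (s, a) \<in> rel"
  proof (cases r rule: rel_cases)
    case (add_left t u b)
    then show ?thesis
      using assms(1,2) rel_add_left[of "s \<otimes>\<^bsub>S\<^esub> t" "s \<otimes>\<^bsub>S\<^esub> u" "a \<otimes>\<^bsub>A\<^esub> b"]
        rel_add_left[of "t \<otimes>\<^bsub>S\<^esub> s" "u \<otimes>\<^bsub>S\<^esub> s" "b \<otimes>\<^bsub>A\<^esub> a"]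
      by (simp add: P_mult_linear P_mult_of S.l_distr S.r_distr)
  next
    case (add_right t b c)
    then show ?thesis
      using assms(1,2) rel_add_right[of "s \<otimes>\<^bsub>S\<^esub> t" "a \<otimes>\<^bsub>A\<^esub> b" "a \<otimes>\<^bsub>A\<^esub> c"]
        rel_add_right[of "t \<otimes>\<^bsub>S\<^esub> s" "b \<otimes>\<^bsub>A\<^esub> a" "c \<otimes>\<^bsub>A\<^esub> a"]
      by (simp add: P_mult_linear P_mult_of A.l_distr A.r_distr)
  next
    case (scalar t c b)
    have "a \<otimes>\<^bsub>A\<^esub> (\<iota> c \<otimes>\<^bsub>A\<^esub> b) = \<iota> c \<otimes>\<^bsub>A\<^esub> (a \<otimes>\<^bsub>A\<^esub> b)"
      using assms(2) scalar(2) \<iota>_central[of a c] \<iota>_closed[of c] by (metis A.m_assoc)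
    moreover have "(t \<otimes>\<^bsub>S\<^esub> \<sigma> c) \<otimes>\<^bsub>S\<^esub> s = (t \<otimes>\<^bsub>S\<^esub> s) \<otimes>\<^bsub>S\<^esub> \<sigma> c"
      using assms(1) scalar(1) by (simp add: S.m_ac)
    ultimately show ?thesis
      using assms(1,2) scalar rel_scalar[of "s \<otimes>\<^bsub>S\<^esub> t" "a \<otimes>\<^bsub>A\<^esub> b" c]
        rel_scalar[of "t \<otimes>\<^bsub>S\<^esub> s" "b \<otimes>\<^bsub>A\<^esub> a" c]
      by (simp add: P_mult_linear P_mult_of S.m_assoc A.m_assoc)
  qed
  then show "frag_of (s, a) \<otimes>\<^bsub>P\<^esub> r \<in> rel" "r \<otimes>\<^bsub>P\<^esub> frag_of (s, a) \<in> rel" by auto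
qed

lemma zero_in_P: "0 \<in> carrier P"
  by (simp add: P_simps)

lemma rel_span_in_P: "f \<in> rel_span \<Longrightarrow> f \<in> carrier P"
proof (induction rule: rel_span.induct)
  case (rel r)
  then show ?case using rel_in_P by blast
qed (simp_all add: zero_in_P P_diff_closed)

lemma rel_span_ideal: "ideal rel_span P"
proof (rule idealI[OF ring_P])
  have uminus: "- f \<in> rel_span" if "f \<in> rel_span" for f
    using rel_span.diff[OF rel_span.zero that] by simp
  show "subgroup rel_span (add_monoid P)"
  proof (rule P.add.subgroupI)
    show "\<ominus>\<^bsub>P\<^esub> f \<in> rel_span" if "f \<in> rel_span" for f
      using uminus[OF that] P_minus[OF rel_span_in_P[OF that]] by (simp add: a_inv_def)
    show "f \<oplus>\<^bsub>P\<^esub> g \<in> rel_span" if "f \<in> rel_span" "g \<in> rel_span" for f g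
      using rel_span.diff[OF that(1) uminus[OF that(2)]] by (simp add: P_simps)
    show "rel_span \<subseteq> carrier P" using rel_span_in_P by blast
    show "rel_span \<noteq> {}" using rel_span.zero by blast
  qed
  fix r f assume r: "r \<in> rel_span" and f: "f \<in> carrier P"
  show "f \<otimes>\<^bsub>P\<^esub> r \<in> rel_span" using f
  proof (induction f rule: P_induct)
    case (of s a)
    from r show ?case
      by (induction rule: rel_span.induct)
        (use of in \<open>auto simp: P_mult_linear intro: rel_span.intros rel_mult\<close>)
  qed (auto simp: P_mult_linear intro: rel_span.intros)
  show "r \<otimes>\<^bsub>P\<^esub> f \<in> rel_span" using f
  proof (induction f rule: P_induct)
    case (of s a)
    from r show ?case
      by (induction rule: rel_span.induct)
        (use of in \<open>auto simp: P_mult_linear intro: rel_span.intros rel_mult\<close>)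
  qed (auto simp: P_mult_linear intro: rel_span.intros)
qed

lemma tensor_ideal_eq: "tensor_ideal S \<sigma> A \<iota> = rel_span"
proof
  show "tensor_ideal S \<sigma> A \<iota> \<subseteq> rel_span"
    unfolding tensor_ideal_def
    by (rule P.genideal_minimal[OF rel_span_ideal]) (auto intro: rel_span.rel)
  interpret ideal "tensor_ideal S \<sigma> A \<iota>" P
    unfolding tensor_ideal_def by (rule P.genideal_ideal[OF rel_in_P])
  show "rel_span \<subseteq> tensor_ideal S \<sigma> A \<iota>"
  proof
    fix f assume "f \<in> rel_span"
    then show "f \<in> tensor_ideal S \<sigma> A \<iota>"
    proof (induction rule: rel_span.induct)
      case zero
      then show ?case using additive_subgroup.zero_closed[OF additive_subgroup_axioms] by (simp add: P_simps)
    next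
      case (rel r)
      then show ?case unfolding tensor_ideal_def using P.genideal_self[OF rel_in_P] by blast
    next
      case (diff f g)
      then have "f \<ominus>\<^bsub>P\<^esub> g \<in> tensor_ideal S \<sigma> A \<iota>"
        by (simp add: a_minus_def additive_subgroup.a_inv_closed[OF additive_subgroup_axioms]
            additive_subgroup.a_closed[OF additive_subgroup_axioms])
      then show ?case using P_diff[OF rel_span_in_P rel_span_in_P] diff.hyps by simp
    qed
  qed
qed

sublocale I: ideal rel_span P by (rule rel_span_ideal)

lemma B_def': "B = P Quot rel_span"
  by (simp add: tensor_algebra_def tensor_ideal_eq)

sublocale B: ring B
  unfolding B_def' by (rule I.quotient_is_ring)

abbreviation "proj f \<equiv> rel_span +>\<^bsub>P\<^esub> f"

lemma proj_hom: "proj \<in> ring_hom P B"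
  unfolding B_def' by (rule I.rcos_ring_hom)

lemma pt_def': "pt s a = proj (frag_of (s, a))"
  by (simp add: pure_tensor_def tensor_ideal_eq)

lemma proj_closed: "f \<in> carrier P \<Longrightarrow> proj f \<in> carrier B"
  using ring_hom_closed[OF proj_hom] .

lemma proj_add: "\<lbrakk>f \<in> carrier P; g \<in> carrier P\<rbrakk> \<Longrightarrow> proj (f + g) = proj f \<oplus>\<^bsub>B\<^esub> proj g"
  using ring_hom_add[OF proj_hom] by (simp add: P_simps(4))

lemma proj_surj: "V \<in> carrier B \<Longrightarrow> \<exists>f\<in>carrier P. V = proj f"
  unfolding B_def' FactRing_def A_RCOSETS_def' by auto

lemma proj_eq_iff: "\<lbrakk>f \<in> carrier P; g \<in> carrier P\<rbrakk> \<Longrightarrow> proj f = proj g \<longleftrightarrow> f - g \<in> rel_span"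
  using P.quotient_eq_iff_same_a_r_cos[OF rel_span_ideal, of f g] by (simp add: P_diff)

lemma pt_closed [simp, intro]: "\<lbrakk>s \<in> carrier S; a \<in> carrier A\<rbrakk> \<Longrightarrow> pt s a \<in> carrier B"
  by (simp add: pt_def' proj_closed)

lemma pt_add_left:
  assumes "s \<in> carrier S" "t \<in> carrier S" "a \<in> carrier A"
  shows "pt (s \<oplus>\<^bsub>S\<^esub> t) a = pt s a \<oplus>\<^bsub>B\<^esub> pt t a"
proof -
  have "frag_of (s, a) + frag_of (t, a) \<in> carrier P"
    using P.a_closed[of "frag_of (s, a)" "frag_of (t, a)"] assms by (simp add: P_simps(4))
  then show ?thesis
    unfolding pt_def' using assms rel_span.rel[OF rel_add_left[OF assms]]
    by (simp add: proj_add[symmetric] proj_eq_iff diff_diff_eq)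
qed

lemma pt_add_right:
  assumes "s \<in> carrier S" "a \<in> carrier A" "b \<in> carrier A"
  shows "pt s (a \<oplus>\<^bsub>A\<^esub> b) = pt s a \<oplus>\<^bsub>B\<^esub> pt s b"
proof -
  have "frag_of (s, a) + frag_of (s, b) \<in> carrier P"
    using P.a_closed[of "frag_of (s, a)" "frag_of (s, b)"] assms by (simp add: P_simps(4))
  then show ?thesis
    unfolding pt_def' using assms rel_span.rel[OF rel_add_right[OF assms]]
    by (simp add: proj_add[symmetric] proj_eq_iff diff_diff_eq)
qed

lemma pt_scalar:
  assumes "s \<in> carrier S" "a \<in> carrier A"
  shows "pt (s \<otimes>\<^bsub>S\<^esub> \<sigma> c) a = pt s (\<iota> c \<otimes>\<^bsub>A\<^esub> a)"
  unfolding pt_def' using assms rel_span.rel[OF rel_scalar[OF assms]] by (simp add: proj_eq_iff)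

lemma pt_mult:
  assumes "s \<in> carrier S" "a \<in> carrier A" "t \<in> carrier S" "b \<in> carrier A"
  shows "pt s a \<otimes>\<^bsub>B\<^esub> pt t b = pt (s \<otimes>\<^bsub>S\<^esub> t) (a \<otimes>\<^bsub>A\<^esub> b)"
  unfolding pt_def' using ring_hom_mult[OF proj_hom, of "frag_of (s, a)" "frag_of (t, b)"] assms
  by (simp add: P_mult_of)

lemma pt_one: "\<one>\<^bsub>B\<^esub> = pt \<one>\<^bsub>S\<^esub> \<one>\<^bsub>A\<^esub>"
  unfolding pt_def' using ring_hom_one[OF proj_hom] by (simp add: P_simps(2))

lemma pt_zero_left: "a \<in> carrier A \<Longrightarrow> pt \<zero>\<^bsub>S\<^esub> a = \<zero>\<^bsub>B\<^esub>"
  using pt_add_left[of "\<zero>\<^bsub>S\<^esub>" "\<zero>\<^bsub>S\<^esub>" a] by (simp add: B.add.l_cancel_one')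

lemma pt_zero_right: "s \<in> carrier S \<Longrightarrow> pt s \<zero>\<^bsub>A\<^esub> = \<zero>\<^bsub>B\<^esub>"
  using pt_add_right[of s "\<zero>\<^bsub>A\<^esub>" "\<zero>\<^bsub>A\<^esub>"] by (simp add: B.add.l_cancel_one')

text \<open>Sums of pure tensors exhaust the tensor product because a negative is absorbed into the
  left factor, \<open>- (s \<otimes> a) = (- s) \<otimes> a\<close>. To exploit this, the induction
  on representatives carries \<open>f\<close> and \<open>- f\<close> together.\<close>

lemma tensor_induct [consumes 1, case_names zero pt add]:
  assumes "V \<in> carrier B" "Q \<zero>\<^bsub>B\<^esub>"
    and pt: "\<And>s a. \<lbrakk>s \<in> carrier S; a \<in> carrier A\<rbrakk> \<Longrightarrow> Q (pt s a)"
    and add: "\<And>V W. \<lbrakk>V \<in> carrier B; W \<in> carrier B; Q V; Q W\<rbrakk> \<Longrightarrow> Q (V \<oplus>\<^bsub>B\<^esub> W)"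
  shows "Q V"
proof -
  obtain f where f: "f \<in> carrier P" "V = proj f" using proj_surj assms(1) by blast
  have z: "proj 0 = \<zero>\<^bsub>B\<^esub>"
    using ring_hom_zero[OF proj_hom ring_P B.ring_axioms] by (simp add: P_simps(3))
  have "f \<in> carrier P \<and> - f \<in> carrier P \<and> Q (proj f) \<and> Q (proj (- f))" using f(1)
  proof (induction f rule: P_induct)
    case zero
    then show ?case using assms(2) z by (simp add: P_simps)
  next
    case (of s a)
    have "pt s a \<oplus>\<^bsub>B\<^esub> pt (\<ominus>\<^bsub>S\<^esub> s) a = \<zero>\<^bsub>B\<^esub>"
      using of pt_add_left[of s "\<ominus>\<^bsub>S\<^esub> s" a] pt_zero_left[of a] by (simp add: S.r_neg)
    moreover have *: "- frag_of (s, a) \<in> carrier P"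
      using of P_minus[of "frag_of (s, a)"] P.a_inv_closed[of "frag_of (s, a)"] by simp
    then have "pt s a \<oplus>\<^bsub>B\<^esub> proj (- frag_of (s, a)) = \<zero>\<^bsub>B\<^esub>"
      unfolding pt_def' using of proj_add[of "frag_of (s, a)" "- frag_of (s, a)"] z by simp
    ultimately have "proj (- frag_of (s, a)) = pt (\<ominus>\<^bsub>S\<^esub> s) a"
      using of proj_closed[OF *] pt_closed B.add.l_cancel by (metis S.a_inv_closed)
    then show ?case using of * pt[of s a] pt[of "\<ominus>\<^bsub>S\<^esub> s" a] by (simp add: pt_def')
  next
    case (diff f g)
    have "f + - g \<in> carrier P" "g + - f \<in> carrier P"
      using diff P_diff_closed by simp_all
    moreover have "proj (f + - g) = proj f \<oplus>\<^bsub>B\<^esub> proj (- g)" "proj (g + - f) = proj g \<oplus>\<^bsub>B\<^esub> proj (- f)"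
      by (rule proj_add; use diff in simp)+
    ultimately show ?case using diff add proj_closed P_diff_closed by simp
  qed
  then show ?thesis using f by simp
qed

text \<open>The universal property for balanced biadditive maps. The extension to the free group
  vanishes on the relations, so it is constant on cosets and may be read off at a chosen
  representative.\<close>

lemma tensor_lift:
  fixes h :: "'s \<Rightarrow> 'a \<Rightarrow> 'g::ring_1"
  assumes left: "\<And>s t a. \<lbrakk>s \<in> carrier S; t \<in> carrier S; a \<in> carrier A\<rbrakk> \<Longrightarrow> h (s \<oplus>\<^bsub>S\<^esub> t) a = h s a + h t a"
    and right: "\<And>s a b. \<lbrakk>s \<in> carrier S; a \<in> carrier A; b \<in> carrier A\<rbrakk> \<Longrightarrow> h s (a \<oplus>\<^bsub>A\<^esub> b) = h s a + h s b"
    and scalar: "\<And>s c a. \<lbrakk>s \<in> carrier S; a \<in> carrier A\<rbrakk> \<Longrightarrow> h (s \<otimes>\<^bsub>S\<^esub> \<sigma> c) a = h s (\<iota> c \<otimes>\<^bsub>A\<^esub> a)"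
  shows "\<exists>H. (\<forall>s\<in>carrier S. \<forall>a\<in>carrier A. H (pt s a) = h s a)
      \<and> (\<forall>V\<in>carrier B. \<forall>W\<in>carrier B. H (V \<oplus>\<^bsub>B\<^esub> W) = H V + H W)"
proof -
  let ?e = "frag_eval (\<lambda>(s, a). h s a)"
  define H where "H V = ?e (SOME f. f \<in> carrier P \<and> V = proj f)" for V
  have ker: "?e f = 0" if "f \<in> rel_span" for f
    using that
  proof (induction rule: rel_span.induct)
    case (rel r)
    then show ?case
      by (cases r rule: rel_cases) (simp_all add: frag_eval_diff left right scalar)
  qed (simp_all add: frag_eval_diff)
  have H: "H (proj f) = ?e f" if f: "f \<in> carrier P" for f
  proof -
    let ?g = "SOME g. g \<in> carrier P \<and> proj f = proj g"
    have "?g \<in> carrier P \<and> proj f = proj ?g" by (rule someI[of _ f]) (use f in auto)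
    then have "f - ?g \<in> rel_span" using proj_eq_iff[OF f] by blast
    then show ?thesis using ker[of "f - ?g"] by (simp add: frag_eval_diff H_def)
  qed
  have "H (V \<oplus>\<^bsub>B\<^esub> W) = H V + H W" if XY: "V \<in> carrier B" "W \<in> carrier B" for V W
  proof -
    obtain f g where fg: "f \<in> carrier P" "V = proj f" "g \<in> carrier P" "W = proj g"
      using proj_surj XY by metis
    then have "f + g \<in> carrier P" using P.a_closed by (simp add: P_simps(4))
    then show ?thesis
      unfolding fg(2,4) using H fg(1,3) by (simp add: proj_add[OF fg(1,3), symmetric] frag_eval_add)
  qed
  moreover have "H (pt s a) = h s a" if "s \<in> carrier S" "a \<in> carrier A" for s a
    using that H[of "frag_of (s, a)"] by (simp add: pt_def')
  ultimately show ?thesis by blast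
qed

end

section \<open>Rational functions and evaluation of polynomials\<close>

lemma mpolys_closed:
  shows "0 \<in> mpolys m" "1 \<in> mpolys m" "Poly_Mapping.single 0 c \<in> mpolys m"
    and "\<lbrakk>p \<in> mpolys m; q \<in> mpolys m\<rbrakk> \<Longrightarrow> p + q \<in> mpolys m"
    and "p \<in> mpolys m \<Longrightarrow> - p \<in> mpolys m"
    and "\<lbrakk>p \<in> mpolys m; q \<in> mpolys m\<rbrakk> \<Longrightarrow> p * q \<in> mpolys m"
proof -
  show "\<lbrakk>p \<in> mpolys m; q \<in> mpolys m\<rbrakk> \<Longrightarrow> p + q \<in> mpolys m"
    unfolding mpolys_def using keys_add[of p q] by blast
  show "p \<in> mpolys m \<Longrightarrow> - p \<in> mpolys m"
    unfolding mpolys_def by (simp add: in_keys_iff)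
  show "p * q \<in> mpolys m" if "p \<in> mpolys m" "q \<in> mpolys m"
    unfolding mpolys_def
  proof (intro CollectI ballI)
    fix e assume "e \<in> Poly_Mapping.keys (p * q)"
    then obtain a b where "e = a + b" "a \<in> Poly_Mapping.keys p" "b \<in> Poly_Mapping.keys q"
      using keys_mult[of p q] by blast
    then show "Poly_Mapping.keys e \<subseteq> {..<m}"
      using that keys_add[of a b] unfolding mpolys_def by blast
  qed
qed (auto simp: mpolys_def)

lemma mpolys_diff: "\<lbrakk>p \<in> mpolys m; q \<in> mpolys m\<rbrakk> \<Longrightarrow> p - q \<in> mpolys m"
  using mpolys_closed(4)[of p m "- q"] mpolys_closed(5)[of q m] by simp

lemma mpoly_induct [case_names zero single add]:
  assumes "Q 0" "\<And>e c. Q (Poly_Mapping.single e c)" "\<And>p q. \<lbrakk>Q p; Q q\<rbrakk> \<Longrightarrow> Q (p + q)"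
  shows "Q (p :: 'i \<Rightarrow>\<^sub>0 'b::comm_monoid_add)"
proof (induction p rule: update_induct)
  case const
  then show ?case by (rule assms(1))
next
  case (update f a b)
  have "Poly_Mapping.update a b f = Poly_Mapping.single a b + f"
    using update(1) by (intro poly_mapping_eqI) (auto simp: lookup_update lookup_add lookup_single in_keys_iff when_def)
  then show ?case using assms update by metis
qed

abbreviation "Q_field m \<equiv> carrier (ratfun_field m)"

lemma ratfun_field_simps:
  "carrier (ratfun_field m) = {Fract p q |p q. p \<in> mpolys m \<and> q \<in> mpolys m \<and> q \<noteq> 0}"
  "x \<otimes>\<^bsub>ratfun_field m\<^esub> y = x * y" "x \<oplus>\<^bsub>ratfun_field m\<^esub> y = x + y"
  "\<one>\<^bsub>ratfun_field m\<^esub> = 1" "\<zero>\<^bsub>ratfun_field m\<^esub> = 0"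
  by (simp_all add: ratfun_field_def ring_of_type_algebra_def)

lemma Q_fieldI: "\<lbrakk>p \<in> mpolys m; q \<in> mpolys m; q \<noteq> 0\<rbrakk> \<Longrightarrow> Fract p q \<in> Q_field m"
  by (auto simp: ratfun_field_simps)

lemma Q_field_closed:
  shows "0 \<in> Q_field m" "1 \<in> Q_field m" "ratfun_const c \<in> Q_field m"
    and "\<lbrakk>x \<in> Q_field m; y \<in> Q_field m\<rbrakk> \<Longrightarrow> x + y \<in> Q_field m"
    and "\<lbrakk>x \<in> Q_field m; y \<in> Q_field m\<rbrakk> \<Longrightarrow> x * y \<in> Q_field m"
    and "x \<in> Q_field m \<Longrightarrow> - x \<in> Q_field m"
    and "x \<in> Q_field m \<Longrightarrow> inverse x \<in> Q_field m"
proof -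
  show 0: "0 \<in> Q_field m"
    using Q_fieldI[of 0 m 1] by (simp add: mpolys_closed Zero_fract_def)
  show "1 \<in> Q_field m"
    using Q_fieldI[of 1 m 1] by (simp add: mpolys_closed One_fract_def)
  show "ratfun_const c \<in> Q_field m"
    unfolding ratfun_const_def by (rule Q_fieldI) (simp_all add: mpolys_closed)
  show "- x \<in> Q_field m" if "x \<in> Q_field m"
    using that by (auto simp: ratfun_field_simps(1)) (metis mpolys_closed(5))
  show "x + y \<in> Q_field m" "x * y \<in> Q_field m" if xy: "x \<in> Q_field m" "y \<in> Q_field m"
  proof -
    obtain p q r s where "x = Fract p q" "y = Fract r s" "p \<in> mpolys m" "q \<in> mpolys m"
        "r \<in> mpolys m" "s \<in> mpolys m" "q \<noteq> 0" "s \<noteq> 0"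
      using xy unfolding ratfun_field_simps by blast
    then show "x + y \<in> Q_field m" "x * y \<in> Q_field m"
      by (auto intro!: Q_fieldI mpolys_closed)
  qed
  show "inverse x \<in> Q_field m" if x: "x \<in> Q_field m"
  proof -
    obtain p q where pq: "x = Fract p q" "p \<in> mpolys m" "q \<in> mpolys m" "q \<noteq> 0"
      using x unfolding ratfun_field_simps by blast
    show ?thesis
    proof (cases "p = 0")
      case True
      then have "inverse x = 0" using pq by (simp add: rat_number_collapse fract_collapse)
      then show ?thesis using 0 by simp
    next
      case False
      then show ?thesis using pq by (auto intro: Q_fieldI)
    qed
  qed
qed

lemma Q_field_sum: "(\<And>i. i \<in> I \<Longrightarrow> f i \<in> Q_field m) \<Longrightarrow> sum f I \<in> Q_field m"
  by (induction I rule: infinite_finite_induct) (auto intro: Q_field_closed)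

lemma cring_ratfun_field: "cring (ratfun_field m :: 'k::field ratfun ring)"
proof (rule cringI)
  show "abelian_group (ratfun_field m :: 'k ratfun ring)"
  proof (rule abelian_groupI)
    show "\<exists>y\<in>Q_field m. y \<oplus>\<^bsub>ratfun_field m\<^esub> x = \<zero>\<^bsub>ratfun_field m\<^esub>" if "x \<in> Q_field m" for x :: "'k ratfun"
      using Q_field_closed(6)[OF that] by (intro bexI[of _ "- x"]) (simp_all add: ratfun_field_simps(2-))
  qed (simp_all add: ratfun_field_simps(2-) Q_field_closed add_ac)
  show "comm_monoid (ratfun_field m :: 'k ratfun ring)"
    by (rule comm_monoidI) (simp_all add: ratfun_field_simps(2-) Q_field_closed mult_ac)
qed (simp add: ratfun_field_simps(2-) distrib_right)

section \<open>Algebras with a structure map, and polynomials in commuting elements\<close>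

locale field_algebra = ring A for A :: "('a, 'b) ring_scheme" (structure) +
  fixes \<iota> :: "'k::field \<Rightarrow> 'a"
  assumes \<iota>_hom: "\<iota> \<in> ring_hom ring_of_type_algebra A"
    and nontrivial: "\<one> \<noteq> \<zero>"
    and \<iota>_central: "a \<in> carrier A \<Longrightarrow> \<iota> c \<otimes> a = a \<otimes> \<iota> c"
begin

lemma \<iota>_closed [simp, intro]: "\<iota> c \<in> carrier A"
  using ring_hom_closed[OF \<iota>_hom] by (simp add: ring_of_type_algebra_def)

lemma \<iota>_simps: "\<iota> (a + b) = \<iota> a \<oplus> \<iota> b" "\<iota> (a * b) = \<iota> a \<otimes> \<iota> b" "\<iota> 1 = \<one>"
  using ring_hom_add[OF \<iota>_hom, of a b] ring_hom_mult[OF \<iota>_hom, of a b] ring_hom_one[OF \<iota>_hom]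
  by (simp_all add: ring_of_type_algebra_def)

lemma \<iota>_zero: "\<iota> 0 = \<zero>"
  using \<iota>_simps(1)[of 0 0] by (simp add: add.l_cancel_one')

lemma \<iota>_eq_zero_iff: "\<iota> c = \<zero> \<longleftrightarrow> c = 0"
proof
  assume "\<iota> c = \<zero>"
  then have "\<iota> (c * inverse c) = \<zero>" by (simp add: \<iota>_simps)
  then show "c = 0" using \<iota>_simps(3) nontrivial by (cases "c = 0") auto
qed (simp add: \<iota>_zero)

lemma \<iota>_minus: "\<iota> (- c) = \<ominus> \<iota> c"
  using \<iota>_simps(1)[of "- c" c] \<iota>_zero by (intro minus_equality[symmetric]) auto

lemma subfield_range: "subfield (range \<iota>) A"
proof (rule subfieldI)
  have "subring (range \<iota>) A"
    by (rule subringI) (auto simp: \<iota>_simps[symmetric] \<iota>_minus[symmetric])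
  then show "subcring (range \<iota>) A"
    by (rule subcringI) (auto simp: \<iota>_simps[symmetric] mult.commute)
  show "Units (A\<lparr>carrier := range \<iota>\<rparr>) = range \<iota> - {\<zero>}"
  proof
    show "Units (A\<lparr>carrier := range \<iota>\<rparr>) \<subseteq> range \<iota> - {\<zero>}"
      unfolding Units_def using nontrivial by auto
    show "range \<iota> - {\<zero>} \<subseteq> Units (A\<lparr>carrier := range \<iota>\<rparr>)"
    proof
      fix x assume "x \<in> range \<iota> - {\<zero>}"
      then obtain c where c: "x = \<iota> c" "c \<noteq> 0" using \<iota>_zero by auto
      then have "\<iota> (inverse c) \<otimes> x = \<one>" "x \<otimes> \<iota> (inverse c) = \<one>"
        by (simp_all add: \<iota>_simps[symmetric])
      then show "x \<in> Units (A\<lparr>carrier := range \<iota>\<rparr>)"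
        unfolding Units_def using c by auto
    qed
  qed
qed

sublocale central_algebra A "range \<iota>"
proof (intro central_algebra.intro central_algebra_axioms.intro)
  show "ring A" by (rule ring_axioms)
  show "subfield (range \<iota>) A" by (rule subfield_range)
  show "c \<otimes> x = x \<otimes> c" if "c \<in> range \<iota>" "x \<in> carrier A" for c x
    using that \<iota>_central by (elim rangeE) simp
qed

end

text \<open>The factors are multiplied in a fixed order because the ambient ring is not commutative.
  Exponents at indices beyond the bound are ignored.\<close>

primrec monom_val :: "('a, 'b) ring_scheme \<Rightarrow> (nat \<Rightarrow> 'a) \<Rightarrow> nat \<Rightarrow> (nat \<Rightarrow> nat) \<Rightarrow> 'a" where
  "monom_val R y 0 e = \<one>\<^bsub>R\<^esub>"
| "monom_val R y (Suc t) e = monom_val R y t e \<otimes>\<^bsub>R\<^esub> y t [^]\<^bsub>R\<^esub> e t"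

text \<open>The sequence \<open>y\<close> is total with all values in \<open>C\<close>, so that
  composing it with any map on indices stays inside the locale; \<open>m\<close> only says how many
  entries are used as variables.\<close>

locale commuting_elements = field_algebra A \<iota> for A :: "('a, 'b) ring_scheme" (structure) and \<iota> +
  fixes C :: "'a set" and y :: "nat \<Rightarrow> 'a" and m :: nat
  assumes C: "subcring C A" and \<iota>_C: "range \<iota> \<subseteq> C" and y_C: "y t \<in> C"
begin

lemma C_carrier: "x \<in> C \<Longrightarrow> x \<in> carrier A"
  using subcringE(1)[OF C] by blast

lemma C_comm: "\<lbrakk>u \<in> C; v \<in> C\<rbrakk> \<Longrightarrow> u \<otimes> v = v \<otimes> u"
  using subcring.sub_m_comm[OF C] .

lemma C_closed: "\<one> \<in> C" "\<zero> \<in> C" "\<lbrakk>u \<in> C; v \<in> C\<rbrakk> \<Longrightarrow> u \<otimes> v \<in> C" "\<lbrakk>u \<in> C; v \<in> C\<rbrakk> \<Longrightarrow> u \<oplus> v \<in> C"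
  using subcringE[OF C] by auto

lemma C_exchange:
  assumes "u \<in> C" "v \<in> C" "w \<in> C" "z \<in> C"
  shows "(u \<otimes> v) \<otimes> (w \<otimes> z) = (u \<otimes> w) \<otimes> (v \<otimes> z)"
proof -
  note [simp] = assms[THEN C_carrier]
  have "(u \<otimes> v) \<otimes> (w \<otimes> z) = u \<otimes> ((v \<otimes> w) \<otimes> z)" by (simp add: m_assoc)
  also have "v \<otimes> w = w \<otimes> v" using assms by (intro C_comm)
  finally show ?thesis by (simp add: m_assoc)
qed

lemma pow_C: "u \<in> C \<Longrightarrow> u [^] (n::nat) \<in> C"
  by (induction n) (auto intro: C_closed)

lemma monom_val_C: "monom_val A y n e \<in> C"
  by (induction n) (auto intro: C_closed pow_C y_C)

lemma monom_val_closed [simp, intro]: "monom_val A y n e \<in> carrier A"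
  by (rule C_carrier[OF monom_val_C])

lemma monom_val_add:
  "monom_val A y n (\<lambda>t. e t + e' t) = monom_val A y n e \<otimes> monom_val A y n e'"
proof (induction n)
  case (Suc n)
  have "y n [^] (e n + e' n) = y n [^] e n \<otimes> y n [^] e' n"
    using C_carrier[OF y_C] by (simp add: nat_pow_mult)
  then show ?case using Suc C_exchange[OF monom_val_C monom_val_C pow_C[OF y_C] pow_C[OF y_C]] by simp
qed simp

lemma monom_val_zero: "(\<And>t. t < n \<Longrightarrow> e t = 0) \<Longrightarrow> monom_val A y n e = \<one>"
  by (induction n) auto

definition ev :: "'c mpoly \<Rightarrow> 'a" where
  "ev p = (\<Oplus>e\<in>Poly_Mapping.keys p. \<iota> (Poly_Mapping.lookup p e) \<otimes> monom_val A y m (Poly_Mapping.lookup e))"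

lemma ev_superset:
  assumes "finite K" "Poly_Mapping.keys p \<subseteq> K"
  shows "ev p = (\<Oplus>e\<in>K. \<iota> (Poly_Mapping.lookup p e) \<otimes> monom_val A y m (Poly_Mapping.lookup e))"
  unfolding ev_def using assms
  by (intro add.finprod_mono_neutral_cong_left) (auto simp: in_keys_iff \<iota>_zero)

lemma ev_C: "ev p \<in> C"
proof -
  have "(\<Oplus>e\<in>K. \<iota> (Poly_Mapping.lookup p e) \<otimes> monom_val A y m (Poly_Mapping.lookup e)) \<in> C" for K
  proof (induction K rule: infinite_finite_induct)
    case (insert e K)
    have "\<iota> (Poly_Mapping.lookup p e) \<otimes> monom_val A y m (Poly_Mapping.lookup e) \<in> C"
      using \<iota>_C monom_val_C by (intro C_closed) auto
    then show ?case using insert by (auto simp: finsum_insert intro: C_closed)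
  qed (auto simp: finsum_infinite intro: C_closed)
  then show ?thesis unfolding ev_def .
qed

lemma ev_closed [simp, intro]: "ev p \<in> carrier A"
  by (rule C_carrier[OF ev_C])

lemma ev_zero: "ev 0 = \<zero>"
  by (simp add: ev_def)

lemma ev_add: "ev (p + q) = ev p \<oplus> ev q"
proof -
  let ?K = "Poly_Mapping.keys p \<union> Poly_Mapping.keys q"
  have "Poly_Mapping.keys (p + q) \<subseteq> ?K" by (rule keys_add)
  then show ?thesis
    by (simp add: ev_superset[of ?K] lookup_add \<iota>_simps l_distr finsum_addf)
qed

lemma ev_single: "ev (Poly_Mapping.single e c) = \<iota> c \<otimes> monom_val A y m (Poly_Mapping.lookup e)"
  using ev_superset[of "{e}" "Poly_Mapping.single e c"] by (simp add: finsum_insert)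

lemma ev_const: "ev (Poly_Mapping.single 0 c) = \<iota> c"
  by (simp add: ev_single monom_val_zero)

lemma ev_one: "ev 1 = \<one>"
  using ev_const[of 1] by (simp add: \<iota>_simps)

lemma ev_mult: "ev (p * q) = ev p \<otimes> ev q"
proof (induction p rule: mpoly_induct)
  case (single e c)
  show ?case
  proof (induction q rule: mpoly_induct)
    case (single e' c')
    have "monom_val A y m (Poly_Mapping.lookup (e + e'))
        = monom_val A y m (Poly_Mapping.lookup e) \<otimes> monom_val A y m (Poly_Mapping.lookup e')"
      using monom_val_add[of m "Poly_Mapping.lookup e" "Poly_Mapping.lookup e'"]
      by (simp add: lookup_add[abs_def])
    moreover have "\<iota> c \<in> C" "\<iota> c' \<in> C" using \<iota>_C by auto
    ultimately show ?case
      using C_exchange[of "\<iota> c" "\<iota> c'"] monom_val_C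
      by (simp add: mult_single ev_single \<iota>_simps)
  qed (simp_all add: ev_zero ev_add distrib_left r_distr)
qed (simp_all add: ev_zero ev_add distrib_right l_distr)

lemma ev_minus: "ev (- p) = \<ominus> ev p"
  using ev_add[of "- p" p] ev_zero by (intro minus_equality[symmetric]) auto

end

lemma (in abelian_group) add_eq_imp_diff_eq:
  assumes "x \<in> carrier G" "y \<in> carrier G" "z \<in> carrier G" "w \<in> carrier G"
    and "x \<oplus> y = z \<oplus> w"
  shows "x \<oplus> \<ominus> z = w \<oplus> \<ominus> y"
proof -
  have "x = (x \<oplus> y) \<oplus> \<ominus> y" using assms(1,2) by (simp add: a_assoc r_neg)
  also have "\<dots> = z \<oplus> (w \<oplus> \<ominus> y)" using assms by (simp add: a_assoc)
  finally have "x \<oplus> \<ominus> z = \<ominus> z \<oplus> (z \<oplus> (w \<oplus> \<ominus> y))" using assms(1-4) by (simp add: a_comm)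
  also have "\<dots> = w \<oplus> \<ominus> y" using assms(2-4) by (simp add: r_neg1)
  finally show ?thesis .
qed

section \<open>A module functional over a polynomial subring\<close>

locale independent_elements = commuting_elements +
  assumes ev_inj: "\<lbrakk>p \<in> mpolys m; ev p = \<zero>\<rbrakk> \<Longrightarrow> p = 0"
begin

text \<open>Submodules of \<open>A\<close> under right multiplication by polynomials that meet the
  polynomial subring trivially. Negatives are contained in the closure under the constant polynomial
  \<open>- 1\<close>.\<close>

definition complement :: "'a set \<Rightarrow> bool" where
  "complement N \<longleftrightarrow> N \<subseteq> carrier A \<and> \<zero> \<in> N \<and> (\<forall>u\<in>N. \<forall>v\<in>N. u \<oplus> v \<in> N)
     \<and> (\<forall>u\<in>N. \<forall>p\<in>mpolys m. u \<otimes> ev p \<in> N) \<and> (\<forall>p\<in>mpolys m. ev p \<in> N \<longrightarrow> p = 0)"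

lemma exists_maximal_complement:
  "\<exists>N. complement N \<and> (\<forall>N'. complement N' \<longrightarrow> N \<subseteq> N' \<longrightarrow> N' = N)"
proof -
  have "\<exists>N\<in>Collect complement. \<forall>N'\<in>Collect complement. N \<subseteq> N' \<longrightarrow> N' = N"
  proof (rule subset_Zorn_nonempty)
    have "complement {\<zero>}" unfolding complement_def using ev_inj by auto
    then show "Collect complement \<noteq> {}" by blast
    fix \<C> assume ne: "\<C> \<noteq> {}" and ch: "subset.chain (Collect complement) \<C>"
    then have c: "\<And>N. N \<in> \<C> \<Longrightarrow> complement N"
      and lin: "\<And>N N'. \<lbrakk>N \<in> \<C>; N' \<in> \<C>\<rbrakk> \<Longrightarrow> N \<subseteq> N' \<or> N' \<subseteq> N"
      unfolding subset.chain_def by auto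
    have "u \<oplus> v \<in> \<Union>\<C>" if uv: "u \<in> \<Union>\<C>" "v \<in> \<Union>\<C>" for u v
    proof -
      obtain N N' where "N \<in> \<C>" "N' \<in> \<C>" "u \<in> N" "v \<in> N'" using uv by blast
      then obtain N'' where "N'' \<in> \<C>" "u \<in> N''" "v \<in> N''" using lin by blast
      then show ?thesis using c unfolding complement_def by blast
    qed
    moreover have "\<zero> \<in> \<Union>\<C>" using ne c unfolding complement_def by blast
    moreover have "\<Union>\<C> \<subseteq> carrier A" using c unfolding complement_def by blast
    moreover have "\<forall>u\<in>\<Union>\<C>. \<forall>p\<in>mpolys m. u \<otimes> ev p \<in> \<Union>\<C>" using c unfolding complement_def by blast
    moreover have "\<forall>p\<in>mpolys m. ev p \<in> \<Union>\<C> \<longrightarrow> p = 0" using c unfolding complement_def by blast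
    ultimately have "complement (\<Union>\<C>)" unfolding complement_def by blast
    then show "\<Union>\<C> \<in> Collect complement" by simp
  qed
  then show ?thesis by auto
qed

text \<open>The polynomial subring \<open>ev ` mpolys m\<close> acts on the right. Modulo a maximal submodule meeting
  it trivially, every element of \<open>A\<close> has a nonzero multiple in it, so the inclusion of the
  polynomials into their fraction field extends to \<open>A\<close>.\<close>

theorem exists_functional:
  obtains \<phi> :: "'a \<Rightarrow> 'c ratfun"
  where "\<And>a. a \<in> carrier A \<Longrightarrow> \<phi> a \<in> Q_field m" "\<phi> \<one> = 1"
    and "\<And>a b. \<lbrakk>a \<in> carrier A; b \<in> carrier A\<rbrakk> \<Longrightarrow> \<phi> (a \<oplus> b) = \<phi> a + \<phi> b"
    and "\<And>a p. \<lbrakk>a \<in> carrier A; p \<in> mpolys m\<rbrakk> \<Longrightarrow> \<phi> (a \<otimes> ev p) = Fract p 1 * \<phi> a"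
proof -
  obtain N where N: "complement N" and maxN: "\<And>N'. \<lbrakk>complement N'; N \<subseteq> N'\<rbrakk> \<Longrightarrow> N' = N"
    using exists_maximal_complement by blast
  have Nc: "u \<in> carrier A" if "u \<in> N" for u using that N unfolding complement_def by blast
  have N0: "\<zero> \<in> N" using N unfolding complement_def by blast
  have Na: "u \<oplus> v \<in> N" if "u \<in> N" "v \<in> N" for u v using that N unfolding complement_def by blast
  have Nm: "u \<otimes> ev p \<in> N" if "u \<in> N" "p \<in> mpolys m" for u p
    using that N unfolding complement_def by blast
  have Nev: "p = 0" if "ev p \<in> N" "p \<in> mpolys m" for p using that N unfolding complement_def by blast
  have Ni: "\<ominus> u \<in> N" if "u \<in> N" for u
  proof -
    have "u \<otimes> ev (- 1) \<in> N" using that by (intro Nm mpolys_closed)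
    then show ?thesis using Nc[OF that] by (simp add: ev_minus ev_one r_minus)
  qed
  \<comment> \<open>\<open>a\<close> times \<open>r\<close> is congruent to \<open>p\<close> modulo
    \<open>N\<close>: this forces the value \<open>p / r\<close> on a functional that kills
    \<open>N\<close> and extends the polynomials.\<close>
  define rl where "rl a p r \<longleftrightarrow> p \<in> mpolys m \<and> r \<in> mpolys m \<and> r \<noteq> 0 \<and>
      (\<exists>u\<in>N. a \<otimes> ev r = ev p \<oplus> u)" for a p and r :: "'c mpoly"
  have ex: "\<exists>p r. rl a p r" if a: "a \<in> carrier A" for a
  \<comment> \<open>The submodule generated by \<open>N\<close> and \<open>a\<close>. If it still is
    a complement, maximality puts \<open>a\<close> into \<open>N\<close> and the value is
    \<open>0 / 1\<close>. Otherwise it contains a nonzero polynomial, and its expression in terms of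
    \<open>N\<close> and \<open>a\<close> supplies numerator and denominator.\<close>
  proof (cases "complement {u \<oplus> a \<otimes> ev r |u r. u \<in> N \<and> r \<in> mpolys m}")
    case True
    let ?N' = "{u \<oplus> a \<otimes> ev r |u r. u \<in> N \<and> r \<in> mpolys m}"
    have "u \<in> ?N'" if "u \<in> N" for u
      using that Nc[OF that] a ev_zero mpolys_closed(1)[of m] by (intro CollectI exI[of _ u] exI[of _ 0]) auto
    then have "?N' = N" using maxN True by blast
    moreover have "a \<in> ?N'"
      using a N0 ev_one mpolys_closed(2)[of m] by (intro CollectI exI[of _ \<zero>] exI[of _ 1]) auto
    ultimately have "a \<in> N" by simp
    then have "rl a 0 1"
      unfolding rl_def using a Nc by (auto simp: mpolys_closed ev_one ev_zero)
    then show ?thesis by blast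
  next
    case False
    let ?N' = "{u \<oplus> a \<otimes> ev r |u r. u \<in> N \<and> r \<in> mpolys m}"
    have "?N' \<subseteq> carrier A" using a Nc by auto
    moreover have "\<zero> \<in> ?N'"
      using a N0 ev_zero mpolys_closed(1)[of m] by (intro CollectI exI[of _ \<zero>] exI[of _ 0]) auto
    moreover have "u \<oplus> v \<in> ?N'" if uv: "u \<in> ?N'" "v \<in> ?N'" for u v
    proof -
      obtain u' r v' s where "u = u' \<oplus> a \<otimes> ev r" "v = v' \<oplus> a \<otimes> ev s"
        and *: "u' \<in> N" "v' \<in> N" "r \<in> mpolys m" "s \<in> mpolys m" using uv by blast
      then have "u \<oplus> v = (u' \<oplus> v') \<oplus> a \<otimes> ev (r + s)"
        using a Nc by (simp add: ev_add r_distr a_ac)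
      then show ?thesis using * Na mpolys_closed(4) by blast
    qed
    moreover have "u \<otimes> ev p \<in> ?N'" if up: "u \<in> ?N'" "p \<in> mpolys m" for u p
    proof -
      obtain u' r where "u = u' \<oplus> a \<otimes> ev r" and *: "u' \<in> N" "r \<in> mpolys m" using up by blast
      then have "u \<otimes> ev p = u' \<otimes> ev p \<oplus> a \<otimes> ev (r * p)"
        using a Nc by (simp add: ev_mult l_distr m_assoc)
      then show ?thesis using * Nm up mpolys_closed(6) by blast
    qed
    ultimately obtain p where p: "p \<in> mpolys m" "ev p \<in> ?N'" "p \<noteq> 0"
      using False unfolding complement_def by blast
    then obtain u r where ur: "ev p = u \<oplus> a \<otimes> ev r" "u \<in> N" "r \<in> mpolys m" by blast
    have "r \<noteq> 0"
    proof
      assume "r = 0"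
      then have "ev p \<in> N" using ur a Nc by (simp add: ev_zero)
      then show False using Nev p by blast
    qed
    moreover have "a \<otimes> ev r = ev p \<oplus> (\<ominus> u)"
    proof -
      have "u \<in> carrier A" "a \<otimes> ev r \<in> carrier A" using Nc ur(2) a by auto
      then show ?thesis unfolding ur(1) by (simp add: a_comm[of u "a \<otimes> ev r"] a_assoc r_neg)
    qed
    ultimately have "rl a p r" unfolding rl_def using ur p Ni by blast
    then show ?thesis by blast
  qed
  have uniq: "Fract p r = Fract q s" if pr: "rl a p r" "rl a q s" and a: "a \<in> carrier A" for a p r q s
  proof -
    obtain u v where uv: "u \<in> N" "v \<in> N" "a \<otimes> ev r = ev p \<oplus> u" "a \<otimes> ev s = ev q \<oplus> v"
      using pr unfolding rl_def by blast
    have mp: "p \<in> mpolys m" "r \<in> mpolys m" "q \<in> mpolys m" "s \<in> mpolys m" "r \<noteq> 0" "s \<noteq> 0"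
      using pr unfolding rl_def by auto
    note [simp] = Nc[OF uv(1)] Nc[OF uv(2)]
    have "a \<otimes> ev (r * s) = ev (p * s) \<oplus> u \<otimes> ev s"
      using uv(3) a by (simp add: ev_mult m_assoc[symmetric] l_distr)
    moreover have "a \<otimes> ev (s * r) = ev (q * r) \<oplus> v \<otimes> ev r"
      using uv(4) a by (simp add: ev_mult m_assoc[symmetric] l_distr)
    ultimately have eq: "ev (p * s) \<oplus> u \<otimes> ev s = ev (q * r) \<oplus> v \<otimes> ev r" by (simp add: mult.commute)
    \<comment> \<open>Cross-multiplication: \<open>p * s - q * r\<close> evaluates into
      \<open>N\<close>, and a polynomial doing so is zero.\<close>
    have "ev (p * s - q * r) = ev (p * s) \<oplus> \<ominus> ev (q * r)"
      using ev_add[of "p * s" "- (q * r)"] by (simp add: ev_minus)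
    also have "\<dots> = v \<otimes> ev r \<oplus> \<ominus> (u \<otimes> ev s)"
      by (rule add_eq_imp_diff_eq[OF _ _ _ _ eq]) auto
    finally have "ev (p * s - q * r) \<in> N"
      using Na[OF Nm[OF uv(2) mp(2)] Ni[OF Nm[OF uv(1) mp(4)]]] by simp
    then have "p * s - q * r = 0"
      by (rule Nev) (intro mpolys_diff mpolys_closed mp)
    then show ?thesis using mp by (simp add: eq_fract)
  qed
  define \<phi> where "\<phi> a = (SOME x. \<exists>p r. rl a p r \<and> x = Fract p r)" for a
  have \<phi>: "\<phi> a = Fract p r" if "rl a p r" "a \<in> carrier A" for a p r
  proof -
    have "\<exists>p r. rl a p r \<and> \<phi> a = Fract p r"
      unfolding \<phi>_def by (rule someI[of _ "Fract p r"]) (use that in blast)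
    then show ?thesis using uniq that by metis
  qed
  show thesis
  proof (rule that[of \<phi>])
    show "\<phi> a \<in> Q_field m" if a: "a \<in> carrier A" for a
    proof -
      obtain p r where r: "rl a p r" using ex a by blast
      then show ?thesis using \<phi>[OF r a] unfolding rl_def by (auto intro: Q_fieldI)
    qed
    have "\<one> \<otimes> ev 1 = ev 1 \<oplus> \<zero>" by (simp add: ev_one)
    then have "rl \<one> 1 1" unfolding rl_def
      using N0 by (intro conjI bexI[of _ "\<zero>"]) (simp_all add: mpolys_closed)
    then show "\<phi> \<one> = 1" using \<phi> by (simp add: One_fract_def)
    show "\<phi> (a \<oplus> b) = \<phi> a + \<phi> b" if ab: "a \<in> carrier A" "b \<in> carrier A" for a b
    proof -
      obtain p r q s where r: "rl a p r" "rl b q s" using ex ab by metis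
      obtain u v where uv: "u \<in> N" "v \<in> N" "a \<otimes> ev r = ev p \<oplus> u" "b \<otimes> ev s = ev q \<oplus> v"
        using r unfolding rl_def by blast
      have mp: "p \<in> mpolys m" "r \<in> mpolys m" "q \<in> mpolys m" "s \<in> mpolys m" "r \<noteq> 0" "s \<noteq> 0"
        using r unfolding rl_def by auto
      note [simp] = Nc[OF uv(1)] Nc[OF uv(2)]
      have "a \<otimes> ev (r * s) = ev (p * s) \<oplus> u \<otimes> ev s"
        using uv(3) ab by (simp add: ev_mult m_assoc[symmetric] l_distr)
      moreover have "b \<otimes> ev (r * s) = ev (q * r) \<oplus> v \<otimes> ev r"
        using uv(4) ab by (simp add: mult.commute[of r s] ev_mult m_assoc[symmetric] l_distr)
      ultimately have "(a \<oplus> b) \<otimes> ev (r * s) = ev (p * s + q * r) \<oplus> (u \<otimes> ev s \<oplus> v \<otimes> ev r)"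
        using ab by (simp add: l_distr ev_add a_ac)
      moreover have "u \<otimes> ev s \<oplus> v \<otimes> ev r \<in> N" using Na Nm uv mp by simp
      ultimately have "rl (a \<oplus> b) (p * s + q * r) (r * s)"
        unfolding rl_def using mp by (auto intro!: mpolys_closed)
      then show ?thesis using \<phi> r ab mp by simp
    qed
    show "\<phi> (a \<otimes> ev q) = Fract q 1 * \<phi> a" if aq: "a \<in> carrier A" "q \<in> mpolys m" for a q
    proof -
      obtain p r where r: "rl a p r" using ex aq by metis
      obtain u where u: "u \<in> N" "a \<otimes> ev r = ev p \<oplus> u" using r unfolding rl_def by blast
      have mp: "p \<in> mpolys m" "r \<in> mpolys m" "r \<noteq> 0" using r unfolding rl_def by auto
      have "a \<otimes> ev q \<otimes> ev r = a \<otimes> ev r \<otimes> ev q"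
        using aq(1) C_comm[OF ev_C ev_C, of q r] by (simp add: m_assoc)
      also have "\<dots> = ev (q * p) \<oplus> u \<otimes> ev q"
        using u Nc[OF u(1)] by (simp add: mult.commute[of q p] ev_mult l_distr)
      finally have "rl (a \<otimes> ev q) (q * p) r"
        unfolding rl_def using mp aq u Nm by (auto intro!: mpolys_closed)
      then show ?thesis using \<phi> r aq by simp
    qed
  qed
qed

end

section \<open>Growth degrees and linear systems\<close>

lemma growth_degree_less_imp:
  assumes "growth_degree f < ennreal x"
  shows "\<forall>\<^sub>F i in sequentially. real (f i) \<le> real i powr x"
proof -
  obtain r where r: "ennreal r < ennreal x" "\<forall>\<^sub>F i in sequentially. real (f i) \<le> real i powr r"
    using assms unfolding growth_degree_def Inf_less_iff by auto
  have rx: "r \<le> x" using r(1) by (meson ennreal_leI less_le_not_le linear)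
  show ?thesis
    using r(2) eventually_ge_at_top[of 1]
  proof eventually_elim
    case (elim i)
    have "real i powr r \<le> real i powr x" using elim(2) rx by (intro powr_mono) auto
    then show ?case using elim(1) by linarith
  qed
qed

text \<open>The constant \<open>K\<close> is eventually below \<open>i powr \<epsilon>\<close> for
  each positive \<open>\<epsilon>\<close>, so it costs nothing in the infimum.\<close>

lemma growth_degree_leI:
  assumes "0 \<le> r" "\<forall>\<^sub>F i in sequentially. real (f i) \<le> K * real i powr r"
  shows "growth_degree f \<le> ennreal r"
proof (rule ennreal_le_epsilon)
  fix \<epsilon> :: real assume \<epsilon>: "0 < \<epsilon>"
  have "filterlim (\<lambda>i. real i powr \<epsilon>) at_top sequentially"
    using \<epsilon> by real_asymp
  then have "\<forall>\<^sub>F i in sequentially. K \<le> real i powr \<epsilon>"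
    by (simp add: filterlim_at_top)
  with assms(2) have "\<forall>\<^sub>F i in sequentially. real (f i) \<le> real i powr (r + \<epsilon>)"
  proof eventually_elim
    case (elim i)
    have "K * real i powr r \<le> real i powr \<epsilon> * real i powr r"
      using elim(2) by (intro mult_right_mono) auto
    then show ?case using elim(1) by (simp add: powr_add mult.commute)
  qed
  then have "growth_degree f \<le> ennreal (r + \<epsilon>)"
    unfolding growth_degree_def by (intro Inf_lower) auto
  then show "growth_degree f \<le> ennreal r + ennreal \<epsilon>"
    using assms(1) \<epsilon> by simp
qed

lemma eventually_subseq:
  assumes "\<forall>\<^sub>F i in sequentially. Q i" "0 < (h::nat)"
  shows "\<forall>\<^sub>F i in sequentially. Q (h * i)"
proof -
  have "filterlim (\<lambda>i. h * i) at_top sequentially"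
    using assms(2) by (intro filterlim_subseq) (auto simp: strict_mono_def)
  then show ?thesis using assms(1) by (auto simp: filterlim_iff)
qed

text \<open>In the application \<open>a\<close> is the growth of the algebra over the base field, \<open>u\<close> that of the
  module over the rational function field and \<open>l\<close> the return function.\<close>

locale growth_comparison =
  fixes a u l :: "nat \<Rightarrow> nat" and h c e m :: nat and N :: real
  assumes h: "0 < h" and c: "0 < c" and N: "0 \<le> N" "growth_degree a = ennreal N"
    and u_pos: "1 \<le> u i"
    and u_le: "u i * i ^ m \<le> a (h * i)"
    and a_le: "a i \<le> u (e * l (c * i)) * u (i + e * l (c * i))"
begin

lemma u_eventually:
  assumes "N < y"
  shows "\<forall>\<^sub>F i in sequentially. real (u i) \<le> real h powr y * real i powr (y - real m)"
proof -
  have "growth_degree a < ennreal y" using assms N by (simp add: ennreal_lessI)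
  then have "\<forall>\<^sub>F i in sequentially. real (a (h * i)) \<le> real (h * i) powr y"
    by (intro eventually_subseq[OF growth_degree_less_imp h])
  then show ?thesis using eventually_gt_at_top[of 0]
  proof eventually_elim
    case (elim i)
    have "real (u i) * real i powr real m \<le> real (a (h * i))"
      using u_le[of i] elim(2) by (simp add: powr_realpow flip: of_nat_power of_nat_mult)
    also have "\<dots> \<le> real h powr y * real i powr y" using elim(1) by (simp add: powr_mult)
    finally have "real (u i) \<le> real h powr y * real i powr y / real i powr real m"
      using elim(2) by (simp add: pos_le_divide_eq)
    then show ?case by (simp add: powr_diff)
  qed
qed

text \<open>Otherwise the bound on \<open>u\<close> has a negative exponent for some
  \<open>y\<close> between \<open>N\<close> and \<open>m\<close>, so \<open>u\<close> would tend to
  zero in spite of \<open>u \<ge> 1\<close>.\<close>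

lemma m_le_N: "real m \<le> N"
proof (rule ccontr)
  assume "\<not> real m \<le> N"
  then obtain y where y: "N < y" "y < real m" using dense by (meson not_le)
  have "((\<lambda>i. real h powr y * real i powr (y - real m)) \<longlongrightarrow> 0) sequentially"
  proof -
    have "((\<lambda>i. real i powr (y - real m)) \<longlongrightarrow> 0) sequentially" using y(2) by real_asymp
    then show ?thesis using tendsto_mult_right_zero by blast
  qed
  then have "\<forall>\<^sub>F i in sequentially. real h powr y * real i powr (y - real m) < 1"
    by (rule order_tendstoD) simp
  with u_eventually[OF y(1)] have "\<forall>\<^sub>F i in sequentially. False"
  proof eventually_elim
    case (elim i)
    have "real (u i) \<ge> 1" using u_pos[of i] by simp
    then show ?case using elim by linarith
  qed
  then show False by simp
qed

text \<open>A bound for every \<open>i\<close>, not just for large ones, because \<open>u\<close>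
  will be evaluated at values of the return function, which need not tend to infinity. The finitely
  many initial values go into \<open>K\<close>, and \<open>i + 1\<close> avoids the base
  zero.\<close>

lemma u_bound:
  assumes "N < y"
  shows "\<exists>K\<ge>0. \<forall>i. real (u i) \<le> K * (real i + 1) powr (y - real m)"
proof -
  have z: "0 \<le> y - real m" using m_le_N assms by simp
  obtain i0 where i0: "\<And>i. i \<ge> i0 \<Longrightarrow> real (u i) \<le> real h powr y * real i powr (y - real m)"
    using u_eventually[OF assms] by (auto simp: eventually_sequentially)
  define K where "K = real h powr y + (\<Sum>i<i0. real (u i))"
  have S0: "0 \<le> (\<Sum>i<i0. real (u i))" by (intro sum_nonneg) auto
  have "real (u i) \<le> K * (real i + 1) powr (y - real m)" for i
  proof (cases "i < i0")
    case True
    have "1 \<le> (real i + 1) powr (y - real m)" using z by (intro ge_one_powr_ge_zero) auto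
    moreover have "real (u i) \<le> (\<Sum>i<i0. real (u i))" using True by (intro member_le_sum) auto
    then have "real (u i) \<le> K" by (simp add: K_def add_increasing)
    moreover have "0 \<le> K" using S0 by (simp add: K_def)
    ultimately show ?thesis by (metis mult_left_mono mult.right_neutral order_trans)
  next
    case False
    have "real i powr (y - real m) \<le> (real i + 1) powr (y - real m)" using z by (intro powr_mono2) auto
    moreover have "real h powr y \<le> K" using S0 by (simp add: K_def)
    ultimately have "real h powr y * real i powr (y - real m) \<le> K * (real i + 1) powr (y - real m)"
      by (intro mult_mono) (use S0 in \<open>auto simp: K_def\<close>)
    then show ?thesis using i0[of i] False by simp
  qed
  moreover have "0 \<le> K" using S0 by (simp add: K_def)
  ultimately show ?thesis by blast
qed

text \<open>With \<open>J = e * l (c * i)\<close> one has \<open>J = O(i^x)\<close> and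
  \<open>i + J = O(i^(max x 1))\<close>; inserting both into
  \<open>a i \<le> u J * u (i + J)\<close> gives the exponent. The slack \<open>N < y\<close> and
  \<open>d < x\<close> is due to growth degrees being infima.\<close>

lemma N_le_upper:
  assumes "N < y" "0 \<le> d" "growth_degree l = ennreal d" "d < x"
  shows "N \<le> (y - real m) * (x + max x 1)"
proof -
  let ?z = "y - real m"
  have z: "0 \<le> ?z" using m_le_N assms by simp
  have x: "0 < x" using assms by simp
  obtain K where K: "0 \<le> K" "\<And>i. real (u i) \<le> K * (real i + 1) powr ?z"
    using u_bound[OF assms(1)] by blast
  \<comment> \<open>Chosen so that \<open>J \<le> L * i^x\<close>. Below, \<open>J + 1\<close> is at
    most \<open>(L + 1) * i^x\<close> and \<open>i + J + 1\<close> at most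
    \<open>(L + 2) * i^(max x 1)\<close>, whence the two constants.\<close>
  define L where "L = real e * real c powr x"
  have L: "0 \<le> L" by (simp add: L_def)
  have "growth_degree l < ennreal x" using assms by (simp add: ennreal_lessI)
  then have "\<forall>\<^sub>F i in sequentially. real (l (c * i)) \<le> real (c * i) powr x"
    by (intro eventually_subseq[OF growth_degree_less_imp c])
  then have "\<forall>\<^sub>F i in sequentially.
      real (a i) \<le> (K * K * ((L + 1) powr ?z * (L + 2) powr ?z)) * real i powr (?z * (x + max x 1))"
    using eventually_ge_at_top[of 1]
  proof eventually_elim
    case (elim i)
    define J where "J = e * l (c * i)"
    let ?p = "real i powr x" and ?q = "real i powr max x 1"
    have J: "real J \<le> L * ?p"
    proof -
      have "real J \<le> real e * real (c * i) powr x"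
        unfolding J_def of_nat_mult by (intro mult_left_mono) (use elim(1) in auto)
      then show ?thesis by (simp add: L_def powr_mult mult.assoc)
    qed
    have p1: "1 \<le> ?p" using elim(2) x by (intro ge_one_powr_ge_zero) auto
    have q1: "1 \<le> ?q" using elim(2) x by (intro ge_one_powr_ge_zero) auto
    have pq: "?p \<le> ?q" using elim(2) by (intro powr_mono) auto
    have iq: "real i \<le> ?q"
    proof -
      have "real i powr 1 \<le> ?q" using elim(2) by (intro powr_mono) auto
      then show ?thesis using elim(2) by simp
    qed
    have "(real J + 1) powr ?z \<le> ((L + 1) * ?p) powr ?z"
      using J p1 z by (intro powr_mono2) (auto simp: distrib_right)
    then have "K * (real J + 1) powr ?z \<le> K * ((L + 1) powr ?z * real i powr (x * ?z))"
      using K(1) L by (intro mult_left_mono) (auto simp: powr_mult powr_powr)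
    with K(2)[of J] have 1: "real (u J) \<le> K * ((L + 1) powr ?z * real i powr (x * ?z))" by linarith
    have "L * ?p \<le> L * ?q" using pq L by (rule mult_left_mono)
    then have "(real (i + J) + 1) powr ?z \<le> ((L + 2) * ?q) powr ?z"
      using J q1 iq z by (intro powr_mono2) (auto simp: distrib_right)
    then have "K * (real (i + J) + 1) powr ?z \<le> K * ((L + 2) powr ?z * real i powr (max x 1 * ?z))"
      using K(1) L by (intro mult_left_mono) (auto simp: powr_mult powr_powr)
    with K(2)[of "i + J"] have 2: "real (u (i + J)) \<le> K * ((L + 2) powr ?z * real i powr (max x 1 * ?z))"
      by linarith
    have "real (a i) \<le> real (u J) * real (u (i + J))"
      using a_le[of i] unfolding J_def by (simp flip: of_nat_mult)
    also have "\<dots> \<le> (K * ((L + 1) powr ?z * real i powr (x * ?z)))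
        * (K * ((L + 2) powr ?z * real i powr (max x 1 * ?z)))"
      using 1 2 K(1) by (intro mult_mono) auto
    also have "\<dots> = (K * K * ((L + 1) powr ?z * (L + 2) powr ?z)) * real i powr (?z * (x + max x 1))"
    proof -
      have "?z * (x + max x 1) = x * ?z + max x 1 * ?z" by (simp add: algebra_simps)
      then show ?thesis by (simp only: powr_add mult_ac)
    qed
    finally show ?case .
  qed
  moreover have "0 \<le> ?z * (x + max x 1)" using z x by simp
  ultimately have "growth_degree a \<le> ennreal (?z * (x + max x 1))" by (intro growth_degree_leI)
  then show ?thesis using N \<open>0 \<le> ?z * (x + max x 1)\<close> by simp
qed

text \<open>Put \<open>y = N + \<epsilon>\<close> and \<open>x = d + \<epsilon>\<close> in the
  previous bound and let \<open>\<epsilon>\<close> tend to zero from the right.\<close>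

theorem N_le:
  assumes "0 \<le> d" "growth_degree l = ennreal d"
  shows "N \<le> (N - real m) * (d + max d 1)"
proof -
  have "((\<lambda>\<epsilon>. (N + \<epsilon> - real m) * ((d + \<epsilon>) + max (d + \<epsilon>) 1)) \<longlongrightarrow>
      (N + 0 - real m) * ((d + 0) + max (d + 0) 1)) (at_right 0)"
    by (intro tendsto_intros)
  moreover have "\<forall>\<^sub>F \<epsilon> in at_right 0. N \<le> (N + \<epsilon> - real m) * ((d + \<epsilon>) + max (d + \<epsilon>) 1)"
    unfolding eventually_at_right_field
    using N_le_upper[OF _ assms] by (intro exI[of _ 1]) auto
  ultimately have "N \<le> (N + 0 - real m) * ((d + 0) + max (d + 0) 1)"
    by (intro tendsto_lowerbound) auto
  then show ?thesis by simp
qed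

end

text \<open>Gaussian elimination with more unknowns (\<open>I\<close>) than equations
  (\<open>J\<close>). It is carried out in a subset \<open>K\<close> closed under the field
  operations because the rational functions in \<open>m\<close> indeterminates are a carrier set
  inside a larger type.\<close>

lemma homogeneous_system:
  fixes K :: "'f::field set" and c :: "'i \<Rightarrow> 'j \<Rightarrow> 'f"
  assumes K: "0 \<in> K" "1 \<in> K" "\<And>x y. \<lbrakk>x \<in> K; y \<in> K\<rbrakk> \<Longrightarrow> x + y \<in> K" "\<And>x y. \<lbrakk>x \<in> K; y \<in> K\<rbrakk> \<Longrightarrow> x * y \<in> K"
      "\<And>x. x \<in> K \<Longrightarrow> - x \<in> K" "\<And>x. x \<in> K \<Longrightarrow> inverse x \<in> K"
    and "finite J" "finite I" "card J < card I" "\<And>s t. \<lbrakk>s \<in> I; t \<in> J\<rbrakk> \<Longrightarrow> c s t \<in> K"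
  shows "\<exists>q. (\<forall>s\<in>I. q s \<in> K) \<and> (\<exists>s\<in>I. q s \<noteq> 0) \<and> (\<forall>t\<in>J. (\<Sum>s\<in>I. q s * c s t) = 0)"
  using assms(7-)
proof (induction J arbitrary: I c rule: finite_induct)
  case empty
  then have "I \<noteq> {}" by auto
  then show ?case using K by (intro exI[of _ "\<lambda>_. 1"]) auto
next
  case (insert t J)
  show ?case
  proof (cases "\<forall>s\<in>I. c s t = 0")
    case True
    have "card J < card I" using insert by simp
    then obtain q where "\<forall>s\<in>I. q s \<in> K" "\<exists>s\<in>I. q s \<noteq> 0" "\<forall>t\<in>J. (\<Sum>s\<in>I. q s * c s t) = 0"
      using insert.IH[of I c] insert.prems by blast
    then show ?thesis using True by (intro exI[of _ q]) auto
  next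
    case False
    then obtain s0 where s0: "s0 \<in> I" "c s0 t \<noteq> 0" by blast
    define I' where "I' = I - {s0}"
    \<comment> \<open>Elimination of the unknown \<open>s0\<close> by means of equation
      \<open>t\<close>, with pivot \<open>c s0 t\<close>.\<close>
    define c' where "c' s u = c s u - c s t * inverse (c s0 t) * c s0 u" for s u
    have I': "finite I'" "I = insert s0 I'" "s0 \<notin> I'" using insert.prems s0 by (auto simp: I'_def)
    have "c' s u \<in> K" if "s \<in> I'" "u \<in> J" for s u
    proof -
      have "c s u \<in> K" "c s t \<in> K" "c s0 t \<in> K" "c s0 u \<in> K" using insert.prems that I' by auto
      then have "c s u + - (c s t * inverse (c s0 t) * c s0 u) \<in> K" by (intro K)
      then show ?thesis by (simp add: c'_def)
    qed
    moreover have "card J < card I'" using insert I' by simp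
    ultimately obtain q where q: "\<And>s. s \<in> I' \<Longrightarrow> q s \<in> K" "\<exists>s\<in>I'. q s \<noteq> 0"
        "\<And>u. u \<in> J \<Longrightarrow> (\<Sum>s\<in>I'. q s * c' s u) = 0"
      using insert.IH[of I' c'] I'(1) by blast
    \<comment> \<open>Back substitution: the value of the eliminated unknown that makes equation
      \<open>t\<close> hold.\<close>
    define q0 where "q0 = - ((\<Sum>s\<in>I'. q s * c s t) * inverse (c s0 t))"
    have sumK: "sum g I' \<in> K" if "\<And>s. s \<in> I' \<Longrightarrow> g s \<in> K" for g
      using I'(1) that by (induction I' rule: finite_induct) (auto intro: K)
    have q0: "q0 \<in> K"
      unfolding q0_def using q(1) insert.prems I' s0 by (intro K sumK) auto
    define q' where "q' s = (if s = s0 then q0 else q s)" for s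
    have split: "(\<Sum>s\<in>I. q' s * c s u) = q0 * c s0 u + (\<Sum>s\<in>I'. q s * c s u)" for u
    proof -
      have "(\<Sum>s\<in>I'. q' s * c s u) = (\<Sum>s\<in>I'. q s * c s u)"
        using I'(3) by (intro sum.cong) (auto simp: q'_def)
      then show ?thesis unfolding I'(2) using I'(1,3) by (simp add: q'_def)
    qed
    have "(\<Sum>s\<in>I. q' s * c s u) = 0" if "u \<in> insert t J" for u
    proof (cases "u = t")
      case True
      then show ?thesis using s0(2) split[of t] by (simp add: q0_def)
    next
      case False
      then have "0 = (\<Sum>s\<in>I'. q s * c' s u)" using q(3) that by auto
      also have "\<dots> = (\<Sum>s\<in>I'. q s * c s u) - (\<Sum>s\<in>I'. q s * c s t) * inverse (c s0 t) * c s0 u"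
        by (simp add: c'_def right_diff_distrib sum_subtractf sum_distrib_right mult.assoc)
      finally show ?thesis using split[of u] by (simp add: q0_def)
    qed
    moreover have "\<exists>s\<in>I. q' s \<noteq> 0" using q(2) I' by (auto simp: q'_def)
    moreover have "\<forall>s\<in>I. q' s \<in> K" using q(1) q0 I' by (auto simp: q'_def)
    ultimately show ?thesis by blast
  qed
qed

section \<open>Growth of commutative algebras\<close>

lemma digit_sum_less:
  assumes "\<And>t. t < n \<Longrightarrow> e t < (M::nat)"
  shows "(\<Sum>t<n. e t * M ^ t) < M ^ n"
  using assms
proof (induction n)
  case (Suc n)
  have "(\<Sum>t<Suc n. e t * M ^ t) < M ^ n + e n * M ^ n" using Suc by simp
  also have "\<dots> = (1 + e n) * M ^ n" by simp
  also have "\<dots> \<le> M * M ^ n" using Suc.prems[of n] by (intro mult_right_mono) auto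
  finally show ?case by simp
qed simp

lemma digit_sum_inj:
  assumes "\<And>t. t < n \<Longrightarrow> e t < (M::nat)" "\<And>t. t < n \<Longrightarrow> e' t < M"
    and "(\<Sum>t<n. e t * M ^ t) = (\<Sum>t<n. e' t * M ^ t)" "t < n"
  shows "e t = e' t"
  using assms
proof (induction n arbitrary: t)
  case (Suc n)
  let ?s = "\<Sum>t<n. e t * M ^ t" and ?s' = "\<Sum>t<n. e' t * M ^ t"
  have lt: "?s < M ^ n" "?s' < M ^ n"
    using digit_sum_less[of n e M] digit_sum_less[of n e' M] Suc.prems(1,2) by auto
  have "(?s + e n * M ^ n) div M ^ n = (?s' + e' n * M ^ n) div M ^ n" using Suc.prems(3) by simp
  moreover have "(?s + e n * M ^ n) div M ^ n = e n" "(?s' + e' n * M ^ n) div M ^ n = e' n"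
  proof -
    have nz: "M ^ n \<noteq> 0" using lt(1) by linarith
    show "(?s + e n * M ^ n) div M ^ n = e n" using lt(1) by (subst div_mult_self1[OF nz]) simp
    show "(?s' + e' n * M ^ n) div M ^ n = e' n" using lt(2) by (subst div_mult_self1[OF nz]) simp
  qed
  ultimately have n: "e n = e' n" by simp
  then have "?s = ?s'" using Suc.prems(3) by simp
  then show ?case using Suc.IH[of t] Suc.prems n less_antisym by (cases "t = n") auto
qed simp

text \<open>If \<open>e\<close> is the exponent vector of a monomial in the variables
  \<open>y (h t)\<close>, this is its exponent vector in the variables \<open>y u\<close>. Summing
  over the fibres of \<open>h\<close> makes it correct for every \<open>h\<close>; for injective
  \<open>h\<close> it is a relabelling.\<close>

definition push :: "(nat \<Rightarrow> nat) \<Rightarrow> nat \<Rightarrow> (nat \<Rightarrow> nat) \<Rightarrow> nat \<Rightarrow> nat" where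
  "push h r e u = (\<Sum>t<r. if h t = u then e t else 0)"

lemma push_apply:
  assumes "inj_on h {..<r}" "t < r"
  shows "push h r e (h t) = e t"
proof -
  have "push h r e (h t) = (\<Sum>t'<r. if t' = t then e t' else 0)"
    unfolding push_def using assms by (intro sum.cong) (auto dest: inj_onD)
  then show ?thesis using assms(2) by simp
qed

lemma push_outside: "u \<notin> h ` {..<r} \<Longrightarrow> push h r e u = 0"
  unfolding push_def by (intro sum.neutral) auto

text \<open>There are at most \<open>2 ^ m\<close> choices for the set of coordinates that are at
  least \<open>N\<close>. For each, at most \<open>r\<close> coordinates have \<open>B + 1\<close>
  possible values and the others fewer than \<open>N + 1\<close>. What counts is that the bound has
  degree \<open>r\<close> in \<open>B\<close>.\<close>

lemma card_few_large:
  assumes "1 \<le> N"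
  shows "finite {g :: nat \<Rightarrow> nat. (\<forall>t\<ge>m. g t = 0) \<and> (\<forall>t<m. g t \<le> B) \<and> card {t\<in>{..<m}. N \<le> g t} \<le> r}"
    (is "finite ?G")
    and "card {g :: nat \<Rightarrow> nat. (\<forall>t\<ge>m. g t = 0) \<and> (\<forall>t<m. g t \<le> B) \<and> card {t\<in>{..<m}. N \<le> g t} \<le> r}
      \<le> 2 ^ m * (N ^ m * (B + 1) ^ r)"
proof -
  define box where "box L = (\<Pi>\<^sub>E t\<in>{..<m}. if t \<in> L then {..B} else {..<N})" for L
  define LL where "LL = {L \<in> Pow {..<m}. card L \<le> r}"
  have fLL: "finite LL" unfolding LL_def by auto
  have cardbox: "card (box L) \<le> N ^ m * (B + 1) ^ r" if L: "L \<in> LL" for L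
  proof -
    have Lm: "L \<subseteq> {..<m}" "card L \<le> r" using L by (auto simp: LL_def)
    have "card (box L) = (\<Prod>t<m. if t \<in> L then B + 1 else N)"
      unfolding box_def by (subst card_PiE) (auto intro: prod.cong)
    also have "\<dots> = (\<Prod>t\<in>L. B + 1) * (\<Prod>t\<in>{..<m} - L. N)"
      using Lm(1) by (subst prod.If_cases) (auto simp: Int_absorb1 Diff_eq)
    also have "\<dots> = (B + 1) ^ card L * N ^ card ({..<m} - L)" by simp
    also have "\<dots> \<le> (B + 1) ^ r * N ^ m"
    proof (intro mult_mono power_increasing)
      show "card ({..<m} - L) \<le> m" using card_mono[of "{..<m}" "{..<m} - L"] by auto
    qed (use Lm assms in auto)
    finally show ?thesis by (simp add: mult.commute)
  qed
  have finbox: "finite (box L)" for L unfolding box_def by (intro finite_PiE) auto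
  have inj: "inj_on (\<lambda>g. restrict g {..<m}) ?G"
  proof (rule inj_onI, rule ext)
    fix g g' t assume g: "g \<in> ?G" "g' \<in> ?G" and eq: "restrict g {..<m} = restrict g' {..<m}"
    show "g t = g' t"
    proof (cases "t < m")
      case True
      then show ?thesis using fun_cong[OF eq, of t] by simp
    next
      case False
      then show ?thesis using g by simp
    qed
  qed
  have img: "(\<lambda>g. restrict g {..<m}) ` ?G \<subseteq> (\<Union>L\<in>LL. box L)"
  proof (rule image_subsetI)
    fix g assume g: "g \<in> ?G"
    let ?L = "{t\<in>{..<m}. N \<le> g t}"
    have "?L \<in> LL" using g by (auto simp: LL_def)
    moreover have "restrict g {..<m} \<in> box ?L" using g by (auto simp: box_def)
    ultimately show "restrict g {..<m} \<in> (\<Union>L\<in>LL. box L)" by blast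
  qed
  have finU: "finite (\<Union>L\<in>LL. box L)" using fLL finbox by auto
  show "finite ?G"
    using finite_subset[OF img finU] inj by (rule finite_imageD)
  have "card ?G = card ((\<lambda>g. restrict g {..<m}) ` ?G)" using card_image[OF inj] by simp
  also have "\<dots> \<le> card (\<Union>L\<in>LL. box L)" by (rule card_mono[OF finU img])
  also have "\<dots> \<le> (\<Sum>L\<in>LL. card (box L))" by (rule card_UN_le[OF fLL])
  also have "\<dots> \<le> card LL * (N ^ m * (B + 1) ^ r)"
    using sum_bounded_above[of LL "\<lambda>L. card (box L)"] cardbox by auto
  also have "card LL \<le> 2 ^ m"
    using card_mono[of "Pow {..<m}" LL] by (auto simp: LL_def card_Pow)
  finally show "card ?G \<le> 2 ^ m * (N ^ m * (B + 1) ^ r)" by simp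
qed

section \<open>Monomials in commuting elements and their dependence\<close>

context commuting_elements
begin

lemma monom_val_unit: "v < n \<Longrightarrow> monom_val A y n (\<lambda>u. if v = u then c else 0) = y v [^] c"
proof (induction n)
  case (Suc n)
  have "monom_val A y n (\<lambda>u. if v = u then c else 0) = (if v = n then \<one> else y v [^] c)"
    using Suc by (auto intro: monom_val_zero)
  then show ?case using C_carrier[OF y_C, of v] by auto
qed simp

lemma monom_val_push:
  assumes "\<And>t. t < r \<Longrightarrow> h t < m"
  shows "monom_val A (\<lambda>t. y (h t)) r e = monom_val A y m (push h r e)"
  using assms
proof (induction r)
  case 0
  then show ?case by (simp add: push_def monom_val_zero)
next
  case (Suc r)
  have "push h (Suc r) e = (\<lambda>u. push h r e u + (if h r = u then e r else 0))"
    by (auto simp: push_def)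
  then show ?case
    using Suc monom_val_add[of m "push h r e" "\<lambda>u. if h r = u then e r else 0"]
      monom_val_unit[of "h r" m "e r"] by simp
qed

lemma commuting_reindex: "commuting_elements A \<iota> C (\<lambda>t. y (h t))"
  by (intro commuting_elements.intro commuting_elements_axioms.intro C \<iota>_C y_C field_algebra_axioms)

abbreviation "mval \<equiv> monom_val A y m"

lemma mval_carrier: "mval ` E \<subseteq> carrier A"
  by auto

lemma mval_in_span: "e \<in> E \<Longrightarrow> mval e \<in> subspace_span A (range \<iota>) (mval ` E)"
  by (rule subsetD[OF subspace_span_superset[OF mval_carrier] imageI])

lemma filtration_monomials:
  "Fil (y ` {..<m}) i \<subseteq> subspace_span A (range \<iota>) (mval ` {e. (\<forall>t\<ge>m. e t = 0) \<and> (\<Sum>t<m. e t) \<le> i})"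
proof (induction i)
  case 0
  let ?V = "mval ` {e. (\<forall>t\<ge>m. e t = 0) \<and> (\<Sum>t<m. e t) \<le> 0}"
  have "mval (\<lambda>_. 0) \<in> subspace_span A (range \<iota>) ?V" by (rule mval_in_span) simp
  then have 1: "\<one> \<in> subspace_span A (range \<iota>) ?V" by (simp add: monom_val_zero)
  show ?case
    unfolding standard_filtration.simps
  proof
    fix c assume c: "c \<in> range \<iota>"
    have "c \<otimes> \<one> \<in> subspace_span A (range \<iota>) ?V"
      by (rule subspaceD(4)[OF subspace_subspace_span[OF mval_carrier] c 1])
    moreover have "c \<in> carrier A" using c scalars_in_carrier by blast
    ultimately show "c \<in> subspace_span A (range \<iota>) ?V" by simp
  qed
next
  case (Suc i)
  let ?V = "\<lambda>i. mval ` {e. (\<forall>t\<ge>m. e t = 0) \<and> (\<Sum>t<m. e t) \<le> i}"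
  let ?S = "insert \<one> (y ` {..<m})"
  have S: "?S \<subseteq> carrier A" using C_carrier[OF y_C] by auto
  have prod: "v \<otimes> w \<in> subspace_span A (range \<iota>) (?V (Suc i))" if vi: "v \<in> ?V i" and wS: "w \<in> ?S" for v w
  proof -
    obtain e where e: "v = mval e" "\<forall>t\<ge>m. e t = 0" "(\<Sum>t<m. e t) \<le> i" using vi by auto
    have "\<exists>e'. w = mval e' \<and> (\<forall>t\<ge>m. e' t = 0) \<and> (\<Sum>t<m. e' t) \<le> 1"
    proof (cases "w = \<one>")
      case True
      then show ?thesis by (intro exI[of _ "\<lambda>_. 0"]) (auto simp: monom_val_zero)
    next
      case False
      then obtain v where v: "v < m" "w = y v" using wS by auto
      then show ?thesis
        using monom_val_unit[OF v(1), of 1] C_carrier[OF y_C, of v]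
        by (intro exI[of _ "\<lambda>u. if v = u then 1 else 0"]) auto
    qed
    then obtain e' where e': "w = mval e'" "\<forall>t\<ge>m. e' t = 0" "(\<Sum>t<m. e' t) \<le> 1" by blast
    have "v \<otimes> w = mval (\<lambda>t. e t + e' t)" using e e' monom_val_add by simp
    moreover have "mval (\<lambda>t. e t + e' t) \<in> subspace_span A (range \<iota>) (?V (Suc i))"
      using e(2,3) e'(2,3) by (intro mval_in_span) (auto simp: sum.distrib)
    ultimately show ?thesis by simp
  qed
  have "x \<otimes> g \<in> subspace_span A (range \<iota>) (?V (Suc i))"
    if "x \<in> Fil (y ` {..<m}) i" "g \<in> subspace_span A (range \<iota>) ?S" for x g
    by (rule span_mult_span[OF subspace_subspace_span[OF mval_carrier] mval_carrier S prod
          subsetD[OF Suc that(1)] that(2)])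
  then have "{x \<otimes> g |x g. x \<in> Fil (y ` {..<m}) i \<and> g \<in> subspace_span A (range \<iota>) ?S}
      \<subseteq> subspace_span A (range \<iota>) (?V (Suc i))" by blast
  then show ?case
    unfolding standard_filtration.simps by (rule subspace_span_least[OF subspace_subspace_span[OF mval_carrier]])
qed

text \<open>The injection \<open>h\<close> selects \<open>r\<close> distinct ones among the given
  generators; only its values on \<open>{..<r}\<close> matter.\<close>

definition independent_at :: "(nat \<Rightarrow> nat) \<Rightarrow> nat \<Rightarrow> bool" where
  "independent_at h r \<longleftrightarrow> inj_on h {..<r} \<and> h ` {..<r} \<subseteq> {..<m} \<and>
    (\<forall>p\<in>mpolys r. commuting_elements.ev A \<iota> (\<lambda>t. y (h t)) r p = \<zero> \<longrightarrow> p = 0)"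

lemma exists_max_independent:
  obtains h r where "independent_at h r" "\<And>h' r'. independent_at h' r' \<Longrightarrow> r' \<le> r"
proof -
  have le: "r \<le> m" if "independent_at h r" for h r
  proof -
    have "card (h ` {..<r}) = r" using that by (simp add: independent_at_def card_image)
    moreover have "card (h ` {..<r}) \<le> card {..<m}"
      using that by (intro card_mono) (auto simp: independent_at_def)
    ultimately show ?thesis by simp
  qed
  \<comment> \<open>A polynomial in no variables is constant, and \<open>\<iota>\<close> is
    injective. Thus the set whose maximum is taken is nonempty.\<close>
  have 0: "independent_at h 0" for h
  proof -
    interpret h: commuting_elements A \<iota> C "\<lambda>t. y (h t)" 0 by (rule commuting_reindex)
    have 0: "p = 0" if p: "p \<in> mpolys 0" "h.ev p = \<zero>" for p
    proof -
      have "Poly_Mapping.lookup p e = Poly_Mapping.lookup (Poly_Mapping.single 0 (Poly_Mapping.lookup p 0)) e" for e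
      proof (cases "e = 0")
        case False
        have "e \<notin> Poly_Mapping.keys p"
        proof
          assume "e \<in> Poly_Mapping.keys p"
          then have "Poly_Mapping.keys e \<subseteq> {..<0}" using p(1) unfolding mpolys_def by blast
          then have "Poly_Mapping.keys e = {}" by simp
          then show False using False by (simp only: keys_eq_empty)
        qed
        then show ?thesis using False by (simp add: in_keys_iff lookup_single_not_eq)
      qed simp
      then have p0: "p = Poly_Mapping.single 0 (Poly_Mapping.lookup p 0)"
        by (rule poly_mapping_eqI)
      have "h.ev p = h.ev (Poly_Mapping.single 0 (Poly_Mapping.lookup p 0))"
        by (rule arg_cong[OF p0])
      also have "\<dots> = \<iota> (Poly_Mapping.lookup p 0)" by (rule h.ev_const)
      finally have "\<iota> (Poly_Mapping.lookup p 0) = \<zero>" using p(2) by (rule trans[OF sym])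
      then have "Poly_Mapping.lookup p 0 = 0" by (simp only: \<iota>_eq_zero_iff)
      then show ?thesis by (subst p0) simp
    qed
    show ?thesis
      unfolding independent_at_def
    proof (intro conjI ballI impI)
      show "inj_on h {..<0}" unfolding lessThan_0 by (rule inj_on_empty)
      show "h ` {..<0} \<subseteq> {..<m}" unfolding lessThan_0 image_empty by (rule empty_subsetI)
      show "p = 0" if "p \<in> mpolys 0" "h.ev p = \<zero>" for p using that by (rule 0)
    qed
  qed
  define r where "r = Max {r. \<exists>h. independent_at h r}"
  have fin: "finite {r. \<exists>h. independent_at h r}"
    by (rule finite_subset[of _ "{..m}"]) (use le in auto)
  have "{r. \<exists>h. independent_at h r} \<noteq> {}" using 0 by blast
  then have "r \<in> {r. \<exists>h. independent_at h r}" unfolding r_def by (rule Max_in[OF fin])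
  moreover have "r' \<le> r" if "independent_at h' r'" for h' r'
    unfolding r_def by (rule Max_ge[OF fin]) (use that in blast)
  ultimately show ?thesis using that by blast
qed

end

lemma (in field_algebra) solve_scalar:
  assumes "v \<in> carrier A" "s \<in> carrier A" "c \<noteq> 0" "\<iota> c \<otimes> v \<oplus> s = \<zero>"
  shows "v = \<iota> (- inverse c) \<otimes> s"
proof -
  have cv: "\<iota> c \<otimes> v = \<ominus> s"
    using assms by (intro minus_equality[symmetric]) auto
  have "\<iota> (inverse c) \<otimes> \<iota> c = \<one>"
    unfolding \<iota>_simps(2)[symmetric] using assms(3) \<iota>_simps(3) by simp
  then have "v = \<iota> (inverse c) \<otimes> (\<iota> c \<otimes> v)" using assms(1) by (simp add: m_assoc[symmetric])
  also have "\<dots> = \<iota> (- inverse c) \<otimes> s"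
    unfolding cv \<iota>_minus using assms(2) by (simp add: l_minus r_minus)
  finally show ?thesis .
qed

context commuting_elements
begin

text \<open>Nagata's trick: for large \<open>M\<close> the weight \<open>\<Sum>t. e t * M ^ t\<close> separates the finitely many
  monomials of a relation, so the one of largest weight is a combination of lighter ones.\<close>

lemma dependent_leading_monomial:
  assumes inj: "inj_on h {..<r}" and h: "h ` {..<r} \<subseteq> {..<m}"
    and p: "p \<in> mpolys r" "p \<noteq> 0" "commuting_elements.ev A \<iota> (\<lambda>t. y (h t)) r p = \<zero>"
    and M: "\<And>e t. e \<in> Poly_Mapping.keys p \<Longrightarrow> Poly_Mapping.lookup e t < M"
  shows "\<exists>f E. (\<forall>u. u \<notin> h ` {..<r} \<longrightarrow> f u = 0) \<and> (\<forall>u. f u < M)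
    \<and> (\<forall>e\<in>E. (\<Sum>t<m. e t * M ^ t) < (\<Sum>t<m. f t * M ^ t)) \<and> (\<forall>e\<in>E. \<forall>u\<ge>m. e u = 0)
    \<and> mval f \<in> subspace_span A (range \<iota>) (mval ` E)"
proof -
  interpret h: commuting_elements A \<iota> C "\<lambda>t. y (h t)" r by (rule commuting_reindex)
  define w where "w e = (\<Sum>t<m. e t * M ^ t)" for e :: "nat \<Rightarrow> nat"
  define P where "P e = push h r (Poly_Mapping.lookup e)" for e
  have hm: "h t < m" if "t < r" for t using h that by auto
  have PM: "P e u < M" if "e \<in> Poly_Mapping.keys p" for e u
  proof (cases "u \<in> h ` {..<r}")
    case True
    then obtain t where "t < r" "u = h t" by auto
    then show ?thesis using push_apply[OF inj] M[OF that] by (simp add: P_def)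
  next
    case False
    then show ?thesis using push_outside[of u h r] M[OF that, of 0] by (simp add: P_def)
  qed
  \<comment> \<open>All exponents are below \<open>M\<close>, so the weight is an expansion in base
    \<open>M\<close> and determines the exponent vector.\<close>
  have Pinj: "e = e'" if e: "e \<in> Poly_Mapping.keys p" "e' \<in> Poly_Mapping.keys p" and eq: "w (P e) = w (P e')" for e e'
  proof (rule poly_mapping_eqI)
    fix t
    show "Poly_Mapping.lookup e t = Poly_Mapping.lookup e' t"
    proof (cases "t < r")
      case True
      have "P e (h t) = P e' (h t)"
        by (rule digit_sum_inj[of m "P e" M "P e'"]) (use PM e eq hm[OF True] in \<open>auto simp: w_def\<close>)
      then show ?thesis using push_apply[OF inj True] by (simp add: P_def)
    next
      case False
      then have "t \<notin> Poly_Mapping.keys e" "t \<notin> Poly_Mapping.keys e'" using p(1) e by (auto simp: mpolys_def)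
      then show ?thesis by (simp add: in_keys_iff)
    qed
  qed
  have ne: "Poly_Mapping.keys p \<noteq> {}" using p(2) by (simp add: poly_mapping_eq_iff fun_eq_iff in_keys_iff set_eq_iff)
  obtain e0 where e0: "e0 \<in> Poly_Mapping.keys p" "\<And>e. e \<in> Poly_Mapping.keys p \<Longrightarrow> w (P e) \<le> w (P e0)"
  proof -
    have "Max ((\<lambda>e. w (P e)) ` Poly_Mapping.keys p) \<in> (\<lambda>e. w (P e)) ` Poly_Mapping.keys p"
      using ne by (intro Max_in) auto
    then obtain e0 where "e0 \<in> Poly_Mapping.keys p" "Max ((\<lambda>e. w (P e)) ` Poly_Mapping.keys p) = w (P e0)" by auto
    then show ?thesis using that[of e0] by (metis Max_ge finite_imageI finite_keys imageI)
  qed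
  define E where "E = P ` (Poly_Mapping.keys p - {e0})"
  let ?L = "Poly_Mapping.lookup p"
  have lighter: "w (P e) < w (P e0)" if "e \<in> Poly_Mapping.keys p - {e0}" for e
    using e0 Pinj that by (metis DiffE insertCI le_neq_implies_less)
  have "h.ev p = (\<Oplus>e\<in>insert e0 (Poly_Mapping.keys p - {e0}). \<iota> (?L e) \<otimes> mval (P e))"
    unfolding h.ev_def using e0(1) monom_val_push[OF hm] by (simp add: insert_absorb P_def)
  also have "\<dots> = \<iota> (?L e0) \<otimes> mval (P e0) \<oplus> (\<Oplus>e\<in>Poly_Mapping.keys p - {e0}. \<iota> (?L e) \<otimes> mval (P e))"
    by (rule finsum_insert) auto
  finally have sum0: "\<iota> (?L e0) \<otimes> mval (P e0) \<oplus> (\<Oplus>e\<in>Poly_Mapping.keys p - {e0}. \<iota> (?L e) \<otimes> mval (P e)) = \<zero>"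
    using p(3) by simp
  let ?sp = "subspace_span A (range \<iota>) (mval ` E)"
  have sub: "subalgebra (range \<iota>) ?sp A" by (rule subspace_subspace_span[OF mval_carrier])
  have s: "(\<Oplus>e\<in>Poly_Mapping.keys p - {e0}. \<iota> (?L e) \<otimes> mval (P e)) \<in> ?sp"
    by (intro subspace_finsum[OF sub] subspaceD(4)[OF sub] mval_in_span) (auto simp: E_def)
  define s where "s = (\<Oplus>e\<in>Poly_Mapping.keys p - {e0}. \<iota> (?L e) \<otimes> mval (P e))"
  have sc: "s \<in> carrier A" unfolding s_def by (intro finsum_closed) auto
  have L0: "?L e0 \<noteq> 0" using e0(1) by (simp add: in_keys_iff)
  have "mval (P e0) = \<iota> (- inverse (?L e0)) \<otimes> s"
    using sum0 sc L0 unfolding s_def[symmetric] by (intro solve_scalar) auto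
  also have "\<dots> \<in> ?sp" unfolding s_def by (rule subspaceD(4)[OF sub _ s]) simp
  finally have m0: "mval (P e0) \<in> ?sp" .
  have P0: "P e u = 0" if "u \<notin> h ` {..<r}" for e u using push_outside[OF that] by (simp add: P_def)
  have P1: "P e u = 0" if "m \<le> u" for e u
    using that h by (intro P0) auto
  show ?thesis
  proof (intro exI[of _ "P e0"] exI[of _ E] conjI allI ballI impI)
    show "(\<Sum>t<m. e t * M ^ t) < (\<Sum>t<m. P e0 t * M ^ t)" if "e \<in> E" for e
      using that lighter unfolding E_def w_def by blast
    show "e u = 0" if "e \<in> E" "m \<le> u" for e u
      using that P1 unfolding E_def by auto
  qed (use P0 PM[OF e0(1)] m0 in simp_all)
qed

text \<open>Take a largest independent set of generators, of size \<open>r\<close>. Every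
  \<open>r + 1\<close> generators are dependent, and the leading monomial of a relation can be
  rewritten by lighter ones. A monomial divisible by no leading monomial has at most
  \<open>r\<close> large exponents, so only \<open>O(i^r)\<close> monomials are required to span the
  \<open>i\<close>-th step.\<close>

theorem commutative_growth:
  obtains h r where "independent_elements A \<iota> C (\<lambda>t. y (h t)) r"
    "growth_degree (\<lambda>i. dim (range \<iota>) (Fil (y ` {..<m}) i)) \<le> of_nat r"
proof -
  obtain h0 r where h0: "independent_at h0 r" and max: "\<And>h r'. independent_at h r' \<Longrightarrow> r' \<le> r"
    using exists_max_independent by blast
  \<comment> \<open>All choices of \<open>r + 1\<close> distinct generators, as extensional
    functions to make the set finite.\<close>
  define H where "H = ({..<Suc r} \<rightarrow>\<^sub>E {..<m}) \<inter> {h. inj_on h {..<Suc r}}"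
  have finH: "finite H" unfolding H_def by (intro finite_Int disjI1 finite_PiE) auto
  have "\<exists>p. p \<in> mpolys (Suc r) \<and> p \<noteq> 0 \<and> commuting_elements.ev A \<iota> (\<lambda>t. y (h t)) (Suc r) p = \<zero>"
    if "h \<in> H" for h
  proof -
    have "\<not> independent_at h (Suc r)" using max[of h "Suc r"] by auto
    moreover have "inj_on h {..<Suc r}" "h ` {..<Suc r} \<subseteq> {..<m}" using that by (auto simp: H_def)
    ultimately show ?thesis unfolding independent_at_def by blast
  qed
  then obtain p where p: "\<And>h. h \<in> H \<Longrightarrow> p h \<in> mpolys (Suc r)" "\<And>h. h \<in> H \<Longrightarrow> p h \<noteq> 0"
    "\<And>h. h \<in> H \<Longrightarrow> commuting_elements.ev A \<iota> (\<lambda>t. y (h t)) (Suc r) (p h) = \<zero>" by metis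
  define Z where "Z = (\<Union>h\<in>H. \<Union>e\<in>Poly_Mapping.keys (p h). Poly_Mapping.lookup e ` Poly_Mapping.keys e)"
  have finZ: "finite Z" unfolding Z_def using finH by auto
  \<comment> \<open>One base for all relations: it exceeds every exponent occurring in any of them.
    Hence all reductions decrease one and the same weight.\<close>
  define M where "M = Suc (\<Sum>Z)"
  have M: "Poly_Mapping.lookup e t < M" if "h \<in> H" "e \<in> Poly_Mapping.keys (p h)" for h e t
  proof (cases "t \<in> Poly_Mapping.keys e")
    case True
    then have "Poly_Mapping.lookup e t \<in> Z" unfolding Z_def using that by blast
    then have "Poly_Mapping.lookup e t \<le> \<Sum>Z" using finZ by (metis member_le_sum zero_le)
    then show ?thesis by (simp add: M_def)
  next
    case False
    then show ?thesis by (simp add: M_def in_keys_iff)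
  qed
  define w where "w e = (\<Sum>t<m. e t * M ^ t)" for e :: "nat \<Rightarrow> nat"
  define Q where "Q h f E \<longleftrightarrow> (\<forall>u. u \<notin> h ` {..<Suc r} \<longrightarrow> f u = 0) \<and> (\<forall>u. f u < M)
      \<and> (\<forall>e\<in>E. w e < w f) \<and> (\<forall>e\<in>E. \<forall>u\<ge>m. e u = 0)
      \<and> mval f \<in> subspace_span A (range \<iota>) (mval ` E)" for h f E
  have "\<exists>f E. Q h f E" if h: "h \<in> H" for h
  proof -
    have hh: "inj_on h {..<Suc r}" "h ` {..<Suc r} \<subseteq> {..<m}" using h by (auto simp: H_def)
    show ?thesis
      unfolding w_def Q_def by (rule dependent_leading_monomial[OF hh p(1)[OF h] p(2)[OF h] p(3)[OF h] M[OF h]])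
  qed
  then obtain f E where Q: "\<And>h. h \<in> H \<Longrightarrow> Q h (f h) (E h)" by metis
  have f: "\<And>h u. \<lbrakk>h \<in> H; u \<notin> h ` {..<Suc r}\<rbrakk> \<Longrightarrow> f h u = 0" "\<And>h u. h \<in> H \<Longrightarrow> f h u < M"
    and E: "\<And>h e. \<lbrakk>h \<in> H; e \<in> E h\<rbrakk> \<Longrightarrow> w e < w (f h)" "\<And>h e u. \<lbrakk>h \<in> H; e \<in> E h; m \<le> u\<rbrakk> \<Longrightarrow> e u = 0"
    and fE: "\<And>h. h \<in> H \<Longrightarrow> mval (f h) \<in> subspace_span A (range \<iota>) (mval ` E h)"
    using Q unfolding Q_def by simp_all
  \<comment> \<open>The normal monomials: those divisible by no leading monomial
    \<open>f h\<close>.\<close>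
  define G where "G = {g. (\<forall>t\<ge>m. g t = 0) \<and> (\<forall>h\<in>H. \<exists>u. g u < f h u)}"
  \<comment> \<open>Strong induction on the weight. If \<open>f h\<close> divides the monomial,
    replacing that factor by its lighter monomials leaves a combination of monomials of smaller
    weight, since weights add under multiplication.\<close>
  have reduce: "mval e \<in> subspace_span A (range \<iota>) (mval ` {g \<in> G. w g \<le> w e})" if "\<forall>t\<ge>m. e t = 0" for e
    using that
  proof (induction "w e" arbitrary: e rule: less_induct)
    case less
    let ?sp = "\<lambda>n. subspace_span A (range \<iota>) (mval ` {g \<in> G. w g \<le> n})"
    show ?case
    proof (cases "e \<in> G")
      case True
      then show ?thesis by (intro mval_in_span) simp
    next
      case False
      then obtain h where h: "h \<in> H" "\<And>u. f h u \<le> e u"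
        using less.prems unfolding G_def by (auto simp: not_less)
      define e'' where "e'' u = e u - f h u" for u
      have e: "e = (\<lambda>u. f h u + e'' u)" using h(2) by (auto simp: e''_def)
      have w_add: "w (\<lambda>u. a u + b u) = w a + w b" for a b
        by (simp add: w_def distrib_right sum.distrib)
      have prod: "v \<otimes> x \<in> ?sp (w e)" if v: "v \<in> mval ` E h" and x: "x \<in> {mval e''}" for v x
      proof -
        obtain e' where e': "v = mval e'" "e' \<in> E h" using v by blast
        let ?e = "\<lambda>u. e' u + e'' u"
        have lt: "w ?e < w e" unfolding e w_add using E(1)[OF h(1) e'(2)] by simp
        have "\<forall>t\<ge>m. ?e t = 0" using E(2)[OF h(1) e'(2)] less.prems by (simp add: e''_def)
        then have "mval ?e \<in> ?sp (w ?e)" using less.hyps lt by blast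
        moreover have "?sp (w ?e) \<subseteq> ?sp (w e)"
          using lt by (intro subspace_span_mono[OF _ mval_carrier] image_mono) auto
        moreover have "v \<otimes> x = mval ?e" using e' x monom_val_add by simp
        ultimately show ?thesis by auto
      qed
      have c: "{mval e''} \<subseteq> carrier A" by simp
      have "mval (f h) \<otimes> mval e'' \<in> ?sp (w e)"
      proof (rule span_mult_span[where V = "mval ` E h" and W = "{mval e''}"])
        show "subalgebra (range \<iota>) (?sp (w e)) A" by (rule subspace_subspace_span[OF mval_carrier])
        show "mval e'' \<in> subspace_span A (range \<iota>) {mval e''}"
          using subspace_span_superset[OF c] by blast
      qed (use c mval_carrier prod fE[OF h(1)] in simp_all)
      moreover have "mval e = mval (f h) \<otimes> mval e''" by (subst e) (rule monom_val_add)
      ultimately show ?thesis by simp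
    qed
  qed
  \<comment> \<open>Given \<open>r + 1\<close> exponents at least \<open>M\<close>, let
    \<open>h\<close> enumerate their positions. Then \<open>f h\<close> is below \<open>M\<close>
    there and zero elsewhere, so it divides the monomial, contrary to normality.\<close>
  have large: "card {t\<in>{..<m}. M \<le> g t} \<le> r" if g: "g \<in> G" for g
  proof (rule ccontr)
    assume "\<not> ?thesis"
    then have "card {..<Suc r} \<le> card {t\<in>{..<m}. M \<le> g t}" by simp
    then obtain h where h: "h ` {..<Suc r} \<subseteq> {t\<in>{..<m}. M \<le> g t}" "inj_on h {..<Suc r}"
      using card_le_inj[of "{..<Suc r}" "{t\<in>{..<m}. M \<le> g t}"] by auto
    define h' where "h' = restrict h {..<Suc r}"
    have im: "h' ` {..<Suc r} = h ` {..<Suc r}" by (auto simp: h'_def)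
    have h'H: "h' \<in> H" unfolding H_def h'_def using h by (auto simp: inj_on_def)
    then obtain u where u: "g u < f h' u" using g by (auto simp: G_def)
    then have "u \<in> h' ` {..<Suc r}" using f(1)[OF h'H, of u] by (cases "u \<in> h' ` {..<Suc r}") auto
    then have "M \<le> g u" using im h(1) by auto
    then show False using u f(2)[OF h'H, of u] by simp
  qed
  define S where "S = y ` {..<m}"
  have Sc: "S \<subseteq> carrier A" "finite S" unfolding S_def using C_carrier[OF y_C] by auto
  have bound: "dim (range \<iota>) (Fil S i) \<le> 2 ^ m * (M ^ m * (i * M ^ m + 1) ^ r)" for i
  proof -
    \<comment> \<open>Reduction controls the weight and not the degree. A monomial of degree at most
      \<open>i\<close> has weight at most \<open>i * M ^ m\<close>, and each exponent is bounded by
      the weight.\<close>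
    define B where "B = i * M ^ m"
    let ?G = "{g. (\<forall>t\<ge>m. g t = 0) \<and> (\<forall>t<m. g t \<le> B) \<and> card {t\<in>{..<m}. M \<le> g t} \<le> r}"
    have M1: "1 \<le> M" by (simp add: M_def)
    have fin: "finite ?G" by (rule card_few_large[OF M1])
    have "mval e \<in> subspace_span A (range \<iota>) (mval ` ?G)" if e: "\<forall>t\<ge>m. e t = 0" "(\<Sum>t<m. e t) \<le> i" for e
    proof -
      have "w e \<le> (\<Sum>t<m. e t * M ^ m)"
        unfolding w_def using M1 by (intro sum_mono mult_left_mono power_increasing) auto
      also have "\<dots> = (\<Sum>t<m. e t) * M ^ m" by (simp add: sum_distrib_right)
      also have "\<dots> \<le> B" unfolding B_def using e(2) by (intro mult_right_mono) auto
      finally have we: "w e \<le> B" .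
      have "g t \<le> B" if "g \<in> G" "w g \<le> w e" "t < m" for g t
      proof -
        have "g t * 1 \<le> g t * M ^ t" using M1 by (intro mult_left_mono) auto
        also have "\<dots> \<le> w g" unfolding w_def using that(3) by (intro member_le_sum) auto
        finally show ?thesis using that(2) we by simp
      qed
      then have "{g \<in> G. w g \<le> w e} \<subseteq> ?G" using large by (auto simp: G_def)
      then have "subspace_span A (range \<iota>) (mval ` {g \<in> G. w g \<le> w e}) \<subseteq> subspace_span A (range \<iota>) (mval ` ?G)"
        by (intro subspace_span_mono[OF _ mval_carrier] image_mono)
      then show ?thesis using reduce[OF e(1)] by blast
    qed
    then have "mval ` {e. (\<forall>t\<ge>m. e t = 0) \<and> (\<Sum>t<m. e t) \<le> i} \<subseteq> subspace_span A (range \<iota>) (mval ` ?G)" by blast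
    then have "subspace_span A (range \<iota>) (mval ` {e. (\<forall>t\<ge>m. e t = 0) \<and> (\<Sum>t<m. e t) \<le> i})
        \<subseteq> subspace_span A (range \<iota>) (mval ` ?G)"
      by (rule subspace_span_least[OF subspace_subspace_span[OF mval_carrier]])
    then have "Fil S i \<subseteq> subspace_span A (range \<iota>) (mval ` ?G)"
      using filtration_monomials[of i] unfolding S_def by blast
    then have "dim (range \<iota>) (Fil S i) \<le> card (mval ` ?G)"
      by (intro dim_span_le[OF finite_imageI[OF fin] mval_carrier] subspace_filtration Sc)
    also have "\<dots> \<le> card ?G" by (rule card_image_le[OF fin])
    also have "\<dots> \<le> 2 ^ m * (M ^ m * (B + 1) ^ r)" by (rule card_few_large[OF M1])
    finally show ?thesis unfolding B_def .
  qed
  have "growth_degree (\<lambda>i. dim (range \<iota>) (Fil S i)) \<le> ennreal (real r)"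
  proof (rule growth_degree_leI)
    show "\<forall>\<^sub>F i in sequentially. real (dim (range \<iota>) (Fil S i))
        \<le> (2 ^ m * (M ^ m * (M ^ m + 1) ^ r)) * real i powr real r"
      using eventually_ge_at_top[of 1]
    proof eventually_elim
      case (elim i)
      have "i * M ^ m + 1 \<le> (M ^ m + 1) * i" using elim by (simp add: algebra_simps)
      then have "(i * M ^ m + 1) ^ r \<le> ((M ^ m + 1) * i) ^ r" by (rule power_mono) simp
      then have "dim (range \<iota>) (Fil S i) \<le> 2 ^ m * (M ^ m * ((M ^ m + 1) * i) ^ r)"
        using bound[of i] by (meson mult_le_mono2 order_trans)
      also have "\<dots> = (2 ^ m * (M ^ m * (M ^ m + 1) ^ r)) * i ^ r" by (simp only: power_mult_distrib mult_ac)
      finally have "real (dim (range \<iota>) (Fil S i)) \<le> real ((2 ^ m * (M ^ m * (M ^ m + 1) ^ r)) * i ^ r)"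
        by (rule of_nat_mono)
      then show ?case using elim by (simp add: powr_realpow)
    qed
  qed simp
  moreover have "independent_elements A \<iota> C (\<lambda>t. y (h0 t)) r"
    using h0 commuting_reindex[of h0]
    unfolding independent_at_def independent_elements_def independent_elements_axioms_def by blast
  ultimately show ?thesis using that unfolding S_def by (simp add: ennreal_of_nat_eq_real_of_nat)
qed

end

section \<open>The module over the extended algebra\<close>

locale module_functional = independent_elements A \<iota> C y m
  for A :: "('a, 'b) ring_scheme" (structure) and \<iota> :: "'k::field \<Rightarrow> 'a" and C y m +
  fixes \<phi> :: "'a \<Rightarrow> 'k ratfun"
  assumes \<phi>_closed: "a \<in> carrier A \<Longrightarrow> \<phi> a \<in> Q_field m"
    and \<phi>_one: "\<phi> \<one> = 1"
    and \<phi>_add: "\<lbrakk>a \<in> carrier A; b \<in> carrier A\<rbrakk> \<Longrightarrow> \<phi> (a \<oplus> b) = \<phi> a + \<phi> b"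
    and \<phi>_ev: "\<lbrakk>a \<in> carrier A; p \<in> mpolys m\<rbrakk> \<Longrightarrow> \<phi> (a \<otimes> ev p) = Fract p 1 * \<phi> a"
begin

sublocale T: tensor_product "ratfun_field m" A ratfun_const \<iota>
proof (intro tensor_product.intro tensor_product_axioms.intro)
  show "cring (ratfun_field m :: 'k ratfun ring)" by (rule cring_ratfun_field)
  show "ring A" by (rule ring_axioms)
  show "ratfun_const c \<in> Q_field m" for c :: 'k by (rule Q_field_closed(3))
  show "\<iota> c \<in> carrier A" for c by (rule \<iota>_closed)
  show "\<iota> c \<otimes> a = a \<otimes> \<iota> c" if "a \<in> carrier A" for a c using that by (rule \<iota>_central)
qed

text \<open>\<open>K\<close>-linear functions on \<open>A\<close> with rational function values: the
  ambient space in which the cyclic module generated by \<open>\<phi>\<close> is formed.\<close>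

definition lin :: "('a \<Rightarrow> 'k ratfun) \<Rightarrow> bool" where
  "lin \<psi> \<longleftrightarrow> (\<forall>a\<in>carrier A. \<forall>b\<in>carrier A. \<psi> (a \<oplus> b) = \<psi> a + \<psi> b)
    \<and> (\<forall>c. \<forall>a\<in>carrier A. \<psi> (\<iota> c \<otimes> a) = ratfun_const c * \<psi> a)"

lemma lin_add: "\<lbrakk>lin \<psi>; a \<in> carrier A; b \<in> carrier A\<rbrakk> \<Longrightarrow> \<psi> (a \<oplus> b) = \<psi> a + \<psi> b"
  and lin_scalar: "\<lbrakk>lin \<psi>; a \<in> carrier A\<rbrakk> \<Longrightarrow> \<psi> (\<iota> c \<otimes> a) = ratfun_const c * \<psi> a"
  unfolding lin_def by simp_all

lemma lin_zero:
  assumes "lin \<psi>"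
  shows "\<psi> \<zero> = 0"
proof -
  have "\<psi> \<zero> = \<psi> \<zero> + \<psi> \<zero>"
    using lin_add[OF assms zero_closed zero_closed] unfolding l_zero[OF zero_closed] .
  then show ?thesis by (rule iffD1[OF add_cancel_right_right])
qed

lemma lin_finsum:
  assumes "lin \<psi>" "finite I" "\<And>i. i \<in> I \<Longrightarrow> f i \<in> carrier A"
  shows "\<psi> (\<Oplus>i\<in>I. f i) = (\<Sum>i\<in>I. \<psi> (f i))"
  using assms(2,3)
proof (induction I rule: finite_induct)
  case (insert i I)
  have "f \<in> I \<rightarrow> carrier A" "f i \<in> carrier A" using insert.prems by auto
  then show ?case
    using insert lin_add[OF assms(1), of "f i" "\<Oplus>i\<in>I. f i"] by (simp add: finsum_insert)
qed (simp add: lin_zero[OF assms(1)])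

lemma lin_\<phi>: "lin \<phi>"
proof -
  have "\<phi> (\<iota> c \<otimes> a) = ratfun_const c * \<phi> a" if a: "a \<in> carrier A" for c a
  proof -
    have "\<phi> (\<iota> c \<otimes> a) = \<phi> (a \<otimes> ev (Poly_Mapping.single 0 c))"
      using \<iota>_central[OF a] by (simp add: ev_const)
    also have "\<dots> = ratfun_const c * \<phi> a"
      unfolding ratfun_const_def by (rule \<phi>_ev[OF a mpolys_closed(3)])
    finally show ?thesis .
  qed
  then show ?thesis unfolding lin_def using \<phi>_add by simp
qed

text \<open>A pure tensor of \<open>q\<close> and \<open>a\<close> sends \<open>\<psi>\<close> to
  \<open>b \<mapsto> q * \<psi> (b \<otimes> a)\<close>; multiplying the argument on the right makes
  this a left action. For fixed \<open>\<psi>\<close> and \<open>b\<close> the additive map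
  \<open>H\<close> is chosen once and for all \<open>V\<close>, and on the carrier it is determined
  by its values on pure tensors.\<close>

definition act :: "(('k ratfun \<times> 'a) \<Rightarrow>\<^sub>0 int) set \<Rightarrow> ('a \<Rightarrow> 'k ratfun) \<Rightarrow> 'a \<Rightarrow> 'k ratfun" where
  "act V \<psi> b = (SOME H. (\<forall>q\<in>Q_field m. \<forall>a\<in>carrier A. H (T.pt q a) = q * \<psi> (b \<otimes> a))
    \<and> (\<forall>V\<in>carrier T.B. \<forall>W\<in>carrier T.B. H (V \<oplus>\<^bsub>T.B\<^esub> W) = H V + H W)) V"

lemma
  assumes \<psi>: "lin \<psi>" and b: "b \<in> carrier A"
  shows act_pt: "\<lbrakk>q \<in> Q_field m; a \<in> carrier A\<rbrakk> \<Longrightarrow> act (T.pt q a) \<psi> b = q * \<psi> (b \<otimes> a)"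
    and act_add: "\<lbrakk>V \<in> carrier T.B; W \<in> carrier T.B\<rbrakk> \<Longrightarrow> act (V \<oplus>\<^bsub>T.B\<^esub> W) \<psi> b = act V \<psi> b + act W \<psi> b"
proof -
  let ?P = "\<lambda>H. (\<forall>q\<in>Q_field m. \<forall>a\<in>carrier A. H (T.pt q a) = q * \<psi> (b \<otimes> a))
    \<and> (\<forall>V\<in>carrier T.B. \<forall>W\<in>carrier T.B. H (V \<oplus>\<^bsub>T.B\<^esub> W) = H V + H W)"
  have "\<exists>H. ?P H"
  proof (rule T.tensor_lift)
    show "(s \<oplus>\<^bsub>ratfun_field m\<^esub> t) * \<psi> (b \<otimes> a) = s * \<psi> (b \<otimes> a) + t * \<psi> (b \<otimes> a)" for s t a
      by (simp add: ratfun_field_simps(2-) distrib_right)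
    show "s * \<psi> (b \<otimes> (a \<oplus> a')) = s * \<psi> (b \<otimes> a) + s * \<psi> (b \<otimes> a')"
      if "a \<in> carrier A" "a' \<in> carrier A" for s a a'
      using that b lin_add[OF \<psi>] by (simp add: r_distr distrib_left)
    show "(s \<otimes>\<^bsub>ratfun_field m\<^esub> ratfun_const c) * \<psi> (b \<otimes> a) = s * \<psi> (b \<otimes> (\<iota> c \<otimes> a))"
      if a: "a \<in> carrier A" for s c a
    proof -
      have "b \<otimes> (\<iota> c \<otimes> a) = (b \<otimes> \<iota> c) \<otimes> a" using a b by (simp add: m_assoc)
      also have "b \<otimes> \<iota> c = \<iota> c \<otimes> b" using \<iota>_central[OF b] by simp
      finally have "b \<otimes> (\<iota> c \<otimes> a) = \<iota> c \<otimes> (b \<otimes> a)" using a b by (simp add: m_assoc)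
      then show ?thesis using a b lin_scalar[OF \<psi>] by (simp add: ratfun_field_simps(2-))
    qed
  qed
  then have P: "?P (\<lambda>V. act V \<psi> b)" unfolding act_def by (rule someI_ex)
  show "act (T.pt q a) \<psi> b = q * \<psi> (b \<otimes> a)" if "q \<in> Q_field m" "a \<in> carrier A"
    using P that by blast
  show "act (V \<oplus>\<^bsub>T.B\<^esub> W) \<psi> b = act V \<psi> b + act W \<psi> b" if "V \<in> carrier T.B" "W \<in> carrier T.B"
    using P that by blast
qed

lemma act_zero:
  assumes "lin \<psi>" "b \<in> carrier A"
  shows "act \<zero>\<^bsub>T.B\<^esub> \<psi> b = 0"
proof -
  have "act \<zero>\<^bsub>T.B\<^esub> \<psi> b = act \<zero>\<^bsub>T.B\<^esub> \<psi> b + act \<zero>\<^bsub>T.B\<^esub> \<psi> b"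
    using act_add[OF assms T.B.zero_closed T.B.zero_closed] unfolding T.B.l_zero[OF T.B.zero_closed] .
  then show ?thesis by (rule iffD1[OF add_cancel_right_right])
qed

lemma lin_act:
  assumes "V \<in> carrier T.B" "lin \<psi>"
  shows "lin (act V \<psi>)"
  using assms(1)
proof (induction V rule: T.tensor_induct)
  case zero
  then show ?case unfolding lin_def by (simp add: act_zero[OF assms(2)])
next
  case (pt q a)
  have "\<iota> c \<otimes> b \<otimes> a = \<iota> c \<otimes> (b \<otimes> a)" if "b \<in> carrier A" for b c using that pt by (simp add: m_assoc)
  then show ?case unfolding lin_def
    using pt by (simp add: act_pt[OF assms(2)] l_distr lin_add[OF assms(2)] lin_scalar[OF assms(2)] distrib_left)
next
  case (add V W)
  then show ?case unfolding lin_def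
    by (simp add: act_add[OF assms(2)] distrib_left)
qed

lemma act_mult:
  assumes V: "V \<in> carrier T.B" and W: "W \<in> carrier T.B" and \<psi>: "lin \<psi>"
  shows "b \<in> carrier A \<Longrightarrow> act (V \<otimes>\<^bsub>T.B\<^esub> W) \<psi> b = act V (act W \<psi>) b"
  using V
proof (induction V rule: T.tensor_induct)
  case zero
  then show ?case using W act_zero[OF \<psi>] act_zero[OF lin_act[OF W \<psi>]] by simp
next
  case (pt q a)
  from W show ?case
  proof (induction W rule: T.tensor_induct)
    case zero
    then show ?case using pt act_zero[OF \<psi>] act_pt[OF lin_act[OF T.B.zero_closed \<psi>]] by simp
  next
    case (pt t c)
    then show ?case
      using \<open>q \<in> Q_field m\<close> \<open>a \<in> carrier A\<close> \<open>b \<in> carrier A\<close> Q_field_closed(5)[of q m t]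
      by (simp add: T.pt_mult act_pt[OF \<psi>] act_pt[OF lin_act[OF T.pt_closed \<psi>]] ratfun_field_simps(2-) m_assoc)
  next
    case (add V W)
    then show ?case
      using \<open>q \<in> Q_field m\<close> \<open>a \<in> carrier A\<close> \<open>b \<in> carrier A\<close>
      by (simp add: T.B.r_distr act_add[OF \<psi>] act_pt[OF lin_act[OF _ \<psi>]] distrib_left)
  qed
next
  case (add V V')
  then show ?case
    using W by (simp add: T.B.l_distr act_add[OF \<psi>] act_add[OF lin_act[OF W \<psi>]])
qed

text \<open>Functions are controlled on the carrier of \<open>A\<close> only, so being the zero
  vector of the module means vanishing there.\<close>

lemma act_vanish:
  assumes "V \<in> carrier T.B" "lin \<chi>" "\<And>b. b \<in> carrier A \<Longrightarrow> \<chi> b = 0"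
  shows "b \<in> carrier A \<Longrightarrow> act V \<chi> b = 0"
  using assms(1)
  by (induction V rule: T.tensor_induct) (simp_all add: act_zero act_pt act_add assms(2,3))

section \<open>The extended algebra, its scalars and the embedding of \<open>A\<close>\<close>

abbreviation "emb \<equiv> T.pt 1"

abbreviation "Qs \<equiv> ratfun_scalars m A \<iota>"

lemma Qs_def': "Qs = (\<lambda>q. T.pt q \<one>) ` Q_field m"
  by (simp add: ratfun_scalars_def)

lemma QsI: "q \<in> Q_field m \<Longrightarrow> T.pt q \<one> \<in> Qs"
  by (simp add: Qs_def')

lemma emb_one: "emb \<one> = \<one>\<^bsub>T.B\<^esub>"
  by (simp add: T.pt_one ratfun_field_simps(2-))

lemma emb_closed: "a \<in> carrier A \<Longrightarrow> emb a \<in> carrier T.B"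
  by (rule T.pt_closed[OF Q_field_closed(2)])

lemma emb_add: "\<lbrakk>a \<in> carrier A; b \<in> carrier A\<rbrakk> \<Longrightarrow> emb (a \<oplus> b) = emb a \<oplus>\<^bsub>T.B\<^esub> emb b"
  by (rule T.pt_add_right[OF Q_field_closed(2)])

lemma emb_mult: "\<lbrakk>a \<in> carrier A; b \<in> carrier A\<rbrakk> \<Longrightarrow> emb (a \<otimes> b) = emb a \<otimes>\<^bsub>T.B\<^esub> emb b"
  using T.pt_mult[OF Q_field_closed(2) _ Q_field_closed(2), of a b] by (simp add: ratfun_field_simps(2-))

lemma pt_eq_scalar_mult:
  assumes "q \<in> Q_field m" "a \<in> carrier A"
  shows "T.pt q a = T.pt q \<one> \<otimes>\<^bsub>T.B\<^esub> emb a"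
  using T.pt_mult[OF assms(1) one_closed Q_field_closed(2) assms(2)] assms by (simp add: ratfun_field_simps(2-))

lemma emb_scalar: "emb (\<iota> c) = T.pt (ratfun_const c) \<one>"
  using T.pt_scalar[OF Q_field_closed(2) one_closed, of c] by (simp add: ratfun_field_simps(2-))

lemma pt_zero: "a \<in> carrier A \<Longrightarrow> T.pt 0 a = \<zero>\<^bsub>T.B\<^esub>"
  using T.pt_zero_left[of a] by (simp add: ratfun_field_simps(2-))

lemma pt_add: "\<lbrakk>q \<in> Q_field m; r \<in> Q_field m; a \<in> carrier A\<rbrakk> \<Longrightarrow> T.pt (q + r) a = T.pt q a \<oplus>\<^bsub>T.B\<^esub> T.pt r a"
  using T.pt_add_left[of q r a] by (simp add: ratfun_field_simps(2-))

lemma pt_mult: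
  "\<lbrakk>q \<in> Q_field m; r \<in> Q_field m; a \<in> carrier A; b \<in> carrier A\<rbrakk> \<Longrightarrow>
    T.pt q a \<otimes>\<^bsub>T.B\<^esub> T.pt r b = T.pt (q * r) (a \<otimes> b)"
  using T.pt_mult[of q a r b] by (simp add: ratfun_field_simps(2-))

text \<open>The action detects it: the unit sends \<open>\<phi>\<close> to a function with value
  \<open>1\<close> at \<open>\<one>\<close>, whereas zero acts as zero.\<close>

lemma B_one_neq_zero: "\<one>\<^bsub>T.B\<^esub> \<noteq> \<zero>\<^bsub>T.B\<^esub>"
proof
  assume "\<one>\<^bsub>T.B\<^esub> = \<zero>\<^bsub>T.B\<^esub>"
  then have "act (emb \<one>) \<phi> \<one> = 0" using act_zero[OF lin_\<phi>] by (simp add: emb_one)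
  then show False by (simp add: act_pt[OF lin_\<phi>] Q_field_closed \<phi>_one)
qed

lemma pt_inverse:
  assumes "q \<in> Q_field m" "q \<noteq> 0"
  shows "T.pt (inverse q) \<one> \<otimes>\<^bsub>T.B\<^esub> T.pt q \<one> = \<one>\<^bsub>T.B\<^esub>" "T.pt q \<one> \<otimes>\<^bsub>T.B\<^esub> T.pt (inverse q) \<one> = \<one>\<^bsub>T.B\<^esub>"
  using pt_mult[OF assms(1) Q_field_closed(7)[OF assms(1)], of \<one> \<one>]
    pt_mult[OF Q_field_closed(7)[OF assms(1)] assms(1), of \<one> \<one>] assms(2)
  by (simp_all add: emb_one)

lemma pt_neq_zero:
  assumes "q \<in> Q_field m" "q \<noteq> 0"
  shows "T.pt q \<one> \<noteq> \<zero>\<^bsub>T.B\<^esub>"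
proof
  assume "T.pt q \<one> = \<zero>\<^bsub>T.B\<^esub>"
  then have "\<one>\<^bsub>T.B\<^esub> = \<zero>\<^bsub>T.B\<^esub>"
    using pt_inverse(1)[OF assms] T.pt_closed[OF Q_field_closed(7)[OF assms(1)] one_closed] by simp
  then show False using B_one_neq_zero by simp
qed

lemma subfield_Qs: "subfield Qs T.B"
proof (rule T.B.subfieldI)
  have c: "Qs \<subseteq> carrier T.B" unfolding Qs_def' by (auto intro: T.pt_closed)
  have m: "x \<otimes>\<^bsub>T.B\<^esub> x' = x' \<otimes>\<^bsub>T.B\<^esub> x \<and> x \<otimes>\<^bsub>T.B\<^esub> x' \<in> Qs \<and> x \<oplus>\<^bsub>T.B\<^esub> x' \<in> Qs \<and> \<ominus>\<^bsub>T.B\<^esub> x \<in> Qs"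
    if xx: "x \<in> Qs" "x' \<in> Qs" for x x'
  proof -
    obtain q r where q: "q \<in> Q_field m" "x = T.pt q \<one>" and r: "r \<in> Q_field m" "x' = T.pt r \<one>"
      using xx unfolding Qs_def' by auto
    have "T.pt (- q) \<one> \<oplus>\<^bsub>T.B\<^esub> T.pt q \<one> = \<zero>\<^bsub>T.B\<^esub>"
      using pt_add[OF Q_field_closed(6)[OF q(1)] q(1) one_closed] by (simp add: pt_zero)
    then have "\<ominus>\<^bsub>T.B\<^esub> T.pt q \<one> = T.pt (- q) \<one>"
      using q(1) Q_field_closed(6)[OF q(1)] by (intro T.B.minus_equality) auto
    moreover have "T.pt q \<one> \<otimes>\<^bsub>T.B\<^esub> T.pt r \<one> = T.pt (q * r) \<one>"
      "T.pt r \<one> \<otimes>\<^bsub>T.B\<^esub> T.pt q \<one> = T.pt (q * r) \<one>"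
      using pt_mult[OF q(1) r(1), of \<one> \<one>] pt_mult[OF r(1) q(1), of \<one> \<one>] by (simp_all add: mult.commute)
    moreover have "T.pt q \<one> \<oplus>\<^bsub>T.B\<^esub> T.pt r \<one> = T.pt (q + r) \<one>"
      using pt_add[OF q(1) r(1) one_closed] by simp
    ultimately show ?thesis
      unfolding q(2) r(2) using q(1) r(1) by (simp add: QsI Q_field_closed)
  qed
  have one: "\<one>\<^bsub>T.B\<^esub> \<in> Qs" using QsI[OF Q_field_closed(2)] by (simp add: emb_one)
  have "subring Qs T.B" by (rule T.B.subringI) (use c m one in simp_all)
  then show "subcring Qs T.B" by (rule T.B.subcringI) (use m in simp)
  show "Units (T.B\<lparr>carrier := Qs\<rparr>) = Qs - {\<zero>\<^bsub>T.B\<^esub>}"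
  proof (rule subset_antisym)
    show "Units (T.B\<lparr>carrier := Qs\<rparr>) \<subseteq> Qs - {\<zero>\<^bsub>T.B\<^esub>}"
    proof
      fix x assume "x \<in> Units (T.B\<lparr>carrier := Qs\<rparr>)"
      then obtain x' where x: "x \<in> Qs" "x' \<in> Qs" "x' \<otimes>\<^bsub>T.B\<^esub> x = \<one>\<^bsub>T.B\<^esub>" unfolding Units_def by auto
      have "x \<noteq> \<zero>\<^bsub>T.B\<^esub>"
      proof
        assume "x = \<zero>\<^bsub>T.B\<^esub>"
        then have "x' \<otimes>\<^bsub>T.B\<^esub> \<zero>\<^bsub>T.B\<^esub> = \<one>\<^bsub>T.B\<^esub>" using x(3) by simp
        then show False using T.B.r_null[OF subsetD[OF c x(2)]] B_one_neq_zero by simp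
      qed
      then show "x \<in> Qs - {\<zero>\<^bsub>T.B\<^esub>}" using x(1) by simp
    qed
    show "Qs - {\<zero>\<^bsub>T.B\<^esub>} \<subseteq> Units (T.B\<lparr>carrier := Qs\<rparr>)"
    proof
      fix x assume x: "x \<in> Qs - {\<zero>\<^bsub>T.B\<^esub>}"
      then obtain q where q: "q \<in> Q_field m" "x = T.pt q \<one>" unfolding Qs_def' by auto
      have "q \<noteq> 0" using x q pt_zero[OF one_closed] by auto
      then have "\<exists>x'\<in>Qs. x' \<otimes>\<^bsub>T.B\<^esub> x = \<one>\<^bsub>T.B\<^esub> \<and> x \<otimes>\<^bsub>T.B\<^esub> x' = \<one>\<^bsub>T.B\<^esub>"
        using pt_inverse[OF q(1)] QsI[OF Q_field_closed(7)[OF q(1)]] q(2) by blast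
      then show "x \<in> Units (T.B\<lparr>carrier := Qs\<rparr>)" using x unfolding Units_def by simp
    qed
  qed
qed

sublocale BB: central_algebra T.B Qs
proof (intro central_algebra.intro central_algebra_axioms.intro)
  show "ring T.B" by (rule T.B.ring_axioms)
  show "subfield Qs T.B" by (rule subfield_Qs)
  fix c x assume c: "c \<in> Qs" and x: "x \<in> carrier T.B"
  obtain q where q: "q \<in> Q_field m" "c = T.pt q \<one>" using c unfolding Qs_def' by auto
  have qc: "T.pt q \<one> \<in> carrier T.B" using q(1) by simp
  from x show "c \<otimes>\<^bsub>T.B\<^esub> x = x \<otimes>\<^bsub>T.B\<^esub> c"
  proof (induction x rule: T.tensor_induct)
    case zero
    then show ?case using qc q(2) by simp
  next
    case (pt r a)
    then show ?case unfolding q(2) using pt_mult[OF q(1) pt(1) one_closed pt(2)]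
        pt_mult[OF pt(1) q(1) pt(2) one_closed] by (simp add: mult.commute)
  next
    case (add V W)
    then show ?case using qc q(2) by (simp add: T.B.l_distr T.B.r_distr)
  qed
qed

lemma generate_extension:
  assumes S: "S \<subseteq> carrier A" "generate_ring A (range \<iota> \<union> S) = carrier A"
  shows "generate_ring T.B (Qs \<union> emb ` S) = carrier T.B"
proof (rule subset_antisym)
  let ?G = "generate_ring T.B (Qs \<union> emb ` S)"
  have QS: "Qs \<union> emb ` S \<subseteq> carrier T.B"
    using BB.scalars_in_carrier S(1) emb_closed by auto
  show "?G \<subseteq> carrier T.B" by (rule T.B.generate_ring_incl[OF QS])
  have "emb a \<in> ?G" if "a \<in> generate_ring A (range \<iota> \<union> S)" for a
    using that
  proof (induction rule: generate_ring.induct)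
    case one
    then show ?case by (simp add: emb_one generate_ring.one)
  next
    case (incl h)
    then show ?case
      using QsI[OF Q_field_closed(3)] by (auto simp: emb_scalar intro!: generate_ring.incl)
  next
    case (a_inv h)
    have h: "h \<in> carrier A" using a_inv.hyps S(2) by simp
    have "emb (\<ominus> h) \<oplus>\<^bsub>T.B\<^esub> emb h = \<zero>\<^bsub>T.B\<^esub>"
      using emb_add[of "\<ominus> h" h] h T.pt_zero_right[OF Q_field_closed(2)] by (simp add: l_neg)
    then have "emb (\<ominus> h) = \<ominus>\<^bsub>T.B\<^esub> emb h"
      using h emb_closed by (intro T.B.minus_equality[symmetric]) simp_all
    then show ?case using a_inv.IH generate_ring.a_inv by simp
  next
    case (eng_add h1 h2)
    then show ?case using S(2) emb_add generate_ring.eng_add by simp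
  next
    case (eng_mult h1 h2)
    then show ?case using S(2) emb_mult generate_ring.eng_mult by simp
  qed
  then have emb: "emb a \<in> ?G" if "a \<in> carrier A" for a using that S(2) by simp
  show "carrier T.B \<subseteq> ?G"
  proof
    fix V assume "V \<in> carrier T.B"
    then show "V \<in> ?G"
    proof (induction V rule: T.tensor_induct)
      case zero
      then show ?case by (rule T.B.zero_in_generate)
    next
      case (pt q a)
      have "T.pt q \<one> \<in> ?G" using QsI[OF pt(1)] by (intro generate_ring.incl) simp
      then show ?case
        unfolding pt_eq_scalar_mult[OF pt] using emb[OF pt(2)] by (rule generate_ring.eng_mult)
    next
      case (add V W)
      then show ?case by (intro generate_ring.eng_add)
    qed
  qed
qed

lemma subspace_emb_vimage:
  assumes "subalgebra Qs E T.B"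
  shows "subalgebra (range \<iota>) {a \<in> carrier A. emb a \<in> E} A"
proof (rule subspaceI)
  note E = BB.subspaceD[OF assms]
  show "\<zero> \<in> {a \<in> carrier A. emb a \<in> E}" using E(2) T.pt_zero_right[OF Q_field_closed(2)] by simp
  show "x \<oplus> z \<in> {a \<in> carrier A. emb a \<in> E}"
    if "x \<in> {a \<in> carrier A. emb a \<in> E}" "z \<in> {a \<in> carrier A. emb a \<in> E}" for x z
    using that E(3) emb_add by simp
  show "c \<otimes> x \<in> {a \<in> carrier A. emb a \<in> E}"
    if c: "c \<in> range \<iota>" and x: "x \<in> {a \<in> carrier A. emb a \<in> E}" for c x
  proof -
    obtain d where d: "c = \<iota> d" using c by auto
    have "emb (c \<otimes> x) = T.pt (ratfun_const d) \<one> \<otimes>\<^bsub>T.B\<^esub> emb x"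
      using x d emb_mult[of "\<iota> d" x] by (simp add: emb_scalar)
    also have "\<dots> \<in> E" using x by (intro E(4) QsI Q_field_closed) simp
    finally show ?thesis using x d by simp
  qed
qed auto

lemma emb_filtration:
  assumes S: "S \<subseteq> carrier A"
  shows "a \<in> Fil S i \<Longrightarrow> emb a \<in> BB.Fil (emb ` S) i"
proof (induction i arbitrary: a)
  case 0
  then show ?case using QsI[OF Q_field_closed(3)] by (auto simp: emb_scalar)
next
  case (Suc i)
  have eS: "emb ` S \<subseteq> carrier T.B" using S emb_closed by auto
  have eS1: "insert \<one>\<^bsub>T.B\<^esub> (emb ` S) \<subseteq> carrier T.B" using eS by simp
  let ?G = "subspace_span A (range \<iota>) (insert \<one> S)"
  have S1: "insert \<one> S \<subseteq> carrier A" using S by simp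
  have G: "emb g \<in> subspace_span T.B Qs (insert \<one>\<^bsub>T.B\<^esub> (emb ` S))" if "g \<in> ?G" for g
  proof -
    have "insert \<one> S \<subseteq> {a \<in> carrier A. emb a \<in> subspace_span T.B Qs (insert \<one>\<^bsub>T.B\<^esub> (emb ` S))}"
      using BB.subspace_span_superset[OF eS1] S by (auto simp: emb_one)
    then have "?G \<subseteq> {a \<in> carrier A. emb a \<in> subspace_span T.B Qs (insert \<one>\<^bsub>T.B\<^esub> (emb ` S))}"
      by (rule subspace_span_least[OF subspace_emb_vimage[OF BB.subspace_subspace_span[OF eS1]]])
    then show ?thesis using that by auto
  qed
  let ?E = "{a \<in> carrier A. emb a \<in> BB.Fil (emb ` S) (Suc i)}"
  have "x \<otimes> g \<in> ?E" if xg: "x \<in> Fil S i" "g \<in> ?G" for x g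
  proof -
    have c: "x \<in> carrier A" "g \<in> carrier A"
      using xg filtration_carrier[OF S] subspace_span_carrier[OF S1] by auto
    have "emb x \<otimes>\<^bsub>T.B\<^esub> emb g \<in> BB.Fil (emb ` S) (Suc i)"
      by (rule BB.filtration_mult_generator[OF eS Suc.IH[OF xg(1)] G[OF xg(2)]])
    then show ?thesis using c emb_mult[OF c] by (simp del: standard_filtration.simps)
  qed
  then have "{x \<otimes> g |x g. x \<in> Fil S i \<and> g \<in> ?G} \<subseteq> ?E" by blast
  then have "Fil S (Suc i) \<subseteq> ?E"
    unfolding standard_filtration.simps(2)[of A "range \<iota>" S i]
    by (rule subspace_span_least[OF subspace_emb_vimage[OF BB.subspace_filtration[OF eS]]])
  then show ?case using Suc.prems by blast
qed

text \<open>Scalars from \<open>Qs\<close> are central and can be collected in front of any product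
  of generators, leaving a product formed in \<open>A\<close>.\<close>

lemma filtration_extension:
  assumes S: "S \<subseteq> carrier A"
  shows "BB.Fil (emb ` S) i \<subseteq> subspace_span T.B Qs (emb ` Fil S i)"
proof (induction i)
  case 0
  have c: "emb ` range \<iota> \<subseteq> carrier T.B" using emb_closed by auto
  show ?case
    unfolding standard_filtration.simps(1)
  proof
    fix x assume x: "x \<in> Qs"
    have "emb \<one> \<in> emb ` range \<iota>" using one_in_scalars by (rule imageI)
    then have "\<one>\<^bsub>T.B\<^esub> \<in> subspace_span T.B Qs (emb ` range \<iota>)"
      using BB.subspace_span_superset[OF c] emb_one by auto
    then have "x \<otimes>\<^bsub>T.B\<^esub> \<one>\<^bsub>T.B\<^esub> \<in> subspace_span T.B Qs (emb ` range \<iota>)"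
      by (rule BB.subspaceD(4)[OF BB.subspace_subspace_span[OF c] x])
    moreover have "x \<in> carrier T.B" using x BB.scalars_in_carrier by blast
    ultimately show "x \<in> subspace_span T.B Qs (emb ` range \<iota>)" by simp
  qed
next
  case (Suc i)
  have c: "emb ` Fil S j \<subseteq> carrier T.B" for j using filtration_carrier[OF S] emb_closed by (meson image_subsetI subsetD)
  have eS1: "insert \<one>\<^bsub>T.B\<^esub> (emb ` S) \<subseteq> carrier T.B" using S emb_closed by auto
  let ?E = "subspace_span T.B Qs (emb ` Fil S (Suc i))"
  have S1: "insert \<one> S \<subseteq> carrier A" using S by simp
  have prod: "v \<otimes>\<^bsub>T.B\<^esub> w \<in> ?E" if v: "v \<in> emb ` Fil S i" and w: "w \<in> insert \<one>\<^bsub>T.B\<^esub> (emb ` S)" for v w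
  proof -
    obtain a where a: "v = emb a" "a \<in> Fil S i" using v by blast
    obtain g where g: "w = emb g" "g \<in> insert \<one> S" using w emb_one by auto
    have "a \<otimes> g \<in> Fil S (Suc i)"
      using a(2) subsetD[OF subspace_span_superset[OF S1] g(2)] by (rule filtration_mult_generator[OF S])
    then have "emb (a \<otimes> g) \<in> ?E" by (rule subsetD[OF BB.subspace_span_superset[OF c] imageI])
    moreover have "a \<in> carrier A" "g \<in> carrier A" using a(2) g(2) filtration_carrier[OF S] S1 by auto
    ultimately show ?thesis using a(1) g(1) emb_mult by simp
  qed
  have "x \<otimes>\<^bsub>T.B\<^esub> g \<in> ?E"
    if x: "x \<in> BB.Fil (emb ` S) i" and g: "g \<in> subspace_span T.B Qs (insert \<one>\<^bsub>T.B\<^esub> (emb ` S))" for x g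
    by (rule BB.span_mult_span[OF BB.subspace_subspace_span[OF c] c eS1 prod subsetD[OF Suc x] g])
  then have "{x \<otimes>\<^bsub>T.B\<^esub> g |x g. x \<in> BB.Fil (emb ` S) i \<and> g \<in> subspace_span T.B Qs (insert \<one>\<^bsub>T.B\<^esub> (emb ` S))} \<subseteq> ?E"
    by blast
  then show ?case
    unfolding standard_filtration.simps(2)[of T.B Qs "emb ` S" i]
    by (rule BB.subspace_span_least[OF BB.subspace_subspace_span[OF c]])
qed

text \<open>The lift is the identity on the scalars tensored with \<open>T\<close>: every multiplier
  \<open>x\<close> is replaced by \<open>emb x\<close>.\<close>

lemma mult_op_lift:
  assumes "T \<in> mult_ops A"
  shows "\<exists>T'\<in>mult_ops T.B. \<forall>q\<in>Q_field m. \<forall>a\<in>carrier A. T' (T.pt q a) = T.pt q (T a)"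
  using assms
proof (induction rule: mult_ops.induct)
  case ident
  show ?case by (rule bexI[of _ "\<lambda>z. z"]) (simp_all add: mult_ops.ident)
next
  case (add T U)
  then obtain T' U' where T': "T' \<in> mult_ops T.B" "\<And>q a. \<lbrakk>q \<in> Q_field m; a \<in> carrier A\<rbrakk> \<Longrightarrow> T' (T.pt q a) = T.pt q (T a)"
    and U': "U' \<in> mult_ops T.B" "\<And>q a. \<lbrakk>q \<in> Q_field m; a \<in> carrier A\<rbrakk> \<Longrightarrow> U' (T.pt q a) = T.pt q (U a)" by blast
  show ?case
  proof (intro bexI[of _ "\<lambda>z. T' z \<oplus>\<^bsub>T.B\<^esub> U' z"] ballI)
    show "T' (T.pt q a) \<oplus>\<^bsub>T.B\<^esub> U' (T.pt q a) = T.pt q (T a \<oplus> U a)" if "q \<in> Q_field m" "a \<in> carrier A" for q a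
      using that T.pt_add_right[OF that(1), of "T a" "U a"] T'(2) U'(2) add.hyps by simp
  qed (rule mult_ops.add[OF T'(1) U'(1)])
next
  case (lmult x T)
  then obtain T' where T': "T' \<in> mult_ops T.B" "\<And>q a. \<lbrakk>q \<in> Q_field m; a \<in> carrier A\<rbrakk> \<Longrightarrow> T' (T.pt q a) = T.pt q (T a)" by blast
  show ?case
  proof (intro bexI[of _ "\<lambda>z. emb x \<otimes>\<^bsub>T.B\<^esub> T' z"] ballI)
    show "emb x \<otimes>\<^bsub>T.B\<^esub> T' (T.pt q a) = T.pt q (x \<otimes> T a)" if "q \<in> Q_field m" "a \<in> carrier A" for q a
      using that T'(2) lmult.hyps pt_mult[OF Q_field_closed(2) that(1), of x "T a"] by simp
  qed (rule mult_ops.lmult[OF emb_closed[OF lmult.hyps(1)] T'(1)])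
next
  case (rmult x T)
  then obtain T' where T': "T' \<in> mult_ops T.B" "\<And>q a. \<lbrakk>q \<in> Q_field m; a \<in> carrier A\<rbrakk> \<Longrightarrow> T' (T.pt q a) = T.pt q (T a)" by blast
  show ?case
  proof (intro bexI[of _ "\<lambda>z. T' z \<otimes>\<^bsub>T.B\<^esub> emb x"] ballI)
    show "T' (T.pt q a) \<otimes>\<^bsub>T.B\<^esub> emb x = T.pt q (T a \<otimes> x)" if "q \<in> Q_field m" "a \<in> carrier A" for q a
      using that T'(2) rmult.hyps pt_mult[OF that(1) Q_field_closed(2), of "T a" x] by simp
  qed (rule mult_ops.rmult[OF emb_closed[OF rmult.hyps(1)] T'(1)])
qed

text \<open>The operator reads off the \<open>s\<close>-th coefficient and does not depend on
  \<open>q\<close>. This single fact yields the uniform return bound, and also that elements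
  independent over \<open>K\<close> stay independent over the rational functions.\<close>

lemma mult_op_lift_separate:
  assumes simple: "simple_ring A" and centre: "ring_centre A = range \<iota>"
    and I: "finite I" "lin_indep f I" "f \<in> I \<rightarrow> carrier A" "s \<in> I"
  shows "\<exists>T'\<in>mult_ops T.B. \<forall>q\<in>I \<rightarrow> Q_field m. T' (\<Oplus>\<^bsub>T.B\<^esub>t\<in>I. T.pt (q t) (f t)) = T.pt (q s) \<one>"
proof -
  obtain T where T: "T \<in> mult_ops A" "\<And>t. t \<in> I \<Longrightarrow> T (f t) = (if t = s then \<one> else \<zero>)"
    using mult_ops_separate[OF simple centre I] by blast
  obtain T' where T': "T' \<in> mult_ops T.B"
      "\<And>q a. \<lbrakk>q \<in> Q_field m; a \<in> carrier A\<rbrakk> \<Longrightarrow> T' (T.pt q a) = T.pt q (T a)"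
    using mult_op_lift[OF T(1)] by blast
  have "T' (\<Oplus>\<^bsub>T.B\<^esub>t\<in>I. T.pt (q t) (f t)) = T.pt (q s) \<one>" if q: "q \<in> I \<rightarrow> Q_field m" for q
  proof -
    have qt: "q t \<in> Q_field m" "f t \<in> carrier A" if "t \<in> I" for t using q I(3) that by auto
    have "T' (\<Oplus>\<^bsub>T.B\<^esub>t\<in>I. T.pt (q t) (f t)) = (\<Oplus>\<^bsub>T.B\<^esub>t\<in>I. T' (T.pt (q t) (f t)))"
      using qt by (intro T.B.mult_ops_finsum[OF T'(1)]) auto
    also have "\<dots> = (\<Oplus>\<^bsub>T.B\<^esub>t\<in>I. if s = t then T.pt (q t) \<one> else \<zero>\<^bsub>T.B\<^esub>)"
      using qt T(2) T'(2) T.pt_zero_right by (intro T.B.finsum_cong') auto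
    also have "\<dots> = T.pt (q s) \<one>"
      using qt by (intro T.B.add.finprod_singleton[OF I(4,1)]) auto
    finally show ?thesis .
  qed
  then show ?thesis using T'(1) by blast
qed

end

section \<open>Filtrations of \<open>A\<close> and of the extended algebra, and return
  functions\<close>

locale extended_algebra = module_functional A \<iota> C y m \<phi>
  for A :: "('a, 'b) ring_scheme" (structure) and \<iota> :: "'k::field \<Rightarrow> 'a" and C y m \<phi> +
  fixes S0 :: "'a set" and S1 :: "(('k ratfun \<times> 'a) \<Rightarrow>\<^sub>0 int) set set"
  assumes simple: "simple_ring A" and centre: "ring_centre A = range \<iota>"
    and S0: "S0 \<subseteq> carrier A" "finite S0" "generate_ring A (range \<iota> \<union> S0) = carrier A"
    and S1: "S1 \<subseteq> carrier T.B" "finite S1" "generate_ring T.B (Qs \<union> S1) = carrier T.B"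
begin

abbreviation "F0 \<equiv> Fil S0"
abbreviation "F1 \<equiv> BB.Fil S1"
abbreviation "spanB \<equiv> subspace_span T.B Qs"

lemma F0_carrier: "a \<in> F0 i \<Longrightarrow> a \<in> carrier A"
  using filtration_carrier[OF S0(1), of i] by (rule subsetD)

lemma F1_carrier: "V \<in> F1 i \<Longrightarrow> V \<in> carrier T.B"
  using BB.filtration_carrier[OF S1(1), of i] by (rule subsetD)

lemma pt_in_F1: "\<exists>c>0. \<forall>i. \<forall>q\<in>Q_field m. \<forall>a\<in>F0 i. T.pt q a \<in> F1 (c * i)"
proof -
  have eS: "emb ` S0 \<subseteq> carrier T.B"
    by (rule image_subsetI, rule emb_closed, rule subsetD[OF S0(1)])
  obtain c where c: "emb ` S0 \<subseteq> F1 c"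
    using BB.finite_filtration_bound[OF S1(1) finite_imageI[OF S0(2)], of emb] eS S1(3) by auto
  \<comment> \<open>The successor makes the factor positive, so that multiples of it tend to
    infinity.\<close>
  have c': "emb ` S0 \<subseteq> F1 (Suc c)" using c BB.filtration_Suc[OF S1(1), of c] by (rule subset_trans)
  have "T.pt q a \<in> F1 (Suc c * i)" if q: "q \<in> Q_field m" and a: "a \<in> F0 i" for i q a
  proof -
    have "emb a \<in> F1 (Suc c * i)"
      by (rule subsetD[OF BB.filtration_change_generators[OF eS S1(1) c'] emb_filtration[OF S0(1) a]])
    then show ?thesis
      unfolding pt_eq_scalar_mult[OF q F0_carrier[OF a]]
      by (rule BB.subspaceD(4)[OF BB.subspace_filtration[OF S1(1)] QsI[OF q]])
  qed
  then show ?thesis by (intro exI[of _ "Suc c"] conjI allI ballI) simp_all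
qed

lemma F1_in_span: "\<exists>e. \<forall>j. F1 j \<subseteq> spanB (emb ` F0 (e * j))"
proof -
  have eS: "emb ` S0 \<subseteq> carrier T.B"
    by (rule image_subsetI, rule emb_closed, rule subsetD[OF S0(1)])
  have "S1 \<subseteq> generate_ring T.B (Qs \<union> emb ` S0)"
    using S1(1) generate_extension[OF S0(1,3)] by simp
  then obtain e where e: "S1 \<subseteq> BB.Fil (emb ` S0) e"
    using BB.finite_filtration_bound[OF eS S1(2)] by auto
  have "F1 j \<subseteq> spanB (emb ` F0 (e * j))" for j
    using BB.filtration_change_generators[OF S1(1) eS e, of j] filtration_extension[OF S0(1), of "e * j"]
    by (rule subset_trans)
  then show ?thesis by blast
qed

lemma emb_finsum:
  assumes "finite I" "\<And>i. i \<in> I \<Longrightarrow> f i \<in> carrier A"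
  shows "emb (\<Oplus>i\<in>I. f i) = (\<Oplus>\<^bsub>T.B\<^esub>i\<in>I. emb (f i))"
  using assms
proof (induction I rule: finite_induct)
  case empty
  then show ?case using T.pt_zero_right[OF Q_field_closed(2)] by simp
next
  case (insert i I)
  have "f \<in> I \<rightarrow> carrier A" "f i \<in> carrier A" "(\<lambda>i. emb (f i)) \<in> I \<rightarrow> carrier T.B" "emb (f i) \<in> carrier T.B"
    using insert.prems emb_closed by auto
  then show ?case using insert by (simp add: finsum_insert T.B.finsum_insert emb_add)
qed

lemma span_emb_sum:
  fixes f :: "nat \<Rightarrow> 'a"
  assumes f: "f \<in> {..<n} \<rightarrow> F0 i" and "\<And>v. v \<in> F0 i \<Longrightarrow> \<exists>g\<in>{..<n} \<rightarrow> range \<iota>. v = (\<Oplus>s\<in>{..<n}. g s \<otimes> f s)"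
    and V: "V \<in> spanB (emb ` F0 i)"
  shows "\<exists>q\<in>{..<n} \<rightarrow> Q_field m. V = (\<Oplus>\<^bsub>T.B\<^esub>s\<in>{..<n}. T.pt (q s) (f s))"
proof -
  define E where "E = {(\<Oplus>\<^bsub>T.B\<^esub>s\<in>{..<n}. T.pt (q s) (f s)) |q. q \<in> {..<n} \<rightarrow> Q_field m}"
  have fc: "f s \<in> carrier A" if "s < n" for s using f that F0_carrier by auto
  have pc: "(\<lambda>s. T.pt (q s) (f s)) \<in> {..<n} \<rightarrow> carrier T.B" if "q \<in> {..<n} \<rightarrow> Q_field m" for q
    using that fc by (auto intro!: T.pt_closed)
  have "subalgebra Qs E T.B"
  proof (rule BB.subspaceI)
    show "E \<subseteq> carrier T.B" unfolding E_def using pc by (auto intro!: T.B.finsum_closed)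
    have "(\<Oplus>\<^bsub>T.B\<^esub>s\<in>{..<n}. T.pt 0 (f s)) = (\<Oplus>\<^bsub>T.B\<^esub>s\<in>{..<n}. \<zero>\<^bsub>T.B\<^esub>)"
      using fc pt_zero by (intro T.B.finsum_cong') auto
    then show "\<zero>\<^bsub>T.B\<^esub> \<in> E"
      unfolding E_def by (intro CollectI exI[of _ "\<lambda>_. 0"]) (simp add: Q_field_closed)
    fix V W assume "V \<in> E" "W \<in> E"
    then obtain q r where q: "V = (\<Oplus>\<^bsub>T.B\<^esub>s\<in>{..<n}. T.pt (q s) (f s))" "q \<in> {..<n} \<rightarrow> Q_field m"
      and r: "W = (\<Oplus>\<^bsub>T.B\<^esub>s\<in>{..<n}. T.pt (r s) (f s))" "r \<in> {..<n} \<rightarrow> Q_field m"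
      unfolding E_def by auto
    have "V \<oplus>\<^bsub>T.B\<^esub> W = (\<Oplus>\<^bsub>T.B\<^esub>s\<in>{..<n}. T.pt (q s) (f s) \<oplus>\<^bsub>T.B\<^esub> T.pt (r s) (f s))"
      unfolding q(1) r(1) by (rule T.B.finsum_addf[symmetric, OF pc[OF q(2)] pc[OF r(2)]])
    also have "\<dots> = (\<Oplus>\<^bsub>T.B\<^esub>s\<in>{..<n}. T.pt (q s + r s) (f s))"
    proof (rule T.B.finsum_cong')
      show "(\<lambda>s. T.pt (q s + r s) (f s)) \<in> {..<n} \<rightarrow> carrier T.B"
        by (rule pc) (use q(2) r(2) in \<open>simp add: Pi_iff Q_field_closed\<close>)
      show "T.pt (q s) (f s) \<oplus>\<^bsub>T.B\<^esub> T.pt (r s) (f s) = T.pt (q s + r s) (f s)" if "s \<in> {..<n}" for s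
        using that q(2) r(2) fc by (intro pt_add[symmetric]) auto
    qed simp
    finally show "V \<oplus>\<^bsub>T.B\<^esub> W \<in> E"
      unfolding E_def using q(2) r(2)
      by (intro CollectI exI[of _ "\<lambda>s. q s + r s"]) (simp add: Pi_iff Q_field_closed)
  next
    fix d V assume "d \<in> Qs" "V \<in> E"
    then obtain x q where x: "d = T.pt x \<one>" "x \<in> Q_field m"
      and q: "V = (\<Oplus>\<^bsub>T.B\<^esub>s\<in>{..<n}. T.pt (q s) (f s))" "q \<in> {..<n} \<rightarrow> Q_field m"
      unfolding E_def Qs_def' by auto
    have "d \<otimes>\<^bsub>T.B\<^esub> V = (\<Oplus>\<^bsub>T.B\<^esub>s\<in>{..<n}. d \<otimes>\<^bsub>T.B\<^esub> T.pt (q s) (f s))"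
      unfolding q(1) by (rule T.B.finsum_rdistr) (use x pc[OF q(2)] in auto)
    also have "\<dots> = (\<Oplus>\<^bsub>T.B\<^esub>s\<in>{..<n}. T.pt (x * q s) (f s))"
    proof (rule T.B.finsum_cong')
      show "(\<lambda>s. T.pt (x * q s) (f s)) \<in> {..<n} \<rightarrow> carrier T.B"
        by (rule pc) (use q(2) x(2) in \<open>simp add: Pi_iff Q_field_closed\<close>)
      show "d \<otimes>\<^bsub>T.B\<^esub> T.pt (q s) (f s) = T.pt (x * q s) (f s)" if "s \<in> {..<n}" for s
        using that pt_mult[OF x(2) _ one_closed, of "q s" "f s"] q(2) x(1) fc by auto
    qed simp
    finally show "d \<otimes>\<^bsub>T.B\<^esub> V \<in> E"
      unfolding E_def using q(2) x(2)
      by (intro CollectI exI[of _ "\<lambda>s. x * q s"]) (simp add: Pi_iff Q_field_closed)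
  qed
  moreover have "emb ` F0 i \<subseteq> E"
  proof (rule image_subsetI)
    fix v assume "v \<in> F0 i"
    then obtain g where g: "g \<in> {..<n} \<rightarrow> range \<iota>" "v = (\<Oplus>s\<in>{..<n}. g s \<otimes> f s)" using assms(2) by blast
    have "\<forall>s\<in>{..<n}. \<exists>d. g s = \<iota> d" using g(1) by auto
    then obtain d where d: "\<And>s. s < n \<Longrightarrow> g s = \<iota> (d s)" by (metis lessThan_iff)
    have "emb v = (\<Oplus>\<^bsub>T.B\<^esub>s\<in>{..<n}. emb (g s \<otimes> f s))"
      unfolding g(2) by (rule emb_finsum) (use d fc in auto)
    also have "\<dots> = (\<Oplus>\<^bsub>T.B\<^esub>s\<in>{..<n}. T.pt (ratfun_const (d s)) (f s))"
    proof (rule T.B.finsum_cong')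
      show "(\<lambda>s. T.pt (ratfun_const (d s)) (f s)) \<in> {..<n} \<rightarrow> carrier T.B"
        by (rule pc) (simp add: Q_field_closed)
      show "emb (g s \<otimes> f s) = T.pt (ratfun_const (d s)) (f s)" if "s \<in> {..<n}" for s
        using that d T.pt_scalar[OF Q_field_closed(2) fc, of s "d s"] by (simp add: ratfun_field_simps(2-))
    qed simp
    finally show "emb v \<in> E"
      unfolding E_def by (intro CollectI exI[of _ "\<lambda>s. ratfun_const (d s)"]) (simp add: Q_field_closed)
  qed
  ultimately have "spanB (emb ` F0 i) \<subseteq> E" by (rule BB.subspace_span_least)
  then show ?thesis using V unfolding E_def by blast
qed

text \<open>This makes the \<open>LEAST\<close> in both return functions meaningful. A step of
  \<open>B\<close> lies in the span of a step of \<open>A\<close> with finite basis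
  \<open>f\<close>. For each basis index one operator reads off the coefficient and lies in a
  sandwich of bounded width; a nonzero element has a nonzero coefficient, which is then inverted in
  \<open>Qs\<close>.\<close>

lemma exists_return:
  "\<exists>j. \<forall>V\<in>F1 i - {\<zero>\<^bsub>T.B\<^esub>}.
    \<one>\<^bsub>T.B\<^esub> \<in> spanB {x \<otimes>\<^bsub>T.B\<^esub> V \<otimes>\<^bsub>T.B\<^esub> w |x w. x \<in> F1 j \<and> w \<in> F1 j}"
proof -
  obtain e where e: "\<And>j. F1 j \<subseteq> spanB (emb ` F0 (e * j))" using F1_in_span by blast
  let ?n = "dim (range \<iota>) (F0 (e * i))"
  obtain f where f: "f \<in> {..<?n} \<rightarrow> F0 (e * i)" "lin_indep f {..<?n}"
    and fs: "\<And>v. v \<in> F0 (e * i) \<Longrightarrow> \<exists>g\<in>{..<?n} \<rightarrow> range \<iota>. v = (\<Oplus>s\<in>{..<?n}. g s \<otimes> f s)"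
    using exists_basis[OF finite_dimension_filtration[OF S0(1,2)]] by blast
  have fc: "f \<in> {..<?n} \<rightarrow> carrier A" using f(1) F0_carrier by auto
  define W where "W j V = {x \<otimes>\<^bsub>T.B\<^esub> V \<otimes>\<^bsub>T.B\<^esub> w |x w. x \<in> F1 j \<and> w \<in> F1 j}" for j V
  have "\<exists>j. \<forall>q\<in>{..<?n} \<rightarrow> Q_field m. \<forall>j'\<ge>j.
      T.pt (q s) \<one> \<in> spanB (W j' (\<Oplus>\<^bsub>T.B\<^esub>t\<in>{..<?n}. T.pt (q t) (f t)))" if s: "s \<in> {..<?n}" for s
  proof -
    obtain T' where T': "T' \<in> mult_ops T.B"
      "\<And>q. q \<in> {..<?n} \<rightarrow> Q_field m \<Longrightarrow> T' (\<Oplus>\<^bsub>T.B\<^esub>t\<in>{..<?n}. T.pt (q t) (f t)) = T.pt (q s) \<one>"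
      using mult_op_lift_separate[OF simple centre finite_lessThan f(2) fc s] by blast
    obtain j where j: "\<And>j' V. \<lbrakk>j' \<ge> j; V \<in> carrier T.B\<rbrakk> \<Longrightarrow> T' V \<in> spanB (W j' V)"
      using BB.mult_op_in_sandwich[OF S1(1,3) T'(1)] unfolding W_def by blast
    have "T.pt (q s) \<one> \<in> spanB (W j' (\<Oplus>\<^bsub>T.B\<^esub>t\<in>{..<?n}. T.pt (q t) (f t)))"
      if q: "q \<in> {..<?n} \<rightarrow> Q_field m" and "j' \<ge> j" for q j'
    proof -
      have "(\<Oplus>\<^bsub>T.B\<^esub>t\<in>{..<?n}. T.pt (q t) (f t)) \<in> carrier T.B"
        using q fc by (intro T.B.finsum_closed Pi_I T.pt_closed) auto
      then show ?thesis unfolding T'(2)[OF q, symmetric] by (rule j[OF \<open>j' \<ge> j\<close>])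
    qed
    then show ?thesis by blast
  qed
  then have "\<forall>s\<in>{..<?n}. \<exists>j. \<forall>q\<in>{..<?n} \<rightarrow> Q_field m. \<forall>j'\<ge>j.
      T.pt (q s) \<one> \<in> spanB (W j' (\<Oplus>\<^bsub>T.B\<^esub>t\<in>{..<?n}. T.pt (q t) (f t)))" by (rule ballI)
  from bchoice[OF this] obtain j where "\<forall>s\<in>{..<?n}. \<forall>q\<in>{..<?n} \<rightarrow> Q_field m. \<forall>j'\<ge>j s.
      T.pt (q s) \<one> \<in> spanB (W j' (\<Oplus>\<^bsub>T.B\<^esub>t\<in>{..<?n}. T.pt (q t) (f t)))" by (rule exE)
  then have j: "T.pt (q s) \<one> \<in> spanB (W j' (\<Oplus>\<^bsub>T.B\<^esub>t\<in>{..<?n}. T.pt (q t) (f t)))"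
    if "s \<in> {..<?n}" "q \<in> {..<?n} \<rightarrow> Q_field m" "j' \<ge> j s" for s q j'
    using that by simp
  \<comment> \<open>An upper bound for all \<open>j s\<close>, valid whichever coefficient turns out
    to be nonzero.\<close>
  define J where "J = (\<Sum>s<?n. j s)"
  have "\<one>\<^bsub>T.B\<^esub> \<in> spanB (W J V)" if V: "V \<in> F1 i - {\<zero>\<^bsub>T.B\<^esub>}" for V
  proof -
    have "V \<in> spanB (emb ` F0 (e * i))" using V e[of i] by blast
    then obtain q where q: "q \<in> {..<?n} \<rightarrow> Q_field m" "V = (\<Oplus>\<^bsub>T.B\<^esub>t\<in>{..<?n}. T.pt (q t) (f t))"
      using span_emb_sum[OF f(1) fs] by blast
    have "\<exists>s\<in>{..<?n}. q s \<noteq> 0"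
    proof (rule ccontr)
      assume "\<not> ?thesis"
      then have "V = (\<Oplus>\<^bsub>T.B\<^esub>t\<in>{..<?n}. \<zero>\<^bsub>T.B\<^esub>)"
        unfolding q(2) using fc pt_zero by (intro T.B.finsum_cong') auto
      then show False using V by simp
    qed
    then obtain s where s: "s \<in> {..<?n}" "q s \<noteq> 0" by blast
    have qs: "q s \<in> Q_field m" using q(1) s(1) by auto
    have "j s \<le> J" unfolding J_def using s(1) by (intro member_le_sum) auto
    then have "T.pt (q s) \<one> \<in> spanB (W J V)" unfolding q(2) by (rule j[OF s(1) q(1)])
    moreover have "W J V \<subseteq> carrier T.B"
      unfolding W_def
      by (rule BB.sandwich_carrier) (use V F1_carrier BB.filtration_carrier[OF S1(1)] in auto)
    ultimately have "T.pt (inverse (q s)) \<one> \<otimes>\<^bsub>T.B\<^esub> T.pt (q s) \<one> \<in> spanB (W J V)"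
      by (intro BB.subspaceD(4)[OF BB.subspace_subspace_span QsI] Q_field_closed(7) qs)
    then show ?thesis using pt_inverse(1)[OF qs s(2)] by simp
  qed
  then show ?thesis unfolding W_def by blast
qed

text \<open>The condition behind the left return function. The two-sided condition implies it, so an
  argument that starts from here serves both filter dimensions.\<close>

definition returns :: "nat \<Rightarrow> nat \<Rightarrow> bool" where
  "returns j i \<longleftrightarrow> (\<forall>V\<in>F1 i - {\<zero>\<^bsub>T.B\<^esub>}.
    \<one>\<^bsub>T.B\<^esub> \<in> spanB {x \<otimes>\<^bsub>T.B\<^esub> V \<otimes>\<^bsub>T.B\<^esub> w |x w. x \<in> carrier T.B \<and> w \<in> F1 j})"

lemma two_sided_returns:
  assumes "\<forall>V\<in>F1 i - {\<zero>\<^bsub>T.B\<^esub>}.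
    \<one>\<^bsub>T.B\<^esub> \<in> spanB {x \<otimes>\<^bsub>T.B\<^esub> V \<otimes>\<^bsub>T.B\<^esub> w |x w. x \<in> F1 j \<and> w \<in> F1 j}"
  shows "returns j i"
  unfolding returns_def
proof
  fix V assume V: "V \<in> F1 i - {\<zero>\<^bsub>T.B\<^esub>}"
  let ?W1 = "{x \<otimes>\<^bsub>T.B\<^esub> V \<otimes>\<^bsub>T.B\<^esub> w |x w. x \<in> F1 j \<and> w \<in> F1 j}"
  let ?W2 = "{x \<otimes>\<^bsub>T.B\<^esub> V \<otimes>\<^bsub>T.B\<^esub> w |x w. x \<in> carrier T.B \<and> w \<in> F1 j}"
  have "?W2 \<subseteq> carrier T.B"
    by (rule BB.sandwich_carrier) (use V F1_carrier BB.filtration_carrier[OF S1(1)] in auto)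
  moreover have "?W1 \<subseteq> ?W2" using F1_carrier by blast
  ultimately have "spanB ?W1 \<subseteq> spanB ?W2" by (intro BB.subspace_span_mono)
  then show "\<one>\<^bsub>T.B\<^esub> \<in> spanB ?W2" using assms V by blast
qed

lemma returns_return_function: "returns (return_function T.B Qs F1 i) i"
  by (rule two_sided_returns) (unfold return_function_def, rule LeastI_ex, rule exists_return)

lemma returns_left_return_function: "returns (left_return_function T.B Qs F1 i) i"
proof -
  have "\<exists>j. returns j i" using exists_return[of i] two_sided_returns by blast
  then have "returns (LEAST j. returns j i) i" by (rule LeastI_ex)
  then show ?thesis unfolding left_return_function_def returns_def .
qed

section \<open>The rank of the module\<close>

text \<open>An element \<open>u\<close> of \<open>A\<close> stands for the vector
  \<open>b \<mapsto> \<phi> (b \<otimes> u)\<close> of the module, that is, \<open>emb u\<close>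
  applied to \<open>\<phi>\<close>. Here and in \<open>phi_span\<close>, independence and span of
  such vectors over the rational functions are meant.\<close>

definition phi_indep :: "('i \<Rightarrow> 'a) \<Rightarrow> 'i set \<Rightarrow> bool" where
  "phi_indep f I \<longleftrightarrow> (\<forall>g. (\<forall>s\<in>I. g s \<in> Q_field m) \<longrightarrow>
    (\<forall>b\<in>carrier A. (\<Sum>s\<in>I. g s * \<phi> (b \<otimes> f s)) = 0) \<longrightarrow> (\<forall>s\<in>I. g s = 0))"

definition phi_span :: "('i \<Rightarrow> 'a) \<Rightarrow> 'i set \<Rightarrow> 'a \<Rightarrow> bool" where
  "phi_span f I u \<longleftrightarrow> (\<exists>g. (\<forall>s\<in>I. g s \<in> Q_field m) \<and> (\<forall>b\<in>carrier A. \<phi> (b \<otimes> u) = (\<Sum>s\<in>I. g s * \<phi> (b \<otimes> f s))))"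

lemma phi_span_base:
  assumes "finite I" "t \<in> I"
  shows "phi_span f I (f t)"
  unfolding phi_span_def
proof (intro exI[of _ "\<lambda>s. if s = t then 1 else 0"] conjI ballI)
  show "\<phi> (b \<otimes> f t) = (\<Sum>s\<in>I. (if s = t then 1 else 0) * \<phi> (b \<otimes> f s))" for b
  proof -
    have "(\<Sum>s\<in>I. (if s = t then 1 else 0) * \<phi> (b \<otimes> f s)) = (\<Sum>s\<in>I. if s = t then \<phi> (b \<otimes> f s) else 0)"
      by (intro sum.cong) auto
    then show ?thesis using assms by simp
  qed
qed (simp add: Q_field_closed)

lemma phi_span_dependent:
  assumes I: "finite I" "t \<notin> I" "phi_indep f I" "\<not> phi_indep f (insert t I)"
  shows "phi_span f I (f t)"
proof -
  obtain g where g: "\<forall>s\<in>insert t I. g s \<in> Q_field m"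
      "\<forall>b\<in>carrier A. (\<Sum>s\<in>insert t I. g s * \<phi> (b \<otimes> f s)) = 0" "\<exists>s\<in>insert t I. g s \<noteq> 0"
    using I(4) unfolding phi_indep_def by blast
  have sum: "g t * \<phi> (b \<otimes> f t) + (\<Sum>s\<in>I. g s * \<phi> (b \<otimes> f s)) = 0" if "b \<in> carrier A" for b
    using g(2) that I(1,2) by simp
  have gt: "g t \<noteq> 0"
  proof
    assume 0: "g t = 0"
    then have "\<forall>b\<in>carrier A. (\<Sum>s\<in>I. g s * \<phi> (b \<otimes> f s)) = 0" using sum by simp
    then have "\<forall>s\<in>I. g s = 0" using I(3) g(1) unfolding phi_indep_def by blast
    then show False using 0 g(3) by blast
  qed
  show ?thesis
    unfolding phi_span_def
  proof (intro exI[of _ "\<lambda>s. - (inverse (g t) * g s)"] conjI ballI)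
    show "- (inverse (g t) * g s) \<in> Q_field m" if "s \<in> I" for s
      using that g(1) by (intro Q_field_closed) auto
    fix b assume b: "b \<in> carrier A"
    have "(\<Sum>s\<in>I. - (inverse (g t) * g s) * \<phi> (b \<otimes> f s)) = - inverse (g t) * (\<Sum>s\<in>I. g s * \<phi> (b \<otimes> f s))"
      by (simp add: sum_distrib_left mult.assoc sum_negf)
    also have "(\<Sum>s\<in>I. g s * \<phi> (b \<otimes> f s)) = - (g t * \<phi> (b \<otimes> f t))"
      using sum[OF b] by (simp add: eq_neg_iff_add_eq_0 add.commute)
    also have "- inverse (g t) * - (g t * \<phi> (b \<otimes> f t)) = \<phi> (b \<otimes> f t)"
      using gt by (simp add: mult.assoc[symmetric])
    finally show "\<phi> (b \<otimes> f t) = (\<Sum>s\<in>I. - (inverse (g t) * g s) * \<phi> (b \<otimes> f s))" by simp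
  qed
qed

lemma phi_span_combination:
  fixes f g :: "nat \<Rightarrow> 'a"
  assumes I: "finite I" and n: "\<And>t. t < n \<Longrightarrow> f t \<in> carrier A" "\<And>t. t < n \<Longrightarrow> phi_span f I (f t)"
    and g: "g \<in> {..<n} \<rightarrow> range \<iota>"
  shows "phi_span f I (\<Oplus>t\<in>{..<n}. g t \<otimes> f t)"
proof -
  have "\<forall>t\<in>{..<n}. \<exists>d. g t = \<iota> d" using g by auto
  then obtain d where d: "\<And>t. t < n \<Longrightarrow> g t = \<iota> (d t)" by (metis lessThan_iff)
  have "\<forall>t\<in>{..<n}. \<exists>h. (\<forall>s\<in>I. h s \<in> Q_field m) \<and> (\<forall>b\<in>carrier A. \<phi> (b \<otimes> f t) = (\<Sum>s\<in>I. h s * \<phi> (b \<otimes> f s)))"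
    using n(2) unfolding phi_span_def by simp
  then obtain h where h: "\<And>t s. \<lbrakk>t < n; s \<in> I\<rbrakk> \<Longrightarrow> h t s \<in> Q_field m"
    "\<And>t b. \<lbrakk>t < n; b \<in> carrier A\<rbrakk> \<Longrightarrow> \<phi> (b \<otimes> f t) = (\<Sum>s\<in>I. h t s * \<phi> (b \<otimes> f s))"
    unfolding bchoice_iff by auto
  show ?thesis
    unfolding phi_span_def
  proof (intro exI[of _ "\<lambda>s. \<Sum>t<n. ratfun_const (d t) * h t s"] conjI ballI)
    show "(\<Sum>t<n. ratfun_const (d t) * h t s) \<in> Q_field m" if "s \<in> I" for s
      using that h(1) by (intro Q_field_sum Q_field_closed(5) Q_field_closed(3)) auto
    fix b assume b: "b \<in> carrier A"
    have gf: "(\<lambda>t. g t \<otimes> f t) \<in> {..<n} \<rightarrow> carrier A" using d n(1) by auto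
    have "b \<otimes> (\<Oplus>t\<in>{..<n}. g t \<otimes> f t) = (\<Oplus>t\<in>{..<n}. b \<otimes> (g t \<otimes> f t))"
      by (rule finsum_rdistr[OF _ b gf]) simp
    then have "\<phi> (b \<otimes> (\<Oplus>t\<in>{..<n}. g t \<otimes> f t)) = \<phi> (\<Oplus>t\<in>{..<n}. b \<otimes> (g t \<otimes> f t))" by simp
    also have "\<dots> = (\<Sum>t<n. \<phi> (b \<otimes> (g t \<otimes> f t)))"
      by (rule lin_finsum[OF lin_\<phi>]) (use gf b in auto)
    also have "\<dots> = (\<Sum>t<n. ratfun_const (d t) * (\<Sum>s\<in>I. h t s * \<phi> (b \<otimes> f s)))"
    proof (rule sum.cong)
      fix t assume t: "t \<in> {..<n}"
      have ft: "f t \<in> carrier A" using n(1) t by simp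
      have "b \<otimes> (g t \<otimes> f t) = (b \<otimes> \<iota> (d t)) \<otimes> f t" using d t b ft by (simp add: m_assoc)
      also have "\<dots> = \<iota> (d t) \<otimes> (b \<otimes> f t)" using \<iota>_central[OF b, of "d t"] b ft by (simp add: m_assoc[symmetric])
      finally show "\<phi> (b \<otimes> (g t \<otimes> f t)) = ratfun_const (d t) * (\<Sum>s\<in>I. h t s * \<phi> (b \<otimes> f s))"
        using lin_scalar[OF lin_\<phi>, of "b \<otimes> f t" "d t"] h(2) t b ft by simp
    qed simp
    also have "\<dots> = (\<Sum>s\<in>I. (\<Sum>t<n. ratfun_const (d t) * h t s) * \<phi> (b \<otimes> f s))"
      by (simp add: sum_distrib_left sum_distrib_right mult.assoc) (rule sum.swap)
    finally show "\<phi> (b \<otimes> (\<Oplus>t\<in>{..<n}. g t \<otimes> f t)) = (\<Sum>s\<in>I. (\<Sum>t<n. ratfun_const (d t) * h t s) * \<phi> (b \<otimes> f s))" .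
  qed
qed

text \<open>A maximal independent part of a \<open>K\<close>-basis of \<open>F0 i\<close>. In this
  way the \<open>i\<close>-th step of the module gets a basis represented by elements of
  \<open>F0 i\<close> itself, free of denominators.\<close>

lemma exists_phi_basis:
  "\<exists>(f :: nat \<Rightarrow> 'a) I. finite I \<and> f \<in> I \<rightarrow> F0 i \<and> phi_indep f I \<and> (\<forall>u\<in>F0 i. phi_span f I u)"
proof -
  let ?n = "dim (range \<iota>) (F0 i)"
  obtain f where f: "f \<in> {..<?n} \<rightarrow> F0 i" "lin_indep f {..<?n}"
    and fs: "\<And>v. v \<in> F0 i \<Longrightarrow> \<exists>g\<in>{..<?n} \<rightarrow> range \<iota>. v = (\<Oplus>s\<in>{..<?n}. g s \<otimes> f s)"
    using exists_basis[OF finite_dimension_filtration[OF S0(1,2)]] by blast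
  let ?P = "{I. I \<subseteq> {..<?n} \<and> phi_indep f I}"
  have "phi_indep f {}" by (simp add: phi_indep_def)
  then have mem: "{} \<in> ?P" by simp
  have finP: "finite ?P" by (rule finite_subset[of _ "Pow {..<?n}"]) auto
  from finite_has_maximal2[OF finP mem] obtain I where I: "I \<in> ?P" and mx: "\<forall>J\<in>?P. I \<le> J \<longrightarrow> I = J"
    by (elim bexE conjE)
  have fin: "finite I" by (rule finite_subset[of _ "{..<?n}"]) (use I in auto)
  have sp: "phi_span f I (f t)" if "t < ?n" for t
  proof (cases "t \<in> I")
    case True
    then show ?thesis using phi_span_base[OF fin] by blast
  next
    case False
    have "\<not> phi_indep f (insert t I)"
    proof
      assume "phi_indep f (insert t I)"
      then have "insert t I \<in> ?P" using I that by simp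
      then have "I = insert t I"
        using bspec[OF mx] subset_insertI[of I t] by simp
      then show False using False by blast
    qed
    then show ?thesis using I False by (intro phi_span_dependent fin) auto
  qed
  have fc: "f t \<in> carrier A" if "t < ?n" for t
    by (rule F0_carrier) (use f(1) that in blast)
  have "phi_span f I u" if u: "u \<in> F0 i" for u
  proof -
    obtain g where g: "g \<in> {..<?n} \<rightarrow> range \<iota>" "u = (\<Oplus>s\<in>{..<?n}. g s \<otimes> f s)"
      using fs[OF u] by (elim bexE)
    show ?thesis unfolding g(2) by (rule phi_span_combination[OF fin fc sp g(1)])
  qed
  moreover have "f \<in> I \<rightarrow> F0 i" using f(1) I by auto
  ultimately show ?thesis using fin I by (intro exI[of _ f] exI[of _ I]) simp
qed

lemma phi_basis_nonempty:
  assumes "\<forall>u\<in>F0 i. phi_span f I u"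
  shows "I \<noteq> {}"
proof
  assume "I = {}"
  then have "\<phi> (\<one> \<otimes> \<one>) = 0" using assms one_filtration[OF S0(1), of i] unfolding phi_span_def by auto
  then show False by (simp add: \<phi>_one)
qed

end

lemma Fract_sum: "Fract (\<Sum>i\<in>I. p i) 1 = (\<Sum>i\<in>I. Fract (p i) 1)"
  for p :: "'i \<Rightarrow> 'c::idom"
proof (induction I rule: infinite_finite_induct)
  case (insert i I)
  have "Fract (p i + (\<Sum>i\<in>I. p i)) 1 = Fract (p i) 1 + Fract (\<Sum>i\<in>I. p i) 1" by simp
  then show ?case using insert by simp
qed (simp_all add: Zero_fract_def)

text \<open>The cut-off at \<open>m\<close> secures finite support: members of an extensional
  function space are \<open>undefined\<close> outside the domain, not zero.\<close>

definition exponent :: "nat \<Rightarrow> (nat \<Rightarrow> nat) \<Rightarrow> nat \<Rightarrow>\<^sub>0 nat" where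
  "exponent m \<alpha> = Abs_poly_mapping (\<lambda>t. if t < m then \<alpha> t else 0)"

lemma lookup_exponent: "Poly_Mapping.lookup (exponent m \<alpha>) = (\<lambda>t. if t < m then \<alpha> t else 0)"
proof -
  have "finite {t. (if t < m then \<alpha> t else 0) \<noteq> 0}" by (rule finite_subset[of _ "{..<m}"]) auto
  then show ?thesis unfolding exponent_def by (rule lookup_Abs_poly_mapping)
qed

lemma exponent_inj: "inj_on (exponent m) ({..<m} \<rightarrow>\<^sub>E D)"
proof (rule inj_onI)
  fix \<alpha> \<beta> assume a: "\<alpha> \<in> {..<m} \<rightarrow>\<^sub>E D" and b: "\<beta> \<in> {..<m} \<rightarrow>\<^sub>E D" and eq: "exponent m \<alpha> = exponent m \<beta>"
  show "\<alpha> = \<beta>"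
  proof (rule PiE_ext[OF a b])
    fix t assume "t \<in> {..<m}"
    then show "\<alpha> t = \<beta> t"
      using fun_cong[OF arg_cong[OF eq, of Poly_Mapping.lookup], of t] by (simp add: lookup_exponent)
  qed
qed

lemma single_exponent_mpolys: "Poly_Mapping.single (exponent m \<alpha>) c \<in> mpolys m"
proof -
  have "Poly_Mapping.keys (exponent m \<alpha>) \<subseteq> {..<m}"
    by (auto simp: in_keys_iff lookup_exponent split: if_splits)
  then show ?thesis by (auto simp: mpolys_def)
qed

lemma mpolys_sum: "(\<And>i. i \<in> I \<Longrightarrow> p i \<in> mpolys m) \<Longrightarrow> sum p I \<in> mpolys m"
  by (induction I rule: infinite_finite_induct) (auto intro: mpolys_closed)

section \<open>The two estimates comparing the rank of the module with dimensions in
  \<open>A\<close>\<close>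

context extended_algebra
begin

lemma monom_val_filtration:
  assumes "\<And>t. t < m \<Longrightarrow> y t \<in> F0 h" "\<And>t. t < m \<Longrightarrow> e t \<le> i"
  shows "n \<le> m \<Longrightarrow> monom_val A y n e \<in> F0 (h * i * n)"
proof (induction n)
  case 0
  then show ?case using one_in_scalars by simp
next
  case (Suc n)
  have "y n [^] e n \<in> F0 (h * e n)"
    using assms(1) Suc.prems by (intro filtration_power[OF S0(1)]) simp
  moreover have "h * e n \<le> h * i" using assms(2)[of n] Suc.prems by simp
  ultimately have "y n [^] e n \<in> F0 (h * i)" using filtration_mono[OF S0(1)] by blast
  moreover have "monom_val A y n e \<in> F0 (h * i * n)" using Suc by simp
  ultimately have "monom_val A y n e \<otimes> y n [^] e n \<in> F0 (h * i * n + h * i)"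
    by (intro filtration_mult[OF S0(1)])
  then show ?case by (simp add: add.commute)
qed

text \<open>Right multiplication of \<open>u\<close> by a monomial in the \<open>y t\<close> becomes
  scalar multiplication in the module.\<close>

lemma phi_monomial:
  assumes "b \<in> carrier A" "u \<in> carrier A"
  shows "\<phi> (b \<otimes> (\<iota> c \<otimes> (u \<otimes> monom_val A y m (Poly_Mapping.lookup (exponent m \<alpha>)))))
    = Fract (Poly_Mapping.single (exponent m \<alpha>) c) 1 * \<phi> (b \<otimes> u)"
proof -
  let ?e = "exponent m \<alpha>"
  let ?v = "monom_val A y m (Poly_Mapping.lookup ?e)"
  have "b \<otimes> (\<iota> c \<otimes> (u \<otimes> ?v)) = (b \<otimes> u) \<otimes> (\<iota> c \<otimes> ?v)"
  proof -
    have "\<iota> c \<otimes> (u \<otimes> ?v) = (\<iota> c \<otimes> u) \<otimes> ?v" using assms by (simp add: m_assoc)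
    also have "\<iota> c \<otimes> u = u \<otimes> \<iota> c" by (rule \<iota>_central[OF assms(2)])
    finally show ?thesis using assms by (simp add: m_assoc)
  qed
  also have "\<iota> c \<otimes> ?v = ev (Poly_Mapping.single ?e c)" by (rule ev_single[symmetric])
  finally show ?thesis using assms by (simp add: \<phi>_ev single_exponent_mpolys)
qed

text \<open>The source of the summand \<open>m\<close>. The products of the \<open>f s\<close> with
  all monomials of exponents below \<open>i\<close> are independent over \<open>K\<close>:
  \<open>\<phi>\<close> turns a relation into one between the vectors of the \<open>f s\<close> with
  polynomial coefficients, which must vanish, and so do the coefficients of these
  polynomials.\<close>

lemma rank_times_power_le:
  "\<exists>h>0. \<forall>i I (f :: nat \<Rightarrow> 'a). finite I \<longrightarrow> f \<in> I \<rightarrow> F0 i \<longrightarrow> phi_indep f I \<longrightarrow>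
    card I * i ^ m \<le> dim (range \<iota>) (F0 (h * i))"
proof -
  have "y ` {..<m} \<subseteq> generate_ring A (range \<iota> \<union> S0)" using C_carrier[OF y_C] S0(3) by auto
  then obtain h0 where h0: "y ` {..<m} \<subseteq> F0 h0"
    using finite_filtration_bound[OF S0(1), of "y ` {..<m}"] by auto
  \<comment> \<open>\<open>f s\<close> contributes \<open>i\<close> steps and each of the
    \<open>m\<close> variables at most \<open>h0 * i\<close>, together \<open>h * i\<close>.\<close>
  define h where "h = Suc (h0 * m)"
  have "card I * i ^ m \<le> dim (range \<iota>) (F0 (h * i))"
    if I: "finite I" "f \<in> I \<rightarrow> F0 i" "phi_indep f I" for i I and f :: "nat \<Rightarrow> 'a"
  proof -
    define D where "D = ({..<m} \<rightarrow>\<^sub>E {..<i})"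
    have finD: "finite D" unfolding D_def by (rule finite_PiE) auto
    have cardD: "card D = i ^ m" unfolding D_def by (subst card_PiE) auto
    define v where "v \<alpha> = monom_val A y m (Poly_Mapping.lookup (exponent m \<alpha>))" for \<alpha>
    have fc: "f s \<in> carrier A" if "s \<in> I" for s using F0_carrier[of "f s" i] I(2) that by blast
    have vc: "v \<alpha> \<in> carrier A" for \<alpha> unfolding v_def by (rule monom_val_closed)
    let ?F = "\<lambda>(s, \<alpha>). f s \<otimes> v \<alpha>"
    have FV: "?F \<in> I \<times> D \<rightarrow> F0 (h * i)"
    proof (rule Pi_I, clarify)
      fix s \<alpha> assume s: "s \<in> I" and \<alpha>: "\<alpha> \<in> D"
      have "v \<alpha> \<in> F0 (h0 * i * m)"
        unfolding v_def
      proof (rule monom_val_filtration)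
        show "Poly_Mapping.lookup (exponent m \<alpha>) t \<le> i" if "t < m" for t
          using \<alpha> that PiE_mem[of \<alpha> "{..<m}" "\<lambda>_. {..<i}" t] by (simp add: D_def lookup_exponent less_imp_le)
      qed (use h0 in auto)
      moreover have "f s \<in> F0 i" using I(2) s by auto
      ultimately have "f s \<otimes> v \<alpha> \<in> F0 (i + h0 * i * m)" by (intro filtration_mult[OF S0(1)])
      moreover have "i + h0 * i * m = h * i" by (simp add: h_def)
      ultimately show "f s \<otimes> v \<alpha> \<in> F0 (h * i)" by simp
    qed
    have "lin_indep ?F (I \<times> D)"
      unfolding lin_indep_def
    proof (intro ballI impI)
      fix g z
      assume g: "g \<in> I \<times> D \<rightarrow> range \<iota>" and 0: "(\<Oplus>z\<in>I \<times> D. g z \<otimes> ?F z) = \<zero>" and z: "z \<in> I \<times> D"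
      have "\<forall>z\<in>I \<times> D. \<exists>c. g z = \<iota> c" using g by blast
      from bchoice[OF this] obtain c where c: "\<forall>z\<in>I \<times> D. g z = \<iota> (c z)" by (rule exE)
      \<comment> \<open>The scalars belonging to one \<open>f s\<close> are collected into a
        polynomial.\<close>
      define p where "p s = (\<Sum>\<alpha>\<in>D. Poly_Mapping.single (exponent m \<alpha>) (c (s, \<alpha>)))" for s
      have "\<forall>b\<in>carrier A. (\<Sum>s\<in>I. Fract (p s) 1 * \<phi> (b \<otimes> f s)) = 0"
      proof
        fix b assume b: "b \<in> carrier A"
        have gc: "g z \<otimes> ?F z \<in> carrier A" if "z \<in> I \<times> D" for z
          using that c fc vc by auto
        have "0 = \<phi> (b \<otimes> (\<Oplus>z\<in>I \<times> D. g z \<otimes> ?F z))" using 0 b lin_zero[OF lin_\<phi>] by simp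
        also have "b \<otimes> (\<Oplus>z\<in>I \<times> D. g z \<otimes> ?F z) = (\<Oplus>z\<in>I \<times> D. b \<otimes> (g z \<otimes> ?F z))"
          by (rule finsum_rdistr) (use I(1) finD b gc in auto)
        also have "\<phi> \<dots> = (\<Sum>z\<in>I \<times> D. \<phi> (b \<otimes> (g z \<otimes> ?F z)))"
          by (rule lin_finsum[OF lin_\<phi>]) (use I(1) finD b gc in \<open>auto simp del: case_prod_conv\<close>)
        also have "\<dots> = (\<Sum>z\<in>I \<times> D. Fract (Poly_Mapping.single (exponent m (snd z)) (c z)) 1 * \<phi> (b \<otimes> f (fst z)))"
        proof (rule sum.cong[OF refl])
          fix z assume z: "z \<in> I \<times> D"
          obtain s \<alpha> where s: "z = (s, \<alpha>)" by (rule prod.exhaust)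
          have si: "s \<in> I" using z s by simp
          have "g (s, \<alpha>) = \<iota> (c (s, \<alpha>))" using c z unfolding s by (rule bspec)
          then show "\<phi> (b \<otimes> (g z \<otimes> ?F z)) = Fract (Poly_Mapping.single (exponent m (snd z)) (c z)) 1 * \<phi> (b \<otimes> f (fst z))"
            using phi_monomial[OF b fc[OF si], of "c (s, \<alpha>)" \<alpha>] unfolding s by (simp add: v_def)
        qed
        also have "\<dots> = (\<Sum>s\<in>I. \<Sum>\<alpha>\<in>D. Fract (Poly_Mapping.single (exponent m \<alpha>) (c (s, \<alpha>))) 1 * \<phi> (b \<otimes> f s))"
          by (subst sum.cartesian_product) (simp add: case_prod_unfold)
        also have "\<dots> = (\<Sum>s\<in>I. Fract (p s) 1 * \<phi> (b \<otimes> f s))"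
          by (simp add: p_def Fract_sum sum_distrib_right)
        finally show "(\<Sum>s\<in>I. Fract (p s) 1 * \<phi> (b \<otimes> f s)) = 0" by (rule sym)
      qed
      moreover have "\<forall>s\<in>I. Fract (p s) 1 \<in> Q_field m"
        unfolding p_def by (intro ballI Q_fieldI mpolys_sum single_exponent_mpolys) (simp_all add: mpolys_closed)
      ultimately have P0: "\<forall>s\<in>I. Fract (p s) 1 = 0"
        using I(3)[unfolded phi_indep_def, THEN spec, of "\<lambda>s. Fract (p s) 1"] by blast
      obtain s \<alpha> where s: "z = (s, \<alpha>)" "s \<in> I" "\<alpha> \<in> D" using z by auto
      have "Fract (p s) 1 = 0" using P0 s(2) by (rule bspec)
      then have "p s = 0" by (simp add: Zero_fract_def eq_fract)
      \<comment> \<open>Different members of \<open>D\<close> give different exponents, so the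
        coefficient of \<open>p s\<close> at \<open>exponent m \<alpha>\<close> is exactly
        \<open>c (s, \<alpha>)\<close>.\<close>
      have "Poly_Mapping.lookup (p s) (exponent m \<alpha>)
          = (\<Sum>\<beta>\<in>D. if \<beta> = \<alpha> then c (s, \<beta>) else 0)"
        unfolding p_def lookup_sum
      proof (rule sum.cong[OF refl])
        fix \<beta> assume "\<beta> \<in> D"
        then show "Poly_Mapping.lookup (Poly_Mapping.single (exponent m \<beta>) (c (s, \<beta>))) (exponent m \<alpha>)
            = (if \<beta> = \<alpha> then c (s, \<beta>) else 0)"
          using inj_onD[OF exponent_inj, of m \<beta> \<alpha> "{..<i}"] s(3)
          by (auto simp: lookup_single when_def D_def)
      qed
      then have "c (s, \<alpha>) = 0" using \<open>p s = 0\<close> s(3) finD by simp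
      then show "g z = \<zero>" using c z s(1) by (simp add: \<iota>_zero)
    qed
    then have "card (I \<times> D) \<le> dim (range \<iota>) (F0 (h * i))"
      by (rule card_le_dim[OF _ _ FV filtration_carrier[OF S0(1)] finite_dimension_filtration[OF S0(1,2)]])
        (use I(1) finD in simp)
    then show ?thesis using cardD by (simp add: card_cartesian_product)
  qed
  then show ?thesis by (intro exI[of _ h]) (simp add: h_def)
qed

lemma act_finsum:
  assumes "lin \<psi>" "b \<in> carrier A" "finite I" "\<And>s. s \<in> I \<Longrightarrow> q s \<in> Q_field m" "\<And>s. s \<in> I \<Longrightarrow> a s \<in> carrier A"
  shows "act (\<Oplus>\<^bsub>T.B\<^esub>s\<in>I. T.pt (q s) (a s)) \<psi> b = (\<Sum>s\<in>I. q s * \<psi> (b \<otimes> a s))"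
  using assms(3-)
proof (induction I rule: finite_induct)
  case empty
  then show ?case using act_zero[OF assms(1,2)] by simp
next
  case (insert s I)
  have c: "T.pt (q s) (a s) \<in> carrier T.B" "(\<lambda>s. T.pt (q s) (a s)) \<in> I \<rightarrow> carrier T.B"
    using insert.prems by (auto intro!: T.pt_closed)
  have "act (\<Oplus>\<^bsub>T.B\<^esub>s\<in>insert s I. T.pt (q s) (a s)) \<psi> b
      = act (T.pt (q s) (a s) \<oplus>\<^bsub>T.B\<^esub> (\<Oplus>\<^bsub>T.B\<^esub>s\<in>I. T.pt (q s) (a s))) \<psi> b"
    using insert.hyps c by (simp add: T.B.finsum_insert)
  also have "\<dots> = q s * \<psi> (b \<otimes> a s) + act (\<Oplus>\<^bsub>T.B\<^esub>s\<in>I. T.pt (q s) (a s)) \<psi> b"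
    using insert.prems c by (simp add: act_add[OF assms(1,2)] act_pt[OF assms(1,2)] T.B.finsum_closed)
  finally show ?case using insert by simp
qed

lemma annihilator_subspace: "subalgebra Qs {Z \<in> carrier T.B. \<forall>b\<in>carrier A. act Z \<phi> b = 0} T.B"
proof (rule BB.subspaceI)
  let ?K = "{Z \<in> carrier T.B. \<forall>b\<in>carrier A. act Z \<phi> b = 0}"
  show "\<zero>\<^bsub>T.B\<^esub> \<in> ?K" using act_zero[OF lin_\<phi>] by simp
  show "x \<oplus>\<^bsub>T.B\<^esub> z \<in> ?K" if "x \<in> ?K" "z \<in> ?K" for x z
    using that act_add[OF lin_\<phi>] by simp
  show "c \<otimes>\<^bsub>T.B\<^esub> x \<in> ?K" if c: "c \<in> Qs" and x: "x \<in> ?K" for c x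
  proof -
    have cc: "c \<in> carrier T.B" using BB.scalars_in_carrier c by (rule subsetD)
    have xc: "x \<in> carrier T.B" using x by simp
    have "act (c \<otimes>\<^bsub>T.B\<^esub> x) \<phi> b = 0" if b: "b \<in> carrier A" for b
      unfolding act_mult[OF cc xc lin_\<phi> b]
      by (rule act_vanish[OF cc lin_act[OF xc lin_\<phi>] _ b]) (use x in simp)
    then show ?thesis using cc xc by simp
  qed
qed auto

text \<open>An element of \<open>spanB (emb ` F0 i)\<close> killing all \<open>u \<phi>\<close> with \<open>u\<close> in the \<open>j\<close>-th step would
  contradict the return property, so \<open>F0 i\<close> cannot outgrow the space of linear maps between
  two steps of the filtered module.\<close>

lemma dim_le_card_mult:
  fixes f f' :: "nat \<Rightarrow> 'a"
  assumes c: "\<And>i q a. \<lbrakk>q \<in> Q_field m; a \<in> F0 i\<rbrakk> \<Longrightarrow> T.pt q a \<in> F1 (c * i)"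
    and e: "\<And>j. F1 j \<subseteq> spanB (emb ` F0 (e * j))"
    and r: "returns l (c * i)"
    and I: "finite I" "f \<in> I \<rightarrow> F0 (e * l)" "\<forall>u\<in>F0 (e * l). phi_span f I u"
    and I': "finite I'" "\<forall>u\<in>F0 (i + e * l). phi_span f' I' u"
  shows "dim (range \<iota>) (F0 i) \<le> card I * card I'"
proof (rule ccontr)
  assume big: "\<not> ?thesis"
  let ?n = "dim (range \<iota>) (F0 i)"
  obtain a where a: "a \<in> {..<?n} \<rightarrow> F0 i" "lin_indep a {..<?n}"
    and "\<And>v. v \<in> F0 i \<Longrightarrow> \<exists>g\<in>{..<?n} \<rightarrow> range \<iota>. v = (\<Oplus>s\<in>{..<?n}. g s \<otimes> a s)"
    using exists_basis[OF finite_dimension_filtration[OF S0(1,2)]] by blast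
  have ac: "a s \<in> carrier A" if "s \<in> {..<?n}" for s
    using F0_carrier[of "a s" i] a(1) that by blast
  have fc: "f t \<in> carrier A" if "t \<in> I" for t
    using F0_carrier[of "f t" "e * l"] I(2) that by blast
  \<comment> \<open>Coordinates, with respect to the family \<open>f'\<close>, of the vectors of the
    products \<open>a s \<otimes> f t\<close>, which lie in the step
    \<open>i + e * l\<close>.\<close>
  have "\<forall>z\<in>{..<?n} \<times> I. \<exists>g. (\<forall>k\<in>I'. g k \<in> Q_field m)
      \<and> (\<forall>b\<in>carrier A. \<phi> (b \<otimes> (a (fst z) \<otimes> f (snd z))) = (\<Sum>k\<in>I'. g k * \<phi> (b \<otimes> f' k)))"
  proof
    fix z assume z: "z \<in> {..<?n} \<times> I"
    have "a (fst z) \<otimes> f (snd z) \<in> F0 (i + e * l)"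
      using z a(1) I(2) by (intro filtration_mult[OF S0(1)]) auto
    then show "\<exists>g. (\<forall>k\<in>I'. g k \<in> Q_field m)
      \<and> (\<forall>b\<in>carrier A. \<phi> (b \<otimes> (a (fst z) \<otimes> f (snd z))) = (\<Sum>k\<in>I'. g k * \<phi> (b \<otimes> f' k)))"
      using I'(2) unfolding phi_span_def by (rule bspec[rotated])
  qed
  from bchoice[OF this] obtain G where G: "\<forall>z\<in>{..<?n} \<times> I. (\<forall>k\<in>I'. G z k \<in> Q_field m)
      \<and> (\<forall>b\<in>carrier A. \<phi> (b \<otimes> (a (fst z) \<otimes> f (snd z))) = (\<Sum>k\<in>I'. G z k * \<phi> (b \<otimes> f' k)))" by (rule exE)
  have GQ: "G (s, t) k \<in> Q_field m" if "s \<in> {..<?n}" "t \<in> I" "k \<in> I'" for s t k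
    using G that by simp
  have G\<phi>: "\<phi> (b \<otimes> (a s \<otimes> f t)) = (\<Sum>k\<in>I'. G (s, t) k * \<phi> (b \<otimes> f' k))"
    if "s \<in> {..<?n}" "t \<in> I" "b \<in> carrier A" for s t b
    using bspec[OF G, of "(s, t)"] that by simp
  \<comment> \<open>A combination of the \<open>a s\<close> kills the vectors of all
    \<open>f t\<close> as soon as \<open>card I * card I'\<close> linear equations hold, one per
    entry of a matrix; by assumption there are more unknowns.\<close>
  have "\<exists>q. (\<forall>s\<in>{..<?n}. q s \<in> Q_field m) \<and> (\<exists>s\<in>{..<?n}. q s \<noteq> 0)
      \<and> (\<forall>z\<in>I \<times> I'. (\<Sum>s\<in>{..<?n}. q s * G (s, fst z) (snd z)) = 0)"
  proof (rule homogeneous_system[where K = "Q_field m"])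
    show "card (I \<times> I') < card {..<?n}" using big by (simp add: card_cartesian_product)
    show "G (s, fst z) (snd z) \<in> Q_field m" if "s \<in> {..<?n}" "z \<in> I \<times> I'" for s z
      using that by (intro GQ) auto
  qed (use I(1) I'(1) in \<open>auto intro: Q_field_closed\<close>)
  then obtain q where q: "\<And>s. s \<in> {..<?n} \<Longrightarrow> q s \<in> Q_field m" "\<exists>s\<in>{..<?n}. q s \<noteq> 0"
    and q0: "\<And>t k. \<lbrakk>t \<in> I; k \<in> I'\<rbrakk> \<Longrightarrow> (\<Sum>s\<in>{..<?n}. q s * G (s, t) k) = 0" by auto
  define Z where "Z = (\<Oplus>\<^bsub>T.B\<^esub>s\<in>{..<?n}. T.pt (q s) (a s))"
  have ZF: "Z \<in> F1 (c * i)"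
    unfolding Z_def
  proof (rule BB.subspace_finsum[OF BB.subspace_filtration[OF S1(1)]])
    show "T.pt (q s) (a s) \<in> F1 (c * i)" if "s \<in> {..<?n}" for s
      using q(1)[OF that] a(1) that by (intro c) auto
  qed
  have Zc: "Z \<in> carrier T.B" by (rule F1_carrier[OF ZF])
  \<comment> \<open>The coefficient-reading operator for an \<open>s\<close> with
    \<open>q s \<noteq> 0\<close> maps \<open>Z\<close> to a nonzero scalar.\<close>
  have "Z \<noteq> \<zero>\<^bsub>T.B\<^esub>"
  proof
    assume Z0: "Z = \<zero>\<^bsub>T.B\<^esub>"
    obtain s where s: "s \<in> {..<?n}" "q s \<noteq> 0" using q(2) by blast
    have ac': "a \<in> {..<?n} \<rightarrow> carrier A" using ac by blast
    obtain T' where T': "T' \<in> mult_ops T.B"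
      "\<forall>q\<in>{..<?n} \<rightarrow> Q_field m. T' (\<Oplus>\<^bsub>T.B\<^esub>t\<in>{..<?n}. T.pt (q t) (a t)) = T.pt (q s) \<one>"
      using mult_op_lift_separate[OF simple centre finite_lessThan a(2) ac' s(1)] by (elim bexE)
    have "q \<in> {..<?n} \<rightarrow> Q_field m" using q(1) by blast
    then have "T' Z = T.pt (q s) \<one>" using T'(2) unfolding Z_def by (rule bspec[rotated])
    then have "T.pt (q s) \<one> = \<zero>\<^bsub>T.B\<^esub>" using Z0 T.B.mult_ops_zero[OF T'(1)] by simp
    then show False using pt_neq_zero[OF q(1)[OF s(1)] s(2)] by simp
  qed
  then have one: "\<one>\<^bsub>T.B\<^esub> \<in> spanB {x \<otimes>\<^bsub>T.B\<^esub> Z \<otimes>\<^bsub>T.B\<^esub> w |x w. x \<in> carrier T.B \<and> w \<in> F1 l}"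
    using r ZF unfolding returns_def by simp
  \<comment> \<open>The vector of \<open>u\<close> is a combination of those of the
    \<open>f t\<close>. After interchanging the sums, the inner sum over \<open>s\<close> is one of
    the equations solved by \<open>q\<close>.\<close>
  have kill: "act (Z \<otimes>\<^bsub>T.B\<^esub> emb u) \<phi> b = 0" if u: "u \<in> F0 (e * l)" and b: "b \<in> carrier A" for u b
  proof -
    have uc: "u \<in> carrier A" by (rule F0_carrier[OF u])
    have lu: "lin (act (emb u) \<phi>)" by (rule lin_act[OF emb_closed[OF uc] lin_\<phi>])
    obtain g where g: "\<forall>t\<in>I. g t \<in> Q_field m" "\<forall>b\<in>carrier A. \<phi> (b \<otimes> u) = (\<Sum>t\<in>I. g t * \<phi> (b \<otimes> f t))"
      using bspec[OF I(3) u] unfolding phi_span_def by (elim exE conjE)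
    have "act (Z \<otimes>\<^bsub>T.B\<^esub> emb u) \<phi> b = act Z (act (emb u) \<phi>) b"
      by (rule act_mult[OF Zc emb_closed[OF uc] lin_\<phi> b])
    also have "\<dots> = (\<Sum>s\<in>{..<?n}. q s * act (emb u) \<phi> (b \<otimes> a s))"
      unfolding Z_def by (rule act_finsum[OF lu b finite_lessThan q(1) ac])
    also have "\<dots> = (\<Sum>s\<in>{..<?n}. q s * (\<Sum>t\<in>I. g t * (\<Sum>k\<in>I'. G (s, t) k * \<phi> (b \<otimes> f' k))))"
    proof (rule sum.cong[OF refl])
      fix s assume s: "s \<in> {..<?n}"
      have "act (emb u) \<phi> (b \<otimes> a s) = \<phi> (b \<otimes> a s \<otimes> u)"
        using act_pt[OF lin_\<phi> _ Q_field_closed(2) uc, of "b \<otimes> a s"] b ac[OF s] by simp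
      also have "\<dots> = (\<Sum>t\<in>I. g t * \<phi> (b \<otimes> a s \<otimes> f t))" using g(2) b ac[OF s] by simp
      also have "\<dots> = (\<Sum>t\<in>I. g t * (\<Sum>k\<in>I'. G (s, t) k * \<phi> (b \<otimes> f' k)))"
        using G\<phi>[OF s _ b] b ac[OF s] fc by (intro sum.cong refl) (simp add: m_assoc)
      finally show "q s * act (emb u) \<phi> (b \<otimes> a s) = q s * (\<Sum>t\<in>I. g t * (\<Sum>k\<in>I'. G (s, t) k * \<phi> (b \<otimes> f' k)))"
        by (rule arg_cong)
    qed
    also have "\<dots> = (\<Sum>s\<in>{..<?n}. \<Sum>t\<in>I. \<Sum>k\<in>I'. g t * \<phi> (b \<otimes> f' k) * (q s * G (s, t) k))"
      by (simp add: sum_distrib_left mult_ac)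
    also have "\<dots> = (\<Sum>t\<in>I. \<Sum>s\<in>{..<?n}. \<Sum>k\<in>I'. g t * \<phi> (b \<otimes> f' k) * (q s * G (s, t) k))"
      by (rule sum.swap)
    also have "\<dots> = (\<Sum>t\<in>I. \<Sum>k\<in>I'. \<Sum>s\<in>{..<?n}. g t * \<phi> (b \<otimes> f' k) * (q s * G (s, t) k))"
      by (intro sum.cong refl sum.swap)
    also have "\<dots> = (\<Sum>t\<in>I. \<Sum>k\<in>I'. g t * \<phi> (b \<otimes> f' k) * (\<Sum>s\<in>{..<?n}. q s * G (s, t) k))"
      by (simp only: sum_distrib_left)
    also have "\<dots> = 0" using q0 by simp
    finally show ?thesis .
  qed
  \<comment> \<open>A subspace over \<open>Qs\<close>, because scalars commute with
    \<open>Z\<close>. Therefore it contains \<open>F1 l\<close> once it contains the image of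
    \<open>F0 (e * l)\<close>.\<close>
  let ?K1 = "{w \<in> carrier T.B. \<forall>b\<in>carrier A. act (Z \<otimes>\<^bsub>T.B\<^esub> w) \<phi> b = 0}"
  have "subalgebra Qs ?K1 T.B"
  proof (rule BB.subspaceI)
    show "\<zero>\<^bsub>T.B\<^esub> \<in> ?K1" using act_zero[OF lin_\<phi>] Zc by simp
    show "x \<oplus>\<^bsub>T.B\<^esub> z \<in> ?K1" if "x \<in> ?K1" "z \<in> ?K1" for x z
      using that act_add[OF lin_\<phi>] Zc by (simp add: T.B.r_distr)
    show "d \<otimes>\<^bsub>T.B\<^esub> x \<in> ?K1" if d: "d \<in> Qs" and x: "x \<in> ?K1" for d x
    proof -
      have dc: "d \<in> carrier T.B" using BB.scalars_in_carrier d by (rule subsetD)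
      have xc: "x \<in> carrier T.B" using x by simp
      have "Z \<otimes>\<^bsub>T.B\<^esub> (d \<otimes>\<^bsub>T.B\<^esub> x) = (Z \<otimes>\<^bsub>T.B\<^esub> d) \<otimes>\<^bsub>T.B\<^esub> x" using Zc dc xc by (simp add: T.B.m_assoc)
      also have "Z \<otimes>\<^bsub>T.B\<^esub> d = d \<otimes>\<^bsub>T.B\<^esub> Z" using BB.central[OF d Zc] by simp
      finally have eq: "Z \<otimes>\<^bsub>T.B\<^esub> (d \<otimes>\<^bsub>T.B\<^esub> x) = d \<otimes>\<^bsub>T.B\<^esub> (Z \<otimes>\<^bsub>T.B\<^esub> x)" using Zc dc xc by (simp add: T.B.m_assoc)
      have "Z \<otimes>\<^bsub>T.B\<^esub> x \<in> {Z \<in> carrier T.B. \<forall>b\<in>carrier A. act Z \<phi> b = 0}" using x Zc by simp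
      from BB.subspaceD(4)[OF annihilator_subspace d this]
      show ?thesis using dc xc unfolding eq[symmetric] by simp
    qed
  qed auto
  moreover have "emb ` F0 (e * l) \<subseteq> ?K1"
    by (rule image_subsetI) (use kill emb_closed[OF F0_carrier] in simp)
  ultimately have "spanB (emb ` F0 (e * l)) \<subseteq> ?K1" by (rule BB.subspace_span_least)
  with e[of l] have K1: "F1 l \<subseteq> ?K1" by (rule subset_trans)
  let ?K = "{Z \<in> carrier T.B. \<forall>b\<in>carrier A. act Z \<phi> b = 0}"
  have "x \<otimes>\<^bsub>T.B\<^esub> Z \<otimes>\<^bsub>T.B\<^esub> w \<in> ?K" if x: "x \<in> carrier T.B" and w: "w \<in> F1 l" for x w
  proof -
    have w1: "w \<in> ?K1" using K1 w by (rule subsetD)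
    then have wc: "w \<in> carrier T.B" by simp
    have Zw: "Z \<otimes>\<^bsub>T.B\<^esub> w \<in> carrier T.B" using Zc wc by simp
    have "act (x \<otimes>\<^bsub>T.B\<^esub> (Z \<otimes>\<^bsub>T.B\<^esub> w)) \<phi> b = 0" if b: "b \<in> carrier A" for b
      unfolding act_mult[OF x Zw lin_\<phi> b]
      by (rule act_vanish[OF x lin_act[OF Zw lin_\<phi>] _ b]) (use w1 in simp)
    then show ?thesis using x Zc wc by (simp add: T.B.m_assoc)
  qed
  then have "{x \<otimes>\<^bsub>T.B\<^esub> Z \<otimes>\<^bsub>T.B\<^esub> w |x w. x \<in> carrier T.B \<and> w \<in> F1 l} \<subseteq> ?K" by blast
  then have "spanB {x \<otimes>\<^bsub>T.B\<^esub> Z \<otimes>\<^bsub>T.B\<^esub> w |x w. x \<in> carrier T.B \<and> w \<in> F1 l} \<subseteq> ?K"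
    by (rule BB.subspace_span_least[OF annihilator_subspace])
  then have "\<one>\<^bsub>T.B\<^esub> \<in> ?K" using one by (rule subsetD)
  \<comment> \<open>The annihilator of \<open>\<phi>\<close> would contain the unit, yet
    \<open>\<phi>\<close> has value \<open>1\<close> at \<open>\<one>\<close>.\<close>
  then have "act (emb \<one>) \<phi> \<one> = 0" by (simp add: emb_one)
  then show False by (simp add: act_pt[OF lin_\<phi>] Q_field_closed \<phi>_one)
qed

text \<open>The rank function \<open>u\<close> and the constants are fixed before \<open>l\<close>
  is quantified, so the same data serve for either return function.\<close>

theorem rank_comparison:
  assumes N: "0 \<le> N" "growth_degree (\<lambda>i. dim (range \<iota>) (F0 i)) = ennreal N"
  obtains u h c e where "\<And>l. (\<And>i. returns (l i) i) \<Longrightarrow>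
    growth_comparison (\<lambda>i. dim (range \<iota>) (F0 i)) u l h c e m N"
proof -
  obtain c where c: "0 < c" "\<And>i q a. \<lbrakk>q \<in> Q_field m; a \<in> F0 i\<rbrakk> \<Longrightarrow> T.pt q a \<in> F1 (c * i)"
    using pt_in_F1 by auto
  obtain e where e: "\<And>j. F1 j \<subseteq> spanB (emb ` F0 (e * j))" using F1_in_span by auto
  obtain h where h: "0 < h" and hb: "\<forall>i I (f :: nat \<Rightarrow> 'a). finite I \<longrightarrow> f \<in> I \<rightarrow> F0 i \<longrightarrow> phi_indep f I \<longrightarrow>
    card I * i ^ m \<le> dim (range \<iota>) (F0 (h * i))"
    using rank_times_power_le by (elim exE conjE)
  define P where "P i z \<longleftrightarrow> finite (snd z) \<and> fst z \<in> snd z \<rightarrow> F0 i \<and> phi_indep (fst z) (snd z)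
    \<and> (\<forall>u\<in>F0 i. phi_span (fst z) (snd z) u)" for i and z :: "(nat \<Rightarrow> 'a) \<times> nat set"
  have "\<exists>z. P i z" for i using exists_phi_basis[of i] unfolding P_def by auto
  then obtain z where z: "\<And>i. P i (z i)" by metis
  define u where "u i = card (snd (z i))" for i
  show ?thesis
  proof (rule that[of u h c e])
    fix l assume r: "\<And>i. returns (l i) i"
    show "growth_comparison (\<lambda>i. dim (range \<iota>) (F0 i)) u l h c e m N"
    proof (rule growth_comparison.intro)
      show "1 \<le> u i" for i
      proof -
        have "snd (z i) \<noteq> {}"
          by (rule phi_basis_nonempty[of i "fst (z i)"]) (use z[of i] in \<open>simp add: P_def\<close>)
        then show ?thesis using z[of i] unfolding u_def P_def by (simp add: Suc_le_eq card_gt_0_iff)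
      qed
      show "u i * i ^ m \<le> dim (range \<iota>) (F0 (h * i))" for i
        unfolding u_def
        by (rule hb[rule_format, of "snd (z i)" "fst (z i)"]) (use z[of i] in \<open>simp_all add: P_def\<close>)
      show "dim (range \<iota>) (F0 i) \<le> u (e * l (c * i)) * u (i + e * l (c * i))" for i
        unfolding u_def
        by (rule dim_le_card_mult[where f = "fst (z (e * l (c * i)))"
              and f' = "fst (z (i + e * l (c * i)))", OF c(2) e r])
          (use z[of "e * l (c * i)"] z[of "i + e * l (c * i)"] in \<open>simp_all add: P_def\<close>)
    qed (use h c(1) N in simp_all)
  qed
qed

end

section \<open>The bound for commutative subalgebras\<close>

text \<open>Here \<open>g\<close> is the filter dimension at the given \<open>m\<close> and
  \<open>f\<close> the maximum. For finite \<open>f\<close> the estimate is monotone in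
  \<open>d\<close>, so \<open>d\<close> may be replaced by \<open>f\<close> and the inequality
  solved for \<open>m\<close>. For infinite \<open>f\<close> the fraction is zero and
  \<open>m \<le> N\<close> is what remains.\<close>

lemma ennreal_bound:
  fixes g f :: ennreal
  assumes N: "0 \<le> N" "real m \<le> N" and "g \<le> f"
    and g: "\<And>d. \<lbrakk>0 \<le> d; g = ennreal d\<rbrakk> \<Longrightarrow> N \<le> (N - real m) * (d + max d 1)"
  shows "of_nat m \<le> ennreal N * (1 - 1 / (f + max f 1))"
proof (cases f)
  case top
  then show ?thesis using N by (simp add: ennreal_of_nat_eq_real_of_nat)
next
  case (real x)
  obtain d where d: "0 \<le> d" "g = ennreal d" using \<open>g \<le> f\<close> real by (cases g) (auto simp: top_unique)
  have dx: "d \<le> x" using \<open>g \<le> f\<close> d real by simp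
  define s where "s = x + max x 1"
  have s: "1 \<le> s" using real by (simp add: s_def)
  have "N \<le> (N - real m) * (d + max d 1)" by (rule g[OF d])
  also have "\<dots> \<le> (N - real m) * s"
    unfolding s_def using dx N by (intro mult_left_mono add_mono max.mono) auto
  finally have "N / s \<le> N - real m" using s by (simp add: pos_divide_le_eq)
  then have m: "real m \<le> N * (1 - 1 / s)" by (simp add: right_diff_distrib)
  have "max f 1 = ennreal (max x 1)"
    using real by (simp add: max_def ennreal_le_1 flip: ennreal_1)
  then have fs: "f + max f 1 = ennreal s" using real by (simp add: s_def ennreal_plus[symmetric] del: ennreal_plus)
  have "1 / (f + max f 1) = ennreal (1 / s)"
    unfolding fs using s divide_ennreal[of 1 s] by simp
  then have "1 - 1 / (f + max f 1) = ennreal (1 - 1 / s)"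
    using s ennreal_minus[of "1 / s" 1] by simp
  then have "ennreal N * (1 - 1 / (f + max f 1)) = ennreal (N * (1 - 1 / s))"
    using N s by (simp add: ennreal_mult)
  then show ?thesis using m by (simp add: ennreal_of_nat_eq_real_of_nat ennreal_leI)
qed

text \<open>Here the estimates are tied to the definitions: \<open>S0\<close> and \<open>S1\<close>
  are literally the generating sets selected by \<open>SOME\<close> in \<open>GK_dim\<close> and in
  the filter dimension, so the filtrations of the locale are the ones being measured.\<close>

lemma (in independent_elements) independent_count_bound:
  assumes simple: "simple_ring A" and centre: "ring_centre A = range \<iota>"
    and fg: "finitely_generated_algebra A (range \<iota>) (carrier A)"
    and N: "0 \<le> N" "GK_dim A (range \<iota>) (carrier A) = ennreal N"
    and d: "d = filter_dim \<or> d = left_filter_dim"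
  shows "real m \<le> N"
    and "\<And>x. \<lbrakk>0 \<le> x; d (ratfun_extension m A \<iota>) (ratfun_scalars m A \<iota>) = ennreal x\<rbrakk> \<Longrightarrow>
      N \<le> (N - real m) * (x + max x 1)"
proof -
  define S0 where "S0 = (SOME S. algebra_generators A (range \<iota>) (carrier A) S)"
  have S0: "algebra_generators A (range \<iota>) (carrier A) S0"
    unfolding S0_def using fg unfolding finitely_generated_algebra_def by (rule someI_ex)
  obtain \<phi> where \<phi>: "\<And>a. a \<in> carrier A \<Longrightarrow> \<phi> a \<in> Q_field m" "\<phi> \<one> = 1"
    "\<And>a b. \<lbrakk>a \<in> carrier A; b \<in> carrier A\<rbrakk> \<Longrightarrow> \<phi> (a \<oplus> b) = \<phi> a + \<phi> b"
    "\<And>a p. \<lbrakk>a \<in> carrier A; p \<in> mpolys m\<rbrakk> \<Longrightarrow> \<phi> (a \<otimes> ev p) = Fract p 1 * \<phi> a"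
    using exists_functional by blast
  interpret M: module_functional A \<iota> C y m \<phi>
    by (intro module_functional.intro module_functional_axioms.intro independent_elements_axioms \<phi>)
  define S1 where "S1 = (SOME S. algebra_generators M.T.B M.Qs (carrier M.T.B) S)"
  have S0': "S0 \<subseteq> carrier A" "finite S0" "generate_ring A (range \<iota> \<union> S0) = carrier A"
    using S0 unfolding algebra_generators_def by auto
  \<comment> \<open>The extended algebra is finitely generated over its scalars, so the choice
    behind \<open>S1\<close> does yield a generating set.\<close>
  have "algebra_generators M.T.B M.Qs (carrier M.T.B) (M.emb ` S0)"
    unfolding algebra_generators_def
  proof (intro conjI)
    show "M.emb ` S0 \<subseteq> carrier M.T.B"
      by (rule image_subsetI, rule M.emb_closed, rule subsetD[OF S0'(1)])
    show "finite (M.emb ` S0)" using S0'(2) by (rule finite_imageI)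
    show "generate_ring M.T.B (M.Qs \<union> M.emb ` S0) = carrier M.T.B"
      by (rule M.generate_extension[OF S0'(1,3)])
  qed
  then have S1: "algebra_generators M.T.B M.Qs (carrier M.T.B) S1"
    unfolding S1_def by (rule someI)
  then have S1': "S1 \<subseteq> carrier M.T.B" "finite S1" "generate_ring M.T.B (M.Qs \<union> S1) = carrier M.T.B"
    unfolding algebra_generators_def by auto
  interpret E: extended_algebra A \<iota> C y m \<phi> S0 S1
    by (intro extended_algebra.intro extended_algebra_axioms.intro M.module_functional_axioms
        simple centre S0' S1')
  have "growth_degree (\<lambda>i. dim (range \<iota>) (E.F0 i)) = ennreal N"
    using N(2) fg unfolding GK_dim_def fg_GK_dim_def chosen_filtration_def S0_def[symmetric] by simp
  then obtain u h c e where u: "\<And>l. (\<And>i. E.returns (l i) i) \<Longrightarrow>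
      growth_comparison (\<lambda>i. dim (range \<iota>) (E.F0 i)) u l h c e m N"
    using E.rank_comparison[OF N(1)] by blast
  have ext: "ratfun_extension m A \<iota> = M.T.B" by (simp add: ratfun_extension_def)
  have "\<exists>l. d (ratfun_extension m A \<iota>) M.Qs = growth_degree l \<and> (\<forall>i. E.returns (l i) i)"
    using d
  proof (rule disjE)
    assume d: "d = filter_dim"
    have "d (ratfun_extension m A \<iota>) M.Qs = growth_degree (return_function M.T.B M.Qs E.F1)"
      unfolding d ext filter_dim_def chosen_filtration_def S1_def by (rule refl)
    then show ?thesis using E.returns_return_function by blast
  next
    assume d: "d = left_filter_dim"
    have "d (ratfun_extension m A \<iota>) M.Qs = growth_degree (left_return_function M.T.B M.Qs E.F1)"
      unfolding d ext left_filter_dim_def chosen_filtration_def S1_def by (rule refl)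
    then show ?thesis using E.returns_left_return_function by blast
  qed
  then obtain l where l: "d (ratfun_extension m A \<iota>) M.Qs = growth_degree l" "\<And>i. E.returns (l i) i"
    by blast
  interpret G: growth_comparison "\<lambda>i. dim (range \<iota>) (E.F0 i)" u l h c e m N
    by (rule u[OF l(2)])
  show "real m \<le> N" by (rule G.m_le_N)
  show "N \<le> (N - real m) * (x + max x 1)"
    if "0 \<le> x" "d (ratfun_extension m A \<iota>) M.Qs = ennreal x" for x
    by (rule G.N_le) (use that l(1) in simp_all)
qed

theorem theorem1p5:
  fixes A :: "('a, 'b) ring_scheme"
    and \<iota> :: "'k::field \<Rightarrow> 'a"
    and C :: "'a set"
    and d :: "(('k ratfun \<times> 'a) \<Rightarrow>\<^sub>0 int) set ring \<Rightarrow> (('k ratfun \<times> 'a) \<Rightarrow>\<^sub>0 int) set set \<Rightarrow> ennreal"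
  assumes "\<iota> \<in> ring_hom ring_of_type_algebra A"
    and "ring_centre A = range \<iota>"
    and "simple_ring A"
    and "finitely_generated_algebra A (range \<iota>) (carrier A)"
    and "0 < GK_dim A (range \<iota>) (carrier A)"
    and "GK_dim A (range \<iota>) (carrier A) < \<infinity>"
    and "subcring C A"
    and "range \<iota> \<subseteq> C"
    and "d = filter_dim \<or> d = left_filter_dim"
  shows "let n = GK_dim A (range \<iota>) (carrier A);
             f = Max ((\<lambda>m. d (ratfun_extension m A \<iota>) (ratfun_scalars m A \<iota>)) ` {m. of_nat m \<le> n})
         in GK_dim A (range \<iota>) C \<le> n * (1 - 1 / (f + max f 1))"
proof -
  define n where "n = GK_dim A (range \<iota>) (carrier A)"
  define f where "f = Max ((\<lambda>m. d (ratfun_extension m A \<iota>) (ratfun_scalars m A \<iota>)) ` {m. of_nat m \<le> n})"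
  obtain N where N: "0 \<le> N" "n = ennreal N"
    using assms(6) unfolding n_def[symmetric] by (cases n) auto
  interpret ring A using assms(3) by (simp add: simple_ring_def)
  interpret field_algebra A \<iota>
  proof (intro field_algebra.intro field_algebra_axioms.intro)
    show "ring A" by (rule ring_axioms)
    show "\<iota> \<in> ring_hom ring_of_type_algebra A" by (rule assms(1))
    show "\<one>\<^bsub>A\<^esub> \<noteq> \<zero>\<^bsub>A\<^esub>" using assms(3) one_zeroD unfolding simple_ring_def by blast
    show "\<iota> c \<otimes>\<^bsub>A\<^esub> a = a \<otimes>\<^bsub>A\<^esub> \<iota> c" if "a \<in> carrier A" for a c
    proof -
      have "\<iota> c \<in> ring_centre A" unfolding assms(2) by (rule rangeI)
      then show ?thesis using that unfolding ring_centre_def by simp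
    qed
  qed
  \<comment> \<open>\<open>Max\<close> is meaningful for finite sets only; the finiteness of the
    dimension of \<open>A\<close> provides this.\<close>
  have fin: "finite {m. of_nat m \<le> n}"
  proof (rule finite_subset[of _ "{..nat \<lceil>N\<rceil>}"])
    show "{m. of_nat m \<le> n} \<subseteq> {..nat \<lceil>N\<rceil>}"
    proof
      fix m :: nat assume "m \<in> {m. of_nat m \<le> n}"
      then have "real m \<le> N" using N by (simp add: ennreal_of_nat_eq_real_of_nat)
      then show "m \<in> {..nat \<lceil>N\<rceil>}" by simp linarith
    qed
  qed simp
  have fg: "fg_GK_dim A (range \<iota>) D \<le> n * (1 - 1 / (f + max f 1))"
    if D: "D \<subseteq> C" "finitely_generated_algebra A (range \<iota>) D" for D
  proof -
    define S where "S = (SOME S. algebra_generators A (range \<iota>) D S)"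
    have "algebra_generators A (range \<iota>) D S"
      unfolding S_def using D(2) unfolding finitely_generated_algebra_def by (rule someI_ex)
    then have S: "finite S" "generate_ring A (range \<iota> \<union> S) = D"
      unfolding algebra_generators_def by auto
    have SC: "S \<subseteq> C" using D(1) generate_ring.incl[of _ "range \<iota> \<union> S" A] unfolding S(2)[symmetric] by blast
    obtain g where g: "bij_betw g {0..<card S} S" using ex_bij_betw_nat_finite[OF S(1)] by blast
    \<comment> \<open>An enumeration of the generators, continued by \<open>\<one>\<close> to a
      sequence all of whose members lie in \<open>C\<close>.\<close>
    define y where "y t = (if t < card S then g t else \<one>\<^bsub>A\<^esub>)" for t
    have yS: "y ` {..<card S} = S"
      using bij_betw_imp_surj_on[OF g] by (auto simp: y_def lessThan_atLeast0)
    have yC: "y t \<in> C" for t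
      using yS SC subcringE(3)[OF assms(7)] by (auto simp: y_def)
    interpret Y: commuting_elements A \<iota> C y "card S"
      by (intro commuting_elements.intro commuting_elements_axioms.intro field_algebra_axioms assms(7,8) yC)
    obtain h r where h: "independent_elements A \<iota> C (\<lambda>t. y (h t)) r"
      and r: "growth_degree (\<lambda>i. dim (range \<iota>) (Fil (y ` {..<card S}) i)) \<le> of_nat r"
      using Y.commutative_growth by blast
    interpret I: independent_elements A \<iota> C "\<lambda>t. y (h t)" r by (rule h)
    have bound: "real r \<le> N"
      "\<And>x. \<lbrakk>0 \<le> x; d (ratfun_extension r A \<iota>) (ratfun_scalars r A \<iota>) = ennreal x\<rbrakk> \<Longrightarrow>
        N \<le> (N - real r) * (x + max x 1)"
      using I.independent_count_bound[OF assms(3,2,4) N(1) _ assms(9)] N(2) unfolding n_def by blast+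
    \<comment> \<open>This places \<open>r\<close> among the values of \<open>m\<close> over which
      the maximum \<open>f\<close> is formed.\<close>
    have "of_nat r \<le> n" using bound(1) N by (simp add: ennreal_of_nat_eq_real_of_nat ennreal_leI)
    then have "d (ratfun_extension r A \<iota>) (ratfun_scalars r A \<iota>) \<le> f"
      unfolding f_def using fin by (intro Max_ge) auto
    then have "of_nat r \<le> n * (1 - 1 / (f + max f 1))"
      unfolding N(2) by (rule ennreal_bound[OF N(1) bound(1) _ bound(2)])
    with r have "growth_degree (\<lambda>i. dim (range \<iota>) (Fil S i)) \<le> n * (1 - 1 / (f + max f 1))"
      unfolding yS by (rule order_trans)
    then show ?thesis unfolding fg_GK_dim_def chosen_filtration_def S_def[symmetric] .
  qed
  \<comment> \<open>Both branches of the definition are covered: \<open>C\<close> itself if it is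
    finitely generated, and otherwise the supremum over its finitely generated subalgebras.\<close>
  have "GK_dim A (range \<iota>) C \<le> n * (1 - 1 / (f + max f 1))"
    unfolding GK_dim_def using fg by (auto intro!: SUP_least)
  then show ?thesis unfolding Let_def n_def f_def .
qed

end
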